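(* Let $O=(p:X\to E^\star)$ be an origami with associated subgroup $H\subseteq F_2$, and let $\mathrm{Aff}^+(H):=\{\gamma\in\mathrm{Aut}^+(F_2)\mid \gamma(H)=H\}$. Then the Veech group of $O$ satisfies $$\Gamma(O)=\hat\beta(\mathrm{Aff}^+(H))\subseteq \mathrm{SL}_2(\mathbb{Z}).$$
   Context: Translation surfaces. A translation structure on a surface is an atlas all of whose transition maps are translations; a translation surface is a surface with such a structure. For a translation surface $Y$, $\mathrm{Aff}^+(Y)$ is the group of orientation preserving affine diffeomorphisms $Y\to Y$ (in charts of the form $z\mapsto Az+b$ with $A\in\mathrm{GL}_2(\mathbb{R})$, $\mathbb{C}\cong\mathbb{R}^2$). The linear part $A$ does not depend on the charts; this gives a homomorphism $\mathrm{der}:\mathrm{Aff}^+(Y)\to\mathrm{GL}_2(\mathbb{R})$, and $\Gamma(Y):=\mathrm{der}(\mathrm{Aff}^+(Y))$ is the Veech group of $Y$. Origamis. Let $\Lambda=\mathbb{Z}^2\subset\mathbb{C}$, $E=\mathbb{C}/\Lambda$, and $E^\star$ the torus $E$ with the image of $0$ removed, with the translation structure induced from $\mathbb{C}$. An origami $O$ is an unramified covering $p:X\to E^\star$ of finite degree $d$, where $X$ is connected and is obtained from a compact surface by removing finitely many points. $X$ carries the translation structure lifted from $E^\star$ via $p$, and $\Gamma(O):=\Gamma(X)$. Groups. Let $u:\mathbb{H}\to X$ be a universal covering ($\mathbb{H}$ the upper half plane); then $p\circ u:\mathbb{H}\to E^\star$ is a universal covering of $E^\star$. The deck transformation group $\mathrm{Gal}(\mathbb{H}/E^\star)\cong\pi_1(E^\star)$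 is identified with the free group $F_2=F_2(x,y)$, where $x$ and $y$ correspond to the canonical marking of $E^\star$, i.e. to the closed paths that are the images of horizontal and vertical segments from a point $Q\in\mathbb{C}-\Lambda$ to $Q+(1,0)^t$ and to $Q+(0,1)^t$, respectively. Put $H:=\mathrm{Gal}(\mathbb{H}/X)\subseteq\mathrm{Gal}(\mathbb{H}/E^\star)=F_2$. The map $\hat\beta$. For $\varphi\in\mathrm{Aut}(F_2)$ let $\hat\beta(\varphi)=\begin{pmatrix}a&b\\c&d\end{pmatrix}$, where $a,c$ are the exponent sums of $x$ and $y$ in $\varphi(x)$, and $b,d$ are the exponent sums of $x$ and $y$ in $\varphi(y)$. $\mathrm{Aut}^+(F_2)$ is the group of orientation preserving automorphisms, i.e. those with $\det\hat\beta(\varphi)=1$; thus $\hat\beta:\mathrm{Aut}^+(F_2)\to\mathrm{SL}_2(\mathbb{Z})$ (it is the canonical projection to $\mathrm{Out}^+(F_2)\cong\mathrm{SL}_2(\mathbb{Z})$). *)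

theory Defs
  imports "HOL-Analysis.Analysis" "HOL-Algebra.Bij"
begin

section \<open>Translation structures and Veech groups\<close>

text \<open>
  A chart of a surface \<open>Y\<close> is a pair of its domain and its coordinate function; only the values
  of the coordinate function on the domain matter.  Transition maps are required to be
  translations locally, i.e. on each component of an overlap, since overlaps need not be connected.
\<close>

type_synonym 'a chart = "'a set \<times> ('a \<Rightarrow> complex)"

definition translation_atlas :: "'a::topological_space set \<Rightarrow> 'a chart set \<Rightarrow> bool" where
  "translation_atlas Y \<A> \<longleftrightarrow>
     (\<Union>(U, \<phi>)\<in>\<A>. U) = Y \<and>
     (\<forall>(U, \<phi>)\<in>\<A>. openin (top_of_set Y) U \<and> open (\<phi> ` U) \<and> (\<exists>g. homeomorphism U (\<phi> ` U) \<phi> g)) \<and>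
     (\<forall>(U, \<phi>)\<in>\<A>. \<forall>(V, \<psi>)\<in>\<A>. \<forall>y\<in>U \<inter> V.
        \<exists>c W. openin (top_of_set Y) W \<and> y \<in> W \<and> W \<subseteq> U \<inter> V \<and> (\<forall>z\<in>W. \<psi> z = \<phi> z + c))"

definition lift_atlas ::
    "'a::topological_space set \<Rightarrow> ('a \<Rightarrow> 'b) \<Rightarrow> 'b chart set \<Rightarrow> 'a chart set" where
  "lift_atlas X p \<A> =
     {(U, s \<circ> p) | U V s. (V, s) \<in> \<A> \<and> openin (top_of_set X) U \<and> inj_on p U \<and> p ` U \<subseteq> V}"

definition real2_of_complex :: "complex \<Rightarrow> real^2" where
  "real2_of_complex z = vector [Re z, Im z]"

text \<open>Near \<open>y\<close>, the map \<open>f\<close> reads \<open>z \<mapsto> A z + b\<close> in the given pair of charts.\<close>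

definition affine_near ::
    "'a::topological_space set \<Rightarrow> 'a chart \<Rightarrow> 'a chart \<Rightarrow> ('a \<Rightarrow> 'a) \<Rightarrow> 'a \<Rightarrow> real^2^2 \<Rightarrow> bool" where
  "affine_near Y c c' f y A \<longleftrightarrow>
     (\<exists>b W. openin (top_of_set Y) W \<and> y \<in> W \<and> W \<subseteq> fst c \<and> f ` W \<subseteq> fst c' \<and>
        (\<forall>z\<in>W. real2_of_complex (snd c' (f z)) = A *v real2_of_complex (snd c z) + b))"

definition self_homeos :: "'a::topological_space set \<Rightarrow> ('a \<Rightarrow> 'a) set" where
  "self_homeos Y = {f \<in> Bij Y. homeomorphism Y Y f (inv_into Y f)}"

text \<open>
  A homeomorphism that is affine with invertible linear part in all charts is automatically a
  diffeomorphism; it preserves the orientation iff the linear parts have positive determinant.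
\<close>

definition Aff_plus :: "'a::topological_space set \<Rightarrow> 'a chart set \<Rightarrow> ('a \<Rightarrow> 'a) set" where
  "Aff_plus Y \<A> = {f \<in> self_homeos Y.
     \<forall>c\<in>\<A>. \<forall>c'\<in>\<A>. \<forall>y\<in>fst c. f y \<in> fst c' \<longrightarrow> (\<exists>A. det A > 0 \<and> affine_near Y c c' f y A)}"

definition der :: "'a::topological_space set \<Rightarrow> 'a chart set \<Rightarrow> ('a \<Rightarrow> 'a) \<Rightarrow> real^2^2" where
  "der Y \<A> f = (THE A. \<forall>c\<in>\<A>. \<forall>c'\<in>\<A>. \<forall>y\<in>fst c. f y \<in> fst c' \<longrightarrow> affine_near Y c c' f y A)"

definition veech_group :: "'a::topological_space set \<Rightarrow> 'a chart set \<Rightarrow> (real^2^2) set" where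
  "veech_group Y \<A> = der Y \<A> ` Aff_plus Y \<A>"


section \<open>The torus and the once-punctured torus\<close>

definition Z2_lattice :: "complex set" where
  "Z2_lattice = {z. Re z \<in> \<int> \<and> Im z \<in> \<int>}"

lemma Z2_lattice_0 [simp]: "0 \<in> Z2_lattice"
  by (simp add: Z2_lattice_def)

lemma Z2_lattice_minus: "z \<in> Z2_lattice \<Longrightarrow> - z \<in> Z2_lattice"
  by (simp add: Z2_lattice_def)

lemma Z2_lattice_add: "z \<in> Z2_lattice \<Longrightarrow> w \<in> Z2_lattice \<Longrightarrow> z + w \<in> Z2_lattice"
  by (simp add: Z2_lattice_def)

quotient_type torus = complex / "\<lambda>z w. z - w \<in> Z2_lattice"
  morphisms rep_torus to_torus
proof (rule equivpI)
  show "reflp (\<lambda>z w. z - w \<in> Z2_lattice)"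
    by (simp add: reflp_def)
  show "symp (\<lambda>z w. z - w \<in> Z2_lattice)"
    by (metis (mono_tags, lifting) Z2_lattice_minus minus_diff_eq sympI)
  show "transp (\<lambda>z w. z - w \<in> Z2_lattice)"
    by (metis (mono_tags, lifting) diff_add_cancel add_diff_eq Z2_lattice_add transpI)
qed

lemma to_torus_eq_iff: "to_torus z = to_torus w \<longleftrightarrow> z - w \<in> Z2_lattice"
  by (rule torus.abs_eq_iff)

lemma to_torus_surj: "\<exists>z. e = to_torus z"
  by (metis Quotient_torus Quotient_def)

text \<open>The quotient topology.\<close>

instantiation torus :: topological_space
begin

definition open_torus :: "torus set \<Rightarrow> bool" where
  "open_torus U \<longleftrightarrow> open (to_torus -` U)"

instance
  by standard (auto simp: open_torus_def vimage_Union intro!: open_Int open_UN)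

end

definition E_star :: "torus set" where
  "E_star = - {to_torus 0}"

lemma open_torus_iff: "open U \<longleftrightarrow> open (to_torus -` U)"
  unfolding open_torus_def ..

lemma continuous_to_torus: "continuous_on UNIV to_torus"
  unfolding continuous_on_open_vimage[OF open_UNIV] by (simp add: open_torus_iff)

lemma open_to_torus_image:
  assumes "open U"
  shows "open (to_torus ` U)"
proof -
  have "to_torus -` to_torus ` U = (\<Union>l\<in>Z2_lattice. (+) l ` U)" (is "?L = ?R")
  proof
    show "?L \<subseteq> ?R"
    proof
      fix z assume "z \<in> ?L"
      then obtain w where "w \<in> U" "z - w \<in> Z2_lattice" by (auto simp: to_torus_eq_iff)
      moreover have "z = (z - w) + w" by simp
      ultimately show "z \<in> ?R" by blast
    qed
    show "?R \<subseteq> ?L"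
    proof
      fix z assume "z \<in> ?R"
      then obtain l w where "l \<in> Z2_lattice" "w \<in> U" "z = l + w" by auto
      then have "to_torus z = to_torus w" by (simp add: to_torus_eq_iff)
      then show "z \<in> ?L" using \<open>w \<in> U\<close> by simp
    qed
  qed
  then show ?thesis
    unfolding open_torus_iff using assms by (auto intro: open_translation)
qed

lemma Z2_lattice_small: "z \<in> Z2_lattice \<Longrightarrow> norm z < 1 \<Longrightarrow> z = 0"
proof -
  assume z: "z \<in> Z2_lattice" and "norm z < 1"
  then have "\<bar>Re z\<bar> < 1" "\<bar>Im z\<bar> < 1"
    using abs_Re_le_cmod[of z] abs_Im_le_cmod[of z] by linarith+
  with z show "z = 0"
    unfolding Z2_lattice_def by (auto elim!: Ints_cases simp: complex_eq_iff)
qed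

lemma inj_on_to_torus: "inj_on to_torus (ball z (1/2))"
proof (rule inj_onI)
  fix v w assume vw: "v \<in> ball z (1/2)" "w \<in> ball z (1/2)" "to_torus v = to_torus w"
  have "dist v w \<le> dist v z + dist w z" by (rule dist_triangle2)
  with vw have "norm (v - w) < 1" by (auto simp: dist_norm[symmetric] dist_commute)
  with vw Z2_lattice_small[of "v - w"] show "v = w" by (simp add: to_torus_eq_iff)
qed

lemma open_E_star: "open E_star"
proof -
  have "- to_torus -` E_star = Re -` \<int> \<inter> Im -` \<int>"
    by (auto simp: E_star_def to_torus_eq_iff Z2_lattice_def)
  moreover have "closed (Re -` \<int> \<inter> Im -` \<int>)"
    by (intro closed_Int continuous_closed_vimage closed_Ints) auto
  ultimately show ?thesis by (metis closed_open double_complement open_torus_iff)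
qed

text \<open>
  The charts of \<open>E_star\<close> are the local inverses of the projection from the complex plane.
\<close>

definition E_star_atlas :: "torus chart set" where
  "E_star_atlas =
     {(V, s). openin (top_of_set E_star) V \<and> continuous_on V s \<and> (\<forall>e\<in>V. to_torus (s e) = e)}"

lemma E_star_atlas_iff:
  "(V, s) \<in> E_star_atlas \<longleftrightarrow>
     open V \<and> V \<subseteq> E_star \<and> continuous_on V s \<and> (\<forall>e\<in>V. to_torus (s e) = e)"
  by (auto simp: E_star_atlas_def openin_open_eq[OF open_E_star])

lemma E_star_atlas_cover:
  assumes "e \<in> E_star"
  shows "\<exists>(V, s)\<in>E_star_atlas. e \<in> V"
proof -
  obtain z where z: "e = to_torus z" using to_torus_surj by blast
  define B where "B = ball z (1/2) \<inter> to_torus -` E_star"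
  have B: "open B" "z \<in> B" "inj_on to_torus B"
    using open_E_star assms z inj_on_subset[OF inj_on_to_torus[of z], of B]
    by (auto simp: B_def open_torus_iff)
  let ?s = "inv_into B to_torus"
  have cont: "continuous_on (to_torus ` B) ?s"
    unfolding continuous_on_open_vimage[OF open_to_torus_image[OF B(1)]]
  proof (intro allI impI)
    fix W :: "complex set" assume "open W"
    have "?s -` W \<inter> to_torus ` B = to_torus ` (B \<inter> W)"
      using B(3) by (auto simp: inv_into_f_f)
    then show "open (?s -` W \<inter> to_torus ` B)"
      using open_to_torus_image[of "B \<inter> W"] B(1) \<open>open W\<close> by auto
  qed
  have "(to_torus ` B, ?s) \<in> E_star_atlas"
    using cont open_to_torus_image[OF B(1)]
    by (auto simp: E_star_atlas_iff B_def f_inv_into_f)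
  then show ?thesis using B z by blast
qed

lemma E_star_section_open:
  assumes "(V, s) \<in> E_star_atlas" "open U" "U \<subseteq> V"
  shows "open (s ` U)"
  unfolding open_subopen[of "s ` U"]
proof
  fix z assume "z \<in> s ` U"
  then obtain e where e: "e \<in> U" "z = s e" by blast
  have V: "open V" "continuous_on V s" and s: "to_torus (s e) = e" if "e \<in> V" for e
    using assms(1) that by (auto simp: E_star_atlas_iff)
  define N where "N = ball z (1/2)"
  have "continuous_on U s" using V e assms continuous_on_subset by blast
  then have oU: "open (s -` N \<inter> U)"
    using assms(2) by (auto simp: N_def continuous_on_open_vimage)
  define T where "T = N \<inter> to_torus -` (s -` N \<inter> U)"
  have "open T" using oU by (auto simp: T_def N_def open_torus_iff)
  moreover have "z \<in> T" using e s[of e] assms(3) by (auto simp: T_def N_def)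
  moreover have "T \<subseteq> s ` U"
  proof
    fix w assume w: "w \<in> T"
    then have "to_torus (s (to_torus w)) = to_torus w" "s (to_torus w) \<in> N" "w \<in> N" "to_torus w \<in> U"
      using s assms(3) by (auto simp: T_def)
    then have "s (to_torus w) = w" using inj_on_to_torus[of z] by (auto simp: N_def inj_on_def)
    then show "w \<in> s ` U" using \<open>to_torus w \<in> U\<close> by force
  qed
  ultimately show "\<exists>T. open T \<and> z \<in> T \<and> T \<subseteq> s ` U" by blast
qed

lemma E_star_transition:
  assumes "(V, s) \<in> E_star_atlas" "(V', s') \<in> E_star_atlas" "e \<in> V" "e \<in> V'"
  shows "\<exists>c W. open W \<and> e \<in> W \<and> W \<subseteq> V \<inter> V' \<and> (\<forall>z\<in>W. s' z = s z + c)"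
proof -
  note a = assms(1,2)[unfolded E_star_atlas_iff]
  define c where "c = s' e - s e"
  define W where "W = (\<lambda>z. s' z - s z) -` ball c 1 \<inter> (V \<inter> V')"
  have "continuous_on (V \<inter> V') (\<lambda>z. s' z - s z)"
    using a by (intro continuous_intros) (auto elim: continuous_on_subset)
  moreover have "open (V \<inter> V')" using a by auto
  ultimately have "open W"
    unfolding W_def using continuous_on_open_vimage open_ball by blast
  moreover have "e \<in> W" using assms by (auto simp: W_def c_def)
  moreover have "s' z = s z + c" if "z \<in> W" for z
  proof -
    have "s' z - s z \<in> Z2_lattice" "c \<in> Z2_lattice"
      using a that assms(3,4) by (auto simp: W_def c_def to_torus_eq_iff[symmetric])
    then have "c - (s' z - s z) \<in> Z2_lattice"
      using Z2_lattice_add Z2_lattice_minus by (metis add_uminus_conv_diff)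
    moreover have "norm (c - (s' z - s z)) < 1" using that by (simp add: W_def dist_norm)
    ultimately have "c - (s' z - s z) = 0" by (rule Z2_lattice_small)
    then show ?thesis by (simp add: algebra_simps)
  qed
  ultimately show ?thesis unfolding W_def by blast
qed


section \<open>Origamis\<close>

text \<open>
  The compact surface is given as a topology on \<open>'a + nat\<close>.  This is no restriction: finitely many
  points can be added to \<open>X\<close> as elements of \<open>nat\<close>.
\<close>

definition compact_surface :: "'a topology \<Rightarrow> bool" where
  "compact_surface T \<longleftrightarrow>
     compact_space T \<and> Hausdorff_space T \<and> second_countable T \<and>
     (\<forall>x\<in>topspace T. \<exists>U (V :: complex set). openin T U \<and> x \<in> U \<and> open V \<and>
        subtopology T U homeomorphic_space top_of_set V)"

definition punctured_compact_surface :: "'a::topological_space set \<Rightarrow> bool" where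
  "punctured_compact_surface X \<longleftrightarrow>
     (\<exists>(T :: ('a + nat) topology) S. compact_surface T \<and> finite S \<and> S \<subseteq> topspace T \<and>
        top_of_set X homeomorphic_space subtopology T (topspace T - S))"

definition origami :: "nat \<Rightarrow> 'a::topological_space set \<Rightarrow> ('a \<Rightarrow> torus) \<Rightarrow> bool" where
  "origami d X p \<longleftrightarrow>
     covering_space X p E_star \<and>
     d > 0 \<and> (\<forall>e\<in>E_star. card {x \<in> X. p x = e} = d) \<and>
     connected X \<and> punctured_compact_surface X"

abbreviation origami_atlas :: "'a::topological_space set \<Rightarrow> ('a \<Rightarrow> torus) \<Rightarrow> 'a chart set" where
  "origami_atlas X p \<equiv> lift_atlas X p E_star_atlas"

lemma covering_E_star_open_map:
  assumes cov: "covering_space X p E_star" and "openin (top_of_set X) W"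
  shows "open (p ` W)"
  unfolding open_subopen[of "p ` W"]
proof
  fix e assume "e \<in> p ` W"
  then obtain x where x: "x \<in> W" "e = p x" by blast
  then have "x \<in> X" using assms(2) openin_imp_subset by blast
  obtain N T q where N: "x \<in> N" "openin (top_of_set X) N" "p x \<in> T"
      "openin (top_of_set E_star) T" "homeomorphism N T p q"
    using covering_space_local_homeomorphism[OF cov \<open>x \<in> X\<close>] by metis
  have "openin (top_of_set N) (W \<inter> N)"
    using assms(2) N(2) by (meson Int_lower2 openin_Int openin_imp_subset openin_subset_trans)
  then have "openin (top_of_set T) (p ` (W \<inter> N))"
    by (rule homeomorphism_imp_open_map[OF N(5)])
  then have "open (p ` (W \<inter> N))"
    using N(4) open_E_star openin_open_trans openin_trans by metis
  then show "\<exists>T. open T \<and> e \<in> T \<and> T \<subseteq> p ` W" using x N(1) by blast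
qed

lemma translation_atlas_origami:
  assumes cov: "covering_space X p E_star"
  shows "translation_atlas X (origami_atlas X p)"
proof -
  have contp: "continuous_on X p"
    using cov by (rule covering_space_imp_continuous)
  have px: "p x \<in> E_star" if "x \<in> X" for x
    using covering_space_imp_surjective[OF cov] that by blast
  have pre: "openin (top_of_set X) (X \<inter> p -` V)" if "open V" for V
    using contp that continuous_openin_preimage_gen by blast
  show ?thesis
    unfolding translation_atlas_def
  proof (intro conjI)
    have "x \<in> (\<Union>(U, \<phi>)\<in>origami_atlas X p. U)" if "x \<in> X" for x
    proof -
      obtain V s where V: "(V, s) \<in> E_star_atlas" "p x \<in> V"
        using E_star_atlas_cover[OF px[OF \<open>x \<in> X\<close>]] by auto
      obtain N T q where N: "x \<in> N" "openin (top_of_set X) N" "homeomorphism N T p q"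
        using covering_space_local_homeomorphism[OF cov \<open>x \<in> X\<close>] by metis
      have "inj_on p N" using N(3) by (metis homeomorphism_apply1 inj_onI)
      moreover have "open V" using V by (simp add: E_star_atlas_iff)
      ultimately have "(N \<inter> (X \<inter> p -` V), s \<circ> p) \<in> origami_atlas X p"
        unfolding lift_atlas_def using V N pre[of V] by (blast intro: openin_Int inj_on_subset)
      then show ?thesis using N V that by blast
    qed
    moreover have "(\<Union>(U, \<phi>)\<in>origami_atlas X p. U) \<subseteq> X"
      unfolding lift_atlas_def by (auto dest!: openin_imp_subset)
    ultimately show "(\<Union>(U, \<phi>)\<in>origami_atlas X p. U) = X" by blast
  next
    have charts: "openin (top_of_set X) U \<and> open ((s \<circ> p) ` U) \<and> (\<exists>g. homeomorphism U ((s \<circ> p) ` U) (s \<circ> p) g)"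
      if V: "(V, s) \<in> E_star_atlas" and U: "openin (top_of_set X) U" "inj_on p U" "p ` U \<subseteq> V" for U V s
    proof -
      have s: "continuous_on V s" "\<And>e. e \<in> V \<Longrightarrow> to_torus (s e) = e"
        using V by (auto simp: E_star_atlas_iff)
      have op: "open ((s \<circ> p) ` W)" if "openin (top_of_set U) W" for W
      proof -
        have "openin (top_of_set X) W" "W \<subseteq> U" using that U(1) openin_trans openin_imp_subset by blast+
        then have "open (s ` (p ` W))"
          using U(3) by (intro E_star_section_open[OF V] covering_E_star_open_map[OF cov]) auto
        then show ?thesis by (simp add: image_comp)
      qed
      have "inj_on s (p ` U)" using s(2) U(3) by (metis inj_on_def subsetD)
      then have "inj_on (s \<circ> p) U" using U(2) by (simp add: comp_inj_on)
      moreover have "continuous_on U (s \<circ> p)"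
        by (intro continuous_on_compose continuous_on_subset[OF s(1) U(3)]
            continuous_on_subset[OF contp openin_imp_subset[OF U(1)]])
      moreover have "openin (top_of_set ((s \<circ> p) ` U)) ((s \<circ> p) ` W)" if "openin (top_of_set U) W" for W
        using op[OF that] openin_imp_subset[OF that] by (intro open_subset image_mono)
      ultimately have "\<exists>g. homeomorphism U ((s \<circ> p) ` U) (s \<circ> p) g"
        using homeomorphism_injective_open_map[OF _ refl, of U "s \<circ> p"] by blast
      then show ?thesis using U op[of U] by simp
    qed
    show "\<forall>(U, \<phi>)\<in>origami_atlas X p.
        openin (top_of_set X) U \<and> open (\<phi> ` U) \<and> (\<exists>g. homeomorphism U (\<phi> ` U) \<phi> g)"
    proof (intro ballI, unfold split_paired_all case_prod_conv)
      fix U \<phi> assume "(U, \<phi>) \<in> origami_atlas X p"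
      then obtain V s where *: "\<phi> = s \<circ> p" "(V, s) \<in> E_star_atlas"
          "openin (top_of_set X) U" "inj_on p U" "p ` U \<subseteq> V"
        by (auto simp: lift_atlas_def)
      show "openin (top_of_set X) U \<and> open (\<phi> ` U) \<and> (\<exists>g. homeomorphism U (\<phi> ` U) \<phi> g)"
        unfolding *(1) by (rule charts[OF *(2-)])
    qed
  next
    have trans: "\<exists>c W. openin (top_of_set X) W \<and> y \<in> W \<and> W \<subseteq> U \<inter> U' \<and> (\<forall>z\<in>W. (s' \<circ> p) z = (s \<circ> p) z + c)"
      if V: "(V, s) \<in> E_star_atlas" "(V', s') \<in> E_star_atlas"
        and U: "openin (top_of_set X) U" "p ` U \<subseteq> V" "openin (top_of_set X) U'" "p ` U' \<subseteq> V'"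
        and y: "y \<in> U \<inter> U'" for U U' V V' s s' y
    proof -
      have "p y \<in> V" "p y \<in> V'" using U y by auto
      from E_star_transition[OF V this]
      obtain c W where W: "open W" "p y \<in> W" "\<forall>z\<in>W. s' z = s z + c" by metis
      have "openin (top_of_set X) (U \<inter> U' \<inter> (X \<inter> p -` W))"
        by (intro openin_Int U pre W(1))
      moreover have "y \<in> X" using y U openin_imp_subset by blast
      ultimately show ?thesis using W y
        by (intro exI[of _ c] exI[of _ "U \<inter> U' \<inter> (X \<inter> p -` W)"]) auto
    qed
    show "\<forall>(U, \<phi>)\<in>origami_atlas X p. \<forall>(V, \<psi>)\<in>origami_atlas X p. \<forall>y\<in>U \<inter> V.
        \<exists>c W. openin (top_of_set X) W \<and> y \<in> W \<and> W \<subseteq> U \<inter> V \<and> (\<forall>z\<in>W. \<psi> z = \<phi> z + c)"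
    proof (intro ballI, unfold split_paired_all case_prod_conv, intro ballI,
        unfold split_paired_all case_prod_conv, intro ballI)
      fix U \<phi> U' \<psi> y
      assume "(U, \<phi>) \<in> origami_atlas X p" "(U', \<psi>) \<in> origami_atlas X p" and y: "y \<in> U \<inter> U'"
      then obtain V s V' s' where *: "\<phi> = s \<circ> p" "\<psi> = s' \<circ> p"
          "(V, s) \<in> E_star_atlas" "(V', s') \<in> E_star_atlas" "openin (top_of_set X) U"
          "p ` U \<subseteq> V" "openin (top_of_set X) U'" "p ` U' \<subseteq> V'"
        by (auto simp: lift_atlas_def)
      show "\<exists>c W. openin (top_of_set X) W \<and> y \<in> W \<and> W \<subseteq> U \<inter> U' \<and> (\<forall>z\<in>W. \<psi> z = \<phi> z + c)"
        unfolding *(1,2) by (rule trans[OF *(3-) y])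
    qed
  qed
qed


section \<open>The free group on two generators\<close>

datatype gen = GX | GY

text \<open>The letter \<open>(g, True)\<close> stands for the generator \<open>g\<close>, and \<open>(g, False)\<close> for its inverse.\<close>

type_synonym letter = "gen \<times> bool"

definition inv_letter :: "letter \<Rightarrow> letter" where
  "inv_letter a = (fst a, \<not> snd a)"

definition reduced_word :: "letter list \<Rightarrow> bool" where
  "reduced_word w \<longleftrightarrow> successively (\<lambda>a b. b \<noteq> inv_letter a) w"

definition red_cons :: "letter \<Rightarrow> letter list \<Rightarrow> letter list" where
  "red_cons a w = (if w \<noteq> [] \<and> hd w = inv_letter a then tl w else a # w)"

definition F2 :: "letter list monoid" where
  "F2 = \<lparr>carrier = {w. reduced_word w}, mult = (\<lambda>v w. foldr red_cons v w), one = []\<rparr>"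

lemma inv_letter_inv [simp]: "inv_letter (inv_letter a) = a"
  by (simp add: inv_letter_def)

lemma reduced_word_Nil [simp]: "reduced_word []"
  by (simp add: reduced_word_def)

lemma reduced_word_Cons: "reduced_word (a # w) \<longleftrightarrow> reduced_word w \<and> (w \<noteq> [] \<longrightarrow> hd w \<noteq> inv_letter a)"
  by (cases w) (auto simp: reduced_word_def)

lemma reduced_red_cons: "reduced_word w \<Longrightarrow> reduced_word (red_cons a w)"
  by (cases w) (auto simp: red_cons_def reduced_word_Cons)

lemma reduced_foldr: "reduced_word w \<Longrightarrow> reduced_word (foldr red_cons v w)"
  by (induction v) (auto simp: reduced_red_cons)

lemma red_cons_cancel: "reduced_word w \<Longrightarrow> red_cons (inv_letter a) (red_cons a w) = w"
  by (cases w) (auto simp: red_cons_def reduced_word_Cons neq_Nil_conv)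

lemma red_cons_cancel': "reduced_word w \<Longrightarrow> red_cons a (red_cons (inv_letter a) w) = w"
  using red_cons_cancel[of w "inv_letter a"] by simp

lemma foldr_red_cons: "reduced_word w \<Longrightarrow> foldr red_cons (red_cons a v) w = red_cons a (foldr red_cons v w)"
proof (cases "v \<noteq> [] \<and> hd v = inv_letter a")
  case True
  then obtain v' where "v = inv_letter a # v'" by (cases v) auto
  moreover assume "reduced_word w"
  ultimately show ?thesis by (simp add: red_cons_def[of a "inv_letter a # v'"] red_cons_cancel' reduced_foldr)
next
  case False
  then have "red_cons a v = a # v" by (auto simp: red_cons_def)
  then show ?thesis by simp
qed

lemma foldr_assoc:
  "reduced_word w \<Longrightarrow> foldr red_cons (foldr red_cons u v) w = foldr red_cons u (foldr red_cons v w)"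
  by (induction u) (auto simp: foldr_red_cons)

lemma foldr_Nil: "reduced_word w \<Longrightarrow> foldr red_cons w [] = w"
  by (induction w) (auto simp: reduced_word_Cons red_cons_def)

lemma foldr_inverse: "reduced_word v \<Longrightarrow> foldr red_cons (map inv_letter (rev w)) (foldr red_cons w v) = v"
  by (induction w) (auto simp: red_cons_cancel reduced_foldr)

lemma group_F2: "group F2"
proof (rule groupI)
  fix w assume w: "w \<in> carrier F2"
  let ?v = "foldr red_cons (map inv_letter (rev w)) []"
  have "?v \<in> carrier F2" "?v \<otimes>\<^bsub>F2\<^esub> w = \<one>\<^bsub>F2\<^esub>"
    using w foldr_inverse[of "[]" w]
    by (auto simp: F2_def reduced_foldr foldr_assoc foldr_Nil)
  then show "\<exists>y\<in>carrier F2. y \<otimes>\<^bsub>F2\<^esub> w = \<one>\<^bsub>F2\<^esub>" by blast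
qed (auto simp: F2_def reduced_foldr foldr_assoc)

definition exponent_sum :: "gen \<Rightarrow> letter list \<Rightarrow> int" where
  "exponent_sum g w = int (count_list w (g, True)) - int (count_list w (g, False))"

definition hat_beta :: "(letter list \<Rightarrow> letter list) \<Rightarrow> real^2^2" where
  "hat_beta \<phi> =
     (let \<phi>x = \<phi> [(GX, True)]; \<phi>y = \<phi> [(GY, True)] in
      vector [vector [of_int (exponent_sum GX \<phi>x), of_int (exponent_sum GX \<phi>y)],
              vector [of_int (exponent_sum GY \<phi>x), of_int (exponent_sum GY \<phi>y)]])"

definition Aut_plus_F2 :: "(letter list \<Rightarrow> letter list) set" where
  "Aut_plus_F2 = {\<phi> \<in> auto F2. det (hat_beta \<phi>) = 1}"

definition Aff_plus_subgroup :: "letter list set \<Rightarrow> (letter list \<Rightarrow> letter list) set" where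
  "Aff_plus_subgroup H = {\<gamma> \<in> Aut_plus_F2. \<gamma> ` H = H}"

definition SL2Z :: "(real^2^2) set" where
  "SL2Z = {A. (\<forall>i j. A $ i $ j \<in> \<int>) \<and> det A = 1}"


section \<open>Deck transformations and the subgroup of an origami\<close>

definition upper_half_plane :: "complex set" where
  "upper_half_plane = {z. Im z > 0}"

definition deck_group ::
    "'a::topological_space set \<Rightarrow> ('a \<Rightarrow> 'b) \<Rightarrow> ('a \<Rightarrow> 'a) monoid" where
  "deck_group C q = (BijGroup C)\<lparr>carrier := {g \<in> self_homeos C. \<forall>z\<in>C. q (g z) = q z}\<rparr>"

definition is_lift_from_to ::
    "(complex \<Rightarrow> torus) \<Rightarrow> (real \<Rightarrow> torus) \<Rightarrow> complex \<Rightarrow> complex \<Rightarrow> bool" where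
  "is_lift_from_to P c z z' \<longleftrightarrow>
     (\<exists>g. path g \<and> path_image g \<subseteq> upper_half_plane \<and> pathstart g = z \<and> pathfinish g = z' \<and>
        (\<forall>t\<in>{0..1}. P (g t) = c t))"

text \<open>
  Let \<open>P\<close> be a universal covering of \<open>E_star\<close>.  An identification of \<open>F2\<close> with the deck group of \<open>P\<close>
  is a group isomorphism induced by the usual isomorphism between the fundamental group and the deck
  group with respect to a base point \<open>z\<close>: the class of a loop corresponds to the deck transformation
  that takes \<open>z\<close> to the end point of the lift of the loop starting at \<open>z\<close>.  Here the two generators
  correspond to the images of the horizontal and the vertical unit segment starting at \<open>Q\<close>.
  Both segments must avoid the lattice, otherwise their images are not loops in \<open>E_star\<close>.
\<close>

definition canonical_marking ::
    "(complex \<Rightarrow> torus) \<Rightarrow> (letter list \<Rightarrow> complex \<Rightarrow> complex) \<Rightarrow> bool" where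
  "canonical_marking P \<Phi> \<longleftrightarrow>
     \<Phi> \<in> iso F2 (deck_group upper_half_plane P) \<and>
     (\<exists>Q z. closed_segment Q (Q + 1) \<inter> Z2_lattice = {} \<and> closed_segment Q (Q + \<i>) \<inter> Z2_lattice = {} \<and>
        z \<in> upper_half_plane \<and> P z = to_torus Q \<and>
        is_lift_from_to P (to_torus \<circ> linepath Q (Q + 1)) z (\<Phi> [(GX, True)] z) \<and>
        is_lift_from_to P (to_torus \<circ> linepath Q (Q + \<i>)) z (\<Phi> [(GY, True)] z))"

definition origami_subgroup ::
    "(complex \<Rightarrow> 'a) \<Rightarrow> (letter list \<Rightarrow> complex \<Rightarrow> complex) \<Rightarrow> letter list set" where
  "origami_subgroup u \<Phi> = {w \<in> carrier F2. \<Phi> w \<in> carrier (deck_group upper_half_plane u)}"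

end

theory Submission
  imports Defs
begin

text \<open>
  Let \<open>P = p \<circ> u\<close> and let \<open>D\<close> be a developing map, i.e. a lift of \<open>P\<close> to the plane; its image is the
  complement of the lattice \<open>\<Lambda>\<close>.  A deck transformation \<open>g\<close> of \<open>P\<close> satisfies \<open>D \<circ> g = D + hol g\<close> with
  \<open>hol g \<in> \<Lambda>\<close>, and under the marking \<open>hol\<close> is the pair of exponent sums.

  An affine homeomorphism of \<open>X\<close> with derivative \<open>A\<close> lifts to a homeomorphism \<open>f\<close> of the upper half
  plane with \<open>D \<circ> f = A D + b\<close>.  Comparing images gives \<open>A \<Lambda> + b = \<Lambda>\<close>, hence \<open>A \<in> SL\<^sub>2(\<int>)\<close>, and
  conjugation by \<open>f\<close> is an automorphism of the deck group of \<open>P\<close> that preserves the deck group of \<open>u\<close>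
  and acts on exponent sums by \<open>A\<close>.

  Conversely, the linear map \<open>hat_beta \<gamma>\<close> of the plane lifts through \<open>P\<close> to a homeomorphism, and the
  automorphism it induces by conjugation has the same image under \<open>hat_beta\<close> as \<open>\<gamma>\<close>.  By Nielsen's
  theorem that the kernel of \<open>Aut(F\<^sub>2) \<rightarrow> GL\<^sub>2(\<int>)\<close> is \<open>Inn(F\<^sub>2)\<close>, the two differ by an inner automorphism.
  After composition with a deck transformation the homeomorphism induces \<open>\<gamma>\<close>, and if \<open>\<gamma>(H) = H\<close> it
  descends to \<open>X\<close>.

  Nielsen's theorem follows from the fact that every basis of \<open>F\<^sub>2\<close> is, up to conjugation and inversion
  of one element, a pair of positive words in two letters.  The length of a positive word is determined
  by its exponent sums.
\<close>

subsection \<open>The free group\<close>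

interpretation F2: group F2
  by (rule group_F2)

abbreviation F2_mult (infixl "\<cdot>" 70) where "v \<cdot> w \<equiv> v \<otimes>\<^bsub>F2\<^esub> w"
abbreviation F2_inv ("_\<^sup>-" [1000] 999) where "w\<^sup>- \<equiv> inv\<^bsub>F2\<^esub> w"

lemma carrier_F2: "w \<in> carrier F2 \<longleftrightarrow> reduced_word w"
  by (simp add: F2_def)

lemma mult_F2: "v \<cdot> w = foldr red_cons v w"
  by (simp add: F2_def)

lemma one_F2: "\<one>\<^bsub>F2\<^esub> = []"
  by (simp add: F2_def)

lemma letter_in_F2 [simp]: "[a] \<in> carrier F2"
  by (simp add: carrier_F2 reduced_word_def)

lemma Nil_in_F2 [simp]: "[] \<in> carrier F2"
  by (simp add: carrier_F2)

lemma Cons_eq_mult: "a # w \<in> carrier F2 \<Longrightarrow> a # w = [a] \<cdot> w"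
  by (auto simp: mult_F2 red_cons_def carrier_F2 reduced_word_Cons)

lemma Cons_in_F2D: "a # w \<in> carrier F2 \<Longrightarrow> w \<in> carrier F2"
  by (simp add: carrier_F2 reduced_word_Cons)

lemma F2_induct [consumes 1, case_names one mult]:
  assumes "w \<in> carrier F2" "P []"
    and "\<And>a w. w \<in> carrier F2 \<Longrightarrow> P w \<Longrightarrow> P ([a] \<cdot> w)"
  shows "P w"
  using assms(1)
proof (induction w)
  case Nil
  show ?case by (rule assms(2))
next
  case (Cons a w)
  then have "w \<in> carrier F2" using Cons_in_F2D by blast
  with Cons assms(3)[of w a] show ?case using Cons_eq_mult[of a w] by simp
qed

lemma F2_cancel:
  assumes "v \<in> carrier F2" "w \<in> carrier F2"
  shows "v\<^sup>- \<cdot> (v \<cdot> w) = w" "v \<cdot> (v\<^sup>- \<cdot> w) = w"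
  using assms by (simp_all add: F2.m_assoc[symmetric])

lemma letter_eq_or_inv: "fst a = fst b \<Longrightarrow> b = a \<or> b = inv_letter a"
  by (auto simp: inv_letter_def prod_eq_iff)

lemma inv_letter_F2: "[a]\<^sup>- = [inv_letter a]"
  by (rule F2.inv_equality) (auto simp: mult_F2 one_F2 red_cons_def)

lemma reduced_word_inv:
  "reduced_word w \<Longrightarrow> reduced_word (map inv_letter (rev w))"
  unfolding reduced_word_def successively_map successively_rev
  by (erule successively_mono) (metis inv_letter_inv)

lemma inv_F2: "w \<in> carrier F2 \<Longrightarrow> w\<^sup>- = map inv_letter (rev w)"
proof (rule F2.inv_equality)
  assume w: "w \<in> carrier F2"
  show "map inv_letter (rev w) \<cdot> w = \<one>\<^bsub>F2\<^esub>"
    using foldr_inverse[of "[]" w] w by (simp add: mult_F2 one_F2 foldr_Nil carrier_F2)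
  show "map inv_letter (rev w) \<in> carrier F2"
    using w by (simp add: carrier_F2 reduced_word_inv)
qed

lemma length_inv_F2 [simp]: "w \<in> carrier F2 \<Longrightarrow> length (w\<^sup>-) = length w"
  by (simp add: inv_F2)

lemma mult_eq_append: "reduced_word (v @ w) \<Longrightarrow> v \<cdot> w = v @ w"
proof (induction v)
  case (Cons a v)
  then have *: "reduced_word (v @ w)" "v @ w \<noteq> [] \<longrightarrow> hd (v @ w) \<noteq> inv_letter a"
    by (auto simp: reduced_word_Cons)
  then have "foldr red_cons v w = v @ w" using Cons.IH by (simp add: mult_F2)
  then show ?case using * by (cases "v @ w = []") (auto simp: mult_F2 red_cons_def)
qed (simp add: mult_F2)

section \<open>Exponent sums as homomorphisms to the integers\<close>

lemma exponent_sum_Cons: "exponent_sum g (a # w) = exponent_sum g [a] + exponent_sum g w"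
  by (simp add: exponent_sum_def)

lemma exponent_sum_inv_letter: "exponent_sum g [inv_letter a] = - exponent_sum g [a]"
  by (cases a) (auto simp: exponent_sum_def inv_letter_def)

lemma exponent_sum_mult: "exponent_sum g (v \<cdot> w) = exponent_sum g v + exponent_sum g w"
proof (induction v)
  case Nil
  then show ?case by (simp add: mult_F2 exponent_sum_def)
next
  case (Cons a v)
  have "exponent_sum g (red_cons a w') = exponent_sum g [a] + exponent_sum g w'" for w'
  proof (cases "w' \<noteq> [] \<and> hd w' = inv_letter a")
    case True
    then obtain w'' where "w' = inv_letter a # w''" by (cases w') auto
    then show ?thesis
      using exponent_sum_Cons[of g "inv_letter a" w'']
      by (simp add: red_cons_def exponent_sum_inv_letter)
  next
    case False
    then show ?thesis by (auto simp: red_cons_def exponent_sum_Cons[of g a w'])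
  qed
  with Cons show ?case by (simp add: mult_F2 exponent_sum_Cons[of g a v])
qed

lemma exponent_sum_one: "exponent_sum g [] = 0"
  by (simp add: exponent_sum_def)

lemma exponent_sum_inv: "w \<in> carrier F2 \<Longrightarrow> exponent_sum g (w\<^sup>-) = - exponent_sum g w"
  using exponent_sum_mult[of g "w\<^sup>-" w] by (simp add: one_F2 exponent_sum_one)

lemma exponent_sum_conj:
  "h \<in> carrier F2 \<Longrightarrow> exponent_sum g (h \<cdot> w \<cdot> h\<^sup>-) = exponent_sum g w"
  by (simp add: exponent_sum_mult exponent_sum_inv)

subsection \<open>Cancellation\<close>

text \<open>For reduced words this is the Gromov product based at the identity of the Cayley tree:
  the length of the shared initial part of the two geodesics.\<close>

fun common_prefix :: "'b list \<Rightarrow> 'b list \<Rightarrow> nat" where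
  "common_prefix (a # v) (b # w) = (if a = b then Suc (common_prefix v w) else 0)"
| "common_prefix _ _ = 0"

lemma common_prefix_commute: "common_prefix v w = common_prefix w v"
  by (induction v w rule: common_prefix.induct) auto

text \<open>Agreement on the first \<open>m\<close> letters is a transitive relation, for every
  \<open>m\<close>.\<close>

lemma common_prefix_ultrametric:
  "min (common_prefix u v) (common_prefix v w) \<le> common_prefix u w"
proof (induction u w arbitrary: v rule: common_prefix.induct)
  case (1 a u c w)
  then show ?case by (cases v) auto
next
  case ("2_1" w)
  then show ?case by simp
next
  case ("2_2" u)
  then show ?case by (cases v) auto
qed

lemma common_prefix_nth: "i < common_prefix v w \<Longrightarrow> v ! i = w ! i"
proof (induction v w arbitrary: i rule: common_prefix.induct)
  case (1 a v b w)
  then show ?case by (cases i) (auto split: if_splits)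
qed auto

lemma common_prefix_take:
  "common_prefix v (take m w) = min m (common_prefix v w)"
proof (induction v w arbitrary: m rule: common_prefix.induct)
  case (1 a v b w)
  then show ?case by (cases m) auto
next
  case ("2_2" v)
  then show ?case by (cases v) auto
qed auto

text \<open>A common first letter drops out of \<open>v\<^sup>- \<cdot> w\<close>, and once the
  first letters differ, the inverse of the first word followed by the second is already reduced.
  Each cancelled letter is lost from both words, hence the factor 2.\<close>

lemma length_inv_mult:
  assumes "v \<in> carrier F2" "w \<in> carrier F2"
  shows "length (v\<^sup>- \<cdot> w) + 2 * common_prefix v w = length v + length w"
  using assms
proof (induction v w rule: common_prefix.induct)
  case (1 a v b w)
  show ?case
  proof (cases "a = b")
    case True
    have vw: "v \<in> carrier F2" "w \<in> carrier F2" using 1 Cons_in_F2D by blast+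
    have "(a # v)\<^sup>- \<cdot> (a # w) = ([a] \<cdot> v)\<^sup>- \<cdot> ([a] \<cdot> w)"
      using 1 True by (metis Cons_eq_mult)
    also have "\<dots> = v\<^sup>- \<cdot> w"
      using vw by (simp add: F2.inv_mult_group F2.m_assoc F2_cancel)
    finally show ?thesis using 1 True vw by simp
  next
    case False
    have "reduced_word (map inv_letter (rev (a # v)) @ b # w)"
      unfolding reduced_word_def successively_append_iff
      using 1 reduced_word_inv[of "a # v"] False
      by (auto simp: carrier_F2 reduced_word_def)
    then show ?thesis
      using 1 False by (simp add: inv_F2 mult_eq_append)
  qed
next
  case ("2_1" w)
  then show ?case using one_F2 by (metis F2.l_one F2.inv_one add_0 common_prefix.simps(2) list.size(3) mult_0_right add.right_neutral)
next
  case ("2_2" v)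
  have "common_prefix v [] = 0" by (cases v) auto
  then show ?case using "2_2" by (metis F2.inv_closed F2.r_one add.right_neutral length_inv_F2 list.size(3) mult_0_right one_F2)
qed

text \<open>Inverting \<open>v\<close> turns cancellation at the junction of \<open>v\<close> and
  \<open>w\<close> into a common beginning, so this counts the letters that each factor loses in the
  product.\<close>

definition cancel :: "letter list \<Rightarrow> letter list \<Rightarrow> nat" where
  "cancel v w = common_prefix (v\<^sup>-) w"

lemma length_mult:
  "v \<in> carrier F2 \<Longrightarrow> w \<in> carrier F2 \<Longrightarrow> length (v \<cdot> w) + 2 * cancel v w = length v + length w"
  using length_inv_mult[of "v\<^sup>-" w] by (simp add: cancel_def)

lemma cancel_inv: "v \<in> carrier F2 \<Longrightarrow> w \<in> carrier F2 \<Longrightarrow> cancel (w\<^sup>-) (v\<^sup>-) = cancel v w"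
  by (simp add: cancel_def common_prefix_commute)

text \<open>This is the length formula for \<open>v\<close> and \<open>v \<cdot> w\<close>, whose
  quotient is \<open>w\<close>. It translates cancellation on the right of \<open>v\<close> into a
  common prefix, to which the ultrametric inequality applies.\<close>

lemma common_prefix_mult:
  assumes "v \<in> carrier F2" "w \<in> carrier F2"
  shows "common_prefix v (v \<cdot> w) + cancel v w = length v"
  using length_inv_mult[of v "v \<cdot> w"] length_mult[of v w] assms
  by (simp add: F2.m_assoc[symmetric])

text \<open>
  The word metric on the Cayley tree of \<open>F2\<close> is \<open>0\<close>-hyperbolic.  The next two lemmas read this for
  the four points \<open>u\<^sup>-\<close>, \<open>1\<close>, \<open>v\<close>, \<open>v \<cdot> w\<close>.
\<close>

lemma cancel_mult:
  assumes "u \<in> carrier F2" "v \<in> carrier F2" "w \<in> carrier F2"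
    and "cancel u v + cancel v w < length v"
  shows "cancel (u \<cdot> v) w = cancel v w"
proof -
  \<comment> \<open>The words \<open>v\<close> and \<open>v \<cdot> w\<close> agree strictly longer
    than \<open>u\<^sup>-\<close> and \<open>v\<close> do. In an ultrametric triangle the two
    smaller of the three overlaps are equal.\<close>
  have "common_prefix (u\<^sup>-) (v \<cdot> w) = cancel u v"
    using common_prefix_ultrametric[of "u\<^sup>-" v "v \<cdot> w"]
      common_prefix_ultrametric[of "u\<^sup>-" "v \<cdot> w" v] common_prefix_mult[OF assms(2,3)]
      common_prefix_commute[of v "v \<cdot> w"] assms(4)
    unfolding cancel_def by linarith
  then have "cancel u (v \<cdot> w) = cancel u v" by (simp add: cancel_def)
  then show ?thesis
    using length_mult[of u "v \<cdot> w"] length_mult[of u v] length_mult[of v w]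
      length_mult[of "u \<cdot> v" w] assms by (simp add: F2.m_assoc)
qed

lemma length_mult_mult_le:
  assumes "u \<in> carrier F2" "v \<in> carrier F2" "w \<in> carrier F2"
    and "cancel u v + cancel v w \<le> length v"
  shows "length (u \<cdot> v \<cdot> w) + length v \<le> length (u \<cdot> v) + length (v \<cdot> w)"
proof -
  have "cancel u v \<le> common_prefix (u\<^sup>-) (v \<cdot> w)"
    using common_prefix_ultrametric[of "u\<^sup>-" v "v \<cdot> w"] common_prefix_mult[OF assms(2,3)] assms(4)
    unfolding cancel_def by linarith
  then have "cancel u v \<le> cancel u (v \<cdot> w)" by (simp add: cancel_def)
  then show ?thesis
    using length_mult[of u "v \<cdot> w"] length_mult[of u v] assms by (simp add: F2.m_assoc)
qed

text \<open>If half of \<open>v\<close> or more cancelled against \<open>v\<close>, letters in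
  mirror positions would be inverse to each other. In the middle this gives two adjacent inverse
  letters if the length is even, and a letter that is its own inverse if it is odd.\<close>

lemma cancel_self:
  assumes "v \<in> carrier F2" "v \<noteq> []"
  shows "2 * cancel v v < length v"
proof (rule ccontr)
  assume *: "\<not> ?thesis"
  define n where "n = length v"
  have eq: "v ! i = inv_letter (v ! (n - 1 - i))" if "2 * i < n" for i
  proof -
    have "i < cancel v v" using * that by (simp add: n_def)
    then have "v\<^sup>- ! i = v ! i" unfolding cancel_def by (rule common_prefix_nth)
    then show ?thesis using assms(1) that by (simp add: inv_F2 n_def rev_nth)
  qed
  have "n > 0" using assms(2) by (simp add: n_def)
  show False
  proof (cases "even n")
    case True
    then obtain m where m: "n = 2 * m" by blast
    have "v ! (m - 1) = inv_letter (v ! m)" using eq[of "m - 1"] m \<open>n > 0\<close> by auto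
    moreover have "v ! Suc i \<noteq> inv_letter (v ! i)" if "Suc i < n" for i
      using assms(1) that unfolding carrier_F2 reduced_word_def successively_conv_nth n_def by auto
    from this[of "m - 1"] have "v ! m \<noteq> inv_letter (v ! (m - 1))" using m \<open>n > 0\<close> by auto
    ultimately show False by simp
  next
    case False
    then obtain m where "n = 2 * m + 1" using oddE by blast
    then have "v ! m = inv_letter (v ! m)" using eq[of m] by simp
    then show False by (cases "v ! m") (simp add: inv_letter_def)
  qed
qed

subsection \<open>Bases of the free group\<close>

text \<open>A generating pair of a free group of rank two is a basis, because the group is Hopfian.
  Quantifying over subgroups lets Nielsen moves be checked without writing elements as
  words.\<close>

definition generating :: "letter list \<Rightarrow> letter list \<Rightarrow> bool" where
  "generating u v \<longleftrightarrow> u \<in> carrier F2 \<and> v \<in> carrier F2 \<and>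
     (\<forall>K. subgroup K F2 \<longrightarrow> u \<in> K \<longrightarrow> v \<in> K \<longrightarrow> K = carrier F2)"

lemma generating_carrier: "generating u v \<Longrightarrow> u \<in> carrier F2" "generating u v \<Longrightarrow> v \<in> carrier F2"
  by (simp_all add: generating_def)

lemma generatingD: "generating u v \<Longrightarrow> subgroup K F2 \<Longrightarrow> u \<in> K \<Longrightarrow> v \<in> K \<Longrightarrow> K = carrier F2"
  by (simp add: generating_def)

lemma generatingI:
  assumes "generating u v" "u' \<in> carrier F2" "v' \<in> carrier F2"
    and "\<And>K. subgroup K F2 \<Longrightarrow> u' \<in> K \<Longrightarrow> v' \<in> K \<Longrightarrow> u \<in> K \<and> v \<in> K"
  shows "generating u' v'"
  using assms unfolding generating_def by metis

lemma generating_swap: "generating u v \<Longrightarrow> generating v u"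
  by (auto simp: generating_def)

lemma generating_inv_left: "generating u v \<Longrightarrow> generating (u\<^sup>-) v"
  by (rule generatingI[of u v])
    (auto simp: generating_def dest: subgroup.m_inv_closed[OF _ _, where G=F2] F2.inv_inv)

lemma generating_mult_right: "generating u v \<Longrightarrow> generating u (u \<cdot> v)"
proof (rule generatingI[of u v])
  fix K assume uv: "generating u v" and K: "subgroup K F2" "u \<in> K" "u \<cdot> v \<in> K"
  have "u\<^sup>- \<cdot> (u \<cdot> v) \<in> K"
    using K by (simp add: subgroup.m_closed subgroup.m_inv_closed)
  moreover have "u\<^sup>- \<cdot> (u \<cdot> v) = v" using uv by (simp add: generating_def F2_cancel)
  ultimately show "u \<in> K \<and> v \<in> K" using K by simp
qed (auto simp: generating_def)

lemma generating_mult_left: "generating u v \<Longrightarrow> generating (u \<cdot> v) v"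
proof (rule generatingI[of u v])
  fix K assume uv: "generating u v" and K: "subgroup K F2" "u \<cdot> v \<in> K" "v \<in> K"
  have "(u \<cdot> v) \<cdot> v\<^sup>- \<in> K"
    using K by (simp add: subgroup.m_closed subgroup.m_inv_closed)
  moreover have "(u \<cdot> v) \<cdot> v\<^sup>- = u" using generating_carrier[OF uv] by (simp add: F2.m_assoc)
  ultimately show "u \<in> K \<and> v \<in> K" using K by simp
qed (auto simp: generating_def)

lemma generating_conj:
  assumes "generating u v" "h \<in> carrier F2"
  shows "generating (h \<cdot> u \<cdot> h\<^sup>-) (h \<cdot> v \<cdot> h\<^sup>-)"
  unfolding generating_def
proof (intro conjI allI impI)
  have uv: "u \<in> carrier F2" "v \<in> carrier F2" using assms by (auto simp: generating_def)
  then show "h \<cdot> u \<cdot> h\<^sup>- \<in> carrier F2" "h \<cdot> v \<cdot> h\<^sup>- \<in> carrier F2" using assms(2) by auto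
  fix K assume K: "subgroup K F2" "h \<cdot> u \<cdot> h\<^sup>- \<in> K" "h \<cdot> v \<cdot> h\<^sup>- \<in> K"
  let ?K = "{w \<in> carrier F2. h \<cdot> w \<cdot> h\<^sup>- \<in> K}"
  have "subgroup ?K F2"
  proof (rule F2.subgroupI)
    show "?K \<noteq> {}" using uv K by blast
  next
    fix w assume "w \<in> ?K"
    moreover from this have "(h \<cdot> w \<cdot> h\<^sup>-)\<^sup>- = h \<cdot> w\<^sup>- \<cdot> h\<^sup>-"
      using assms(2) by (simp add: F2.inv_mult_group F2.m_assoc)
    ultimately show "w\<^sup>- \<in> ?K" using subgroup.m_inv_closed[OF K(1)] by fastforce
  next
    fix v w assume "v \<in> ?K" "w \<in> ?K"
    moreover from this have "(h \<cdot> v \<cdot> h\<^sup>-) \<cdot> (h \<cdot> w \<cdot> h\<^sup>-) = h \<cdot> (v \<cdot> w) \<cdot> h\<^sup>-"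
      using assms(2) by (simp add: F2.m_assoc F2_cancel)
    ultimately show "v \<cdot> w \<in> ?K" using subgroup.m_closed[OF K(1)] by fastforce
  qed blast
  then have *: "?K = carrier F2" using assms(1) uv K unfolding generating_def by blast
  show "K = carrier F2"
  proof
    show "K \<subseteq> carrier F2" using K(1) subgroup.subset by blast
    show "carrier F2 \<subseteq> K"
    proof
      fix w assume w: "w \<in> carrier F2"
      then have "h\<^sup>- \<cdot> w \<cdot> h \<in> ?K" using assms(2) by (subst *) auto
      moreover have "h \<cdot> (h\<^sup>- \<cdot> w \<cdot> h) \<cdot> h\<^sup>- = w"
        using w assms(2) by (simp add: F2.m_assoc F2_cancel)
      ultimately show "w \<in> K" by simp
    qed
  qed
qed

text \<open>Positive Nielsen moves applied to two letters, each of either sign, together with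
  simultaneous conjugation. Up to a common conjugator the entries are words in two letters without
  their inverses.\<close>

inductive positive_pair :: "letter list \<Rightarrow> letter list \<Rightarrow> bool" where
  letters: "fst a \<noteq> fst b \<Longrightarrow> positive_pair [a] [b]"
| right: "positive_pair u v \<Longrightarrow> positive_pair u (u \<cdot> v)"
| left: "positive_pair u v \<Longrightarrow> positive_pair (u \<cdot> v) v"
| conj: "positive_pair u v \<Longrightarrow> h \<in> carrier F2 \<Longrightarrow> positive_pair (h \<cdot> u \<cdot> h\<^sup>-) (h \<cdot> v \<cdot> h\<^sup>-)"

text \<open>Inversion of one entry is what makes the class closed under all Nielsen moves.
  Membership of \<open>v\<close> is explicit because it cannot be recovered from that of
  \<open>v\<^sup>-\<close>.\<close>

definition standard_pair :: "letter list \<Rightarrow> letter list \<Rightarrow> bool" where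
  "standard_pair u v \<longleftrightarrow> v \<in> carrier F2 \<and> (positive_pair u v \<or> positive_pair u (v\<^sup>-))"

section \<open>Closure of standard pairs under Nielsen moves\<close>

lemma positive_pair_carrier:
  "positive_pair u v \<Longrightarrow> u \<in> carrier F2" "positive_pair u v \<Longrightarrow> v \<in> carrier F2"
  by (induction rule: positive_pair.induct) auto

text \<open>Conjugation by \<open>u\<close> takes \<open>v \<cdot> u\<close> to
  \<open>u \<cdot> v\<close> and fixes \<open>u\<close>.\<close>

lemma positive_pair_mult_commute':
  assumes "positive_pair (v \<cdot> u) u" "u \<in> carrier F2" "v \<in> carrier F2"
  shows "positive_pair (u \<cdot> v) u"
  using positive_pair.conj[OF assms(1,2)] assms(2,3) by (simp add: F2.m_assoc)

lemma positive_pair_swap: "positive_pair u v \<Longrightarrow> positive_pair v u"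
proof (induction rule: positive_pair.induct)
  case (right u v)
  then show ?case
    using positive_pair_mult_commute' positive_pair.left positive_pair_carrier by blast
next
  case (left u v)
  note c = positive_pair_carrier[OF left(1)]
  have "positive_pair v (v \<cdot> u)" using left positive_pair.right by blast
  from positive_pair.conj[OF this, of "v\<^sup>-"] c show ?case
    by (simp add: F2.m_assoc F2_cancel)
qed (auto intro: positive_pair.intros)

lemma positive_pair_inv: "positive_pair u v \<Longrightarrow> positive_pair (u\<^sup>-) (v\<^sup>-)"
proof (induction rule: positive_pair.induct)
  case (letters a b)
  then show ?case by (simp add: inv_letter_F2 positive_pair.letters inv_letter_def)
next
  case (right u v)
  note c = positive_pair_carrier[OF right(1)]
  have "positive_pair (u\<^sup>-) (u\<^sup>- \<cdot> v\<^sup>-)" using right positive_pair.right by blast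
  from positive_pair.conj[OF this c(1)] c show ?case
    by (simp add: F2.m_assoc F2.inv_mult_group F2_cancel)
next
  case (left u v)
  note c = positive_pair_carrier[OF left(1)]
  have "positive_pair (u\<^sup>- \<cdot> v\<^sup>-) (v\<^sup>-)" using left positive_pair.left by blast
  from positive_pair_mult_commute'[OF this] c show ?case
    by (simp add: F2.inv_mult_group)
next
  case (conj u v h)
  note c = positive_pair_carrier[OF conj(1)]
  show ?case
    using positive_pair.conj[OF conj(3,2)] c conj(2) by (simp add: F2.m_assoc F2.inv_mult_group)
qed

lemma standard_pair_inv_right: "standard_pair u v \<Longrightarrow> standard_pair u (v\<^sup>-)"
  by (auto simp: standard_pair_def)

lemma standard_pair_swap: "standard_pair u v \<Longrightarrow> standard_pair v u"
  unfolding standard_pair_def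
  by (metis F2.inv_inv positive_pair_carrier(1) positive_pair_inv positive_pair_swap)

lemma standard_pair_inv_left: "standard_pair u v \<Longrightarrow> standard_pair (u\<^sup>-) v"
  using standard_pair_inv_right standard_pair_swap by blast

lemma standard_pair_conj:
  assumes "standard_pair u v" "h \<in> carrier F2"
  shows "standard_pair (h \<cdot> u \<cdot> h\<^sup>-) (h \<cdot> v \<cdot> h\<^sup>-)"
proof -
  have v: "v \<in> carrier F2" using assms by (simp add: standard_pair_def)
  then have "(h \<cdot> v \<cdot> h\<^sup>-)\<^sup>- = h \<cdot> v\<^sup>- \<cdot> h\<^sup>-"
    using assms(2) by (simp add: F2.m_assoc F2.inv_mult_group)
  then show ?thesis using assms v positive_pair.conj unfolding standard_pair_def by fastforce
qed

text \<open>Handles multiplication when the second entry is inverted, where multiplying becomes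
  dividing. For letters this is a product after changing the sign of \<open>b\<close>; after
  \<open>right\<close> or \<open>left\<close> the division undoes the last multiplication, up to
  conjugation and inversion.\<close>

lemma positive_pair_div: "positive_pair u w \<Longrightarrow> standard_pair u (u \<cdot> w\<^sup>-)"
proof (induction rule: positive_pair.induct)
  case (letters a b)
  then have "positive_pair [a] ([a] \<cdot> [inv_letter b])"
    by (intro positive_pair.right positive_pair.letters) (simp add: inv_letter_def)
  then show ?case by (simp add: standard_pair_def inv_letter_F2)
next
  case (right u w)
  note c = positive_pair_carrier[OF right(1)]
  have "standard_pair u (w\<^sup>-)" using right(1) c by (simp add: standard_pair_def)
  from standard_pair_conj[OF this c(1)] c show ?case
    by (simp add: F2.m_assoc F2.inv_mult_group)
next
  case (left s t)
  note c = positive_pair_carrier[OF left(1)]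
  have "positive_pair (t \<cdot> s) s" using left(1) positive_pair_swap positive_pair.left by blast
  from positive_pair_mult_commute'[OF this] c show ?case
    by (simp add: F2.m_assoc standard_pair_def)
next
  case (conj u w h)
  note c = positive_pair_carrier[OF conj(1)]
  show ?case
    using standard_pair_conj[OF conj(3,2)] c conj(2)
    by (simp add: F2.m_assoc F2.inv_mult_group F2_cancel)
qed

lemma standard_pair_mult_right:
  assumes "standard_pair u v"
  shows "standard_pair u (u \<cdot> v)"
proof -
  have v: "v \<in> carrier F2" using assms by (simp add: standard_pair_def)
  show ?thesis
  proof (cases "positive_pair u v")
    case True
    then have "positive_pair u (u \<cdot> v)" by (rule positive_pair.right)
    then show ?thesis by (simp add: standard_pair_def positive_pair_carrier)
  next
    case False
    then show ?thesis
      using assms v positive_pair_div[of u "v\<^sup>-"] by (simp add: standard_pair_def)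
  qed
qed

text \<open>The forward move with \<open>u\<^sup>-\<close> undoes the move with \<open>u\<close>. A
  descent on length needs this direction: the shortened pair is standard by induction, and the
  original pair inherits it.\<close>

lemma standard_pair_mult_rightD:
  assumes "standard_pair u (u \<cdot> v)" "u \<in> carrier F2" "v \<in> carrier F2"
  shows "standard_pair u v"
proof -
  have "standard_pair (u\<^sup>-) (u\<^sup>- \<cdot> (u \<cdot> v))"
    by (intro standard_pair_mult_right standard_pair_inv_left assms)
  then show ?thesis
    using standard_pair_inv_left[of "u\<^sup>-" v] assms by (simp add: F2_cancel)
qed

lemma standard_pair_mult_leftD:
  assumes "standard_pair (u \<cdot> v) v" "u \<in> carrier F2" "v \<in> carrier F2"
  shows "standard_pair u v"
proof -
  have "standard_pair (v \<cdot> u) v"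
    using standard_pair_conj[OF assms(1,3)] assms(2,3) by (simp add: F2.m_assoc)
  then have "standard_pair v u"
    using standard_pair_swap standard_pair_mult_rightD assms by blast
  then show ?thesis by (rule standard_pair_swap)
qed

lemma standard_pair_conjD:
  assumes "standard_pair (h \<cdot> u \<cdot> h\<^sup>-) (h \<cdot> v \<cdot> h\<^sup>-)"
    "h \<in> carrier F2" "u \<in> carrier F2" "v \<in> carrier F2"
  shows "standard_pair u v"
  using standard_pair_conj[OF assms(1), of "h\<^sup>-"] assms(2-)
  by (simp add: F2.m_assoc F2_cancel)

subsection \<open>Nielsen reduction\<close>

text \<open>With \<open>u\<close>, \<open>v\<close> and their inverses indexed by letters,
  distinctions of sign and order become quantification over letters.\<close>

definition pair_letter :: "letter list \<Rightarrow> letter list \<Rightarrow> letter \<Rightarrow> letter list" where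
  "pair_letter u v a = (let w = (case fst a of GX \<Rightarrow> u | GY \<Rightarrow> v) in if snd a then w else w\<^sup>-)"

definition word_eval :: "(letter \<Rightarrow> letter list) \<Rightarrow> letter list \<Rightarrow> letter list" where
  "word_eval f w = foldr (\<lambda>a r. f a \<cdot> r) w []"

lemma word_eval_Nil [simp]: "word_eval f [] = []"
  by (simp add: word_eval_def)

lemma word_eval_Cons [simp]: "word_eval f (a # w) = f a \<cdot> word_eval f w"
  by (simp add: word_eval_def)

lemma word_eval_carrier: "(\<And>a. f a \<in> carrier F2) \<Longrightarrow> word_eval f w \<in> carrier F2"
  by (induction w) auto

lemma mult_Nil [simp]: "w \<in> carrier F2 \<Longrightarrow> w \<cdot> [] = w" "[] \<cdot> w = w"
  by (simp_all add: mult_F2 foldr_Nil carrier_F2)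

lemma word_eval_snoc:
  assumes "\<And>a. f a \<in> carrier F2"
  shows "word_eval f (w @ [a]) = word_eval f w \<cdot> f a"
  by (induction w) (simp_all add: F2.m_assoc word_eval_carrier assms)

lemma word_eval_mult:
  assumes f: "\<And>a. f a \<in> carrier F2" "\<And>a. f (inv_letter a) = (f a)\<^sup>-"
  shows "word_eval f (v \<cdot> w) = word_eval f v \<cdot> word_eval f w"
proof (induction v)
  case (Cons a v)
  have "word_eval f (red_cons a w') = f a \<cdot> word_eval f w'" for w'
  proof (cases "w' \<noteq> [] \<and> hd w' = inv_letter a")
    case True
    then obtain w'' where "w' = inv_letter a # w''" by (cases w') auto
    then show ?thesis by (simp add: red_cons_def f F2_cancel word_eval_carrier)
  next
    case False
    then have "red_cons a w' = a # w'" by (auto simp: red_cons_def)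
    then show ?thesis by simp
  qed
  with Cons show ?case by (simp add: mult_F2[of _ w] F2.m_assoc word_eval_carrier f)
qed (simp add: mult_F2[of _ w])

lemma pair_letter_inv:
  "u \<in> carrier F2 \<Longrightarrow> v \<in> carrier F2 \<Longrightarrow> pair_letter u v (inv_letter a) = (pair_letter u v a)\<^sup>-"
  by (auto simp: pair_letter_def inv_letter_def Let_def split: gen.split)

lemma pair_letter_carrier:
  "u \<in> carrier F2 \<Longrightarrow> v \<in> carrier F2 \<Longrightarrow> pair_letter u v a \<in> carrier F2"
  by (auto simp: pair_letter_def Let_def split: gen.split)

text \<open>The image of the substitution homomorphism is a subgroup containing \<open>u\<close> and
  \<open>v\<close>.\<close>

lemma generating_word:
  assumes "generating u v" "w \<in> carrier F2"
  shows "\<exists>w'\<in>carrier F2. word_eval (pair_letter u v) w' = w"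
proof -
  let ?f = "word_eval (pair_letter u v)"
  have uv: "u \<in> carrier F2" "v \<in> carrier F2" using assms by (auto simp: generating_def)
  note f = pair_letter_carrier[OF uv] pair_letter_inv[OF uv]
  have "?f \<in> hom F2 F2"
    by (intro homI word_eval_carrier word_eval_mult f)
  then interpret group_hom F2 F2 ?f
    by (simp add: group_F2 group_hom_axioms.intro group_hom_def)
  have "u = ?f [(GX, True)]" "v = ?f [(GY, True)]"
    using uv by (simp_all add: pair_letter_def)
  then have "u \<in> ?f ` carrier F2" "v \<in> ?f ` carrier F2" using letter_in_F2 by blast+
  then have "?f ` carrier F2 = carrier F2"
    using assms(1) img_is_subgroup unfolding generating_def by blast
  then show ?thesis using assms(2) by (metis imageE)
qed

text \<open>
  If less than the whole of each middle factor is cancelled by its two neighbours, then every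
  factor of a product leaves at least one letter.
\<close>

lemma length_word_eval:
  assumes f: "\<And>a. f a \<in> carrier F2"
    and C: "\<And>a b c. b \<noteq> inv_letter a \<Longrightarrow> c \<noteq> inv_letter b \<Longrightarrow>
      cancel (f a) (f b) + cancel (f b) (f c) < length (f b)"
    and "w \<in> carrier F2"
  shows "length w \<le> length (word_eval f w)"
proof (cases w rule: rev_cases)
  case (snoc w' a)
  \<comment> \<open>Invariant for building the product from left to right: towards the next factor
    it behaves like its last factor alone, and even after that cancellation it keeps one letter per
    factor.\<close>
  have inv: "(\<forall>b. b \<noteq> inv_letter a \<longrightarrow>
      cancel (word_eval f (w' @ [a])) (f b) = cancel (f a) (f b) \<and>
      length (w' @ [a]) + cancel (f a) (f b) \<le> length (word_eval f (w' @ [a])))"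
    if "reduced_word (w' @ [a])" for w' a
    using that
  proof (induction w' arbitrary: a rule: rev_induct)
    case Nil
    have "a \<noteq> inv_letter a" by (cases a) (simp add: inv_letter_def)
    then show ?case using C[of a a] f[of a] by (force simp: Suc_le_eq)
  next
    case (snoc b w')
    have red: "reduced_word (w' @ [b])" "a \<noteq> inv_letter b"
      using snoc.prems by (auto simp: reduced_word_def successively_append_iff)
    let ?u = "word_eval f (w' @ [b])"
    have u: "?u \<in> carrier F2" by (intro word_eval_carrier f)
    have IH: "cancel ?u (f a) = cancel (f b) (f a)"
      "length (w' @ [b]) + cancel (f b) (f a) \<le> length ?u"
      using snoc.IH[OF red(1)] red(2) by blast+
    show ?case
    proof (intro allI impI)
      fix c assume c: "c \<noteq> inv_letter a"
      have lt: "cancel (f b) (f a) + cancel (f a) (f c) < length (f a)"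
        using C red(2) c by blast
      have eq: "word_eval f ((w' @ [b]) @ [a]) = ?u \<cdot> f a"
        by (rule word_eval_snoc[OF f])
      have "cancel (?u \<cdot> f a) (f c) = cancel (f a) (f c)"
        by (rule cancel_mult) (use u f IH lt in auto)
      moreover have "length (?u \<cdot> f a) + 2 * cancel ?u (f a) = length ?u + length (f a)"
        by (rule length_mult[OF u f])
      ultimately show "cancel (word_eval f ((w' @ [b]) @ [a])) (f c) = cancel (f a) (f c) \<and>
          length ((w' @ [b]) @ [a]) + cancel (f a) (f c) \<le> length (word_eval f ((w' @ [b]) @ [a]))"
        unfolding eq using IH lt by auto
    qed
  qed
  have "a \<noteq> inv_letter a" by (cases a) (simp add: inv_letter_def)
  then have "length (w' @ [a]) + cancel (f a) (f a) \<le> length (word_eval f (w' @ [a]))"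
    using inv[of w' a] assms(3) snoc unfolding carrier_F2 by blast
  then show ?thesis using snoc by simp
qed simp

text \<open>The preimage of a line through the origin of the abelianization. It serves to show that
  a single element cannot generate.\<close>

lemma subgroup_exponent_sum:
  "subgroup {w \<in> carrier F2. exponent_sum GX w * k = exponent_sum GY w * l} F2" (is "subgroup ?K F2")
proof (rule F2.subgroupI)
  have "[] \<in> ?K" by (simp add: exponent_sum_one)
  then show "?K \<noteq> {}" by blast
qed (auto simp: exponent_sum_mult exponent_sum_inv distrib_right)

text \<open>If \<open>u\<close> were trivial, all exponent vectors would be parallel to that of
  \<open>v\<close>. Applied to both generators this makes the vector of \<open>v\<close> zero, and
  then \<open>x\<close> could not be generated.\<close>

lemma generating_not_Nil: "generating u v \<Longrightarrow> u \<noteq> []"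
proof
  assume g: "generating u v" and "u = []"
  define K where "K = {w \<in> carrier F2.
    exponent_sum GX w * exponent_sum GY v = exponent_sum GY w * exponent_sum GX v}"
  have "subgroup K F2"
    unfolding K_def by (rule subgroup_exponent_sum)
  moreover have "u \<in> K" "v \<in> K"
    using generating_carrier[OF g] \<open>u = []\<close> by (simp_all add: K_def exponent_sum_one)
  ultimately have "K = carrier F2" by (rule generatingD[OF g])
  then have "[(GX, True)] \<in> K" "[(GY, True)] \<in> K" by auto
  then have v: "exponent_sum GX v = 0" "exponent_sum GY v = 0"
    by (auto simp: K_def exponent_sum_def)
  define K' where "K' = {w \<in> carrier F2. exponent_sum GX w = 0}"
  have "subgroup K' F2"
    using subgroup_exponent_sum[of 1 0] by (simp add: K'_def)
  moreover have "u \<in> K'" "v \<in> K'"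
    using generating_carrier[OF g] v \<open>u = []\<close> by (simp_all add: K'_def exponent_sum_one)
  ultimately have "K' = carrier F2" by (rule generatingD[OF g])
  then have "[(GX, True)] \<in> K'" by auto
  then show False by (simp add: K'_def exponent_sum_def)
qed

text \<open>
  If both halves of \<open>v = p \<cdot> q\<close> are cancelled by \<open>u\<close>, then \<open>q\<close> conjugates \<open>(u \<cdot> v, v)\<close> to the
  shorter pair \<open>(q \<cdot> u \<cdot> p, q \<cdot> p)\<close>.
\<close>

lemma half_cancellation:
  assumes uv: "u \<in> carrier F2" "v \<in> carrier F2" "v \<noteq> []"
    and c: "2 * cancel u v = length v" "2 * cancel v u = length v" "length v \<le> length u"
  shows "\<exists>h\<in>carrier F2. length (h \<cdot> (u \<cdot> v) \<cdot> h\<^sup>-) + length (h \<cdot> v \<cdot> h\<^sup>-) < length u + length v"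
proof -
  define m where "m = cancel u v"
  define p where "p = take m v"
  define q where "q = drop m v"
  have v: "v = p @ q" by (simp add: p_def q_def)
  have len: "length p = m" "length q = m" "length v = 2 * m" "0 < m" "cancel v u = m"
  proof -
    show lv: "length v = 2 * m" using c(1) by (simp add: m_def)
    then show "length p = m" "length q = m" by (simp_all add: p_def q_def)
    show "0 < m" using lv uv(3) by (cases "m = 0") auto
    show "cancel v u = m" using c(2) lv by simp
  qed
  have pq: "p \<in> carrier F2" "q \<in> carrier F2"
    using uv(2) unfolding carrier_F2 reduced_word_def v successively_append_iff by auto
  have v': "v = p \<cdot> q" using uv(2) by (simp add: v carrier_F2 mult_eq_append)
  have cp: "cancel u p = m"
    by (simp add: cancel_def p_def common_prefix_take) (simp add: m_def cancel_def)
  have "q\<^sup>- = take m (v\<^sup>-)"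
    using uv(2) pq len by (simp add: inv_F2 v)
  then have cq: "cancel q u = m"
    using len(5) by (simp add: cancel_def common_prefix_commute common_prefix_take)
  \<comment> \<open>As \<open>2 * m \<le> length u\<close>, the parts of \<open>u\<close> cancelled
    from its two ends do not overlap. So \<open>q \<cdot> u \<cdot> p\<close> has at most
    \<open>length u - 2 * m\<close> letters and \<open>q \<cdot> p\<close> at most
    \<open>2 * m\<close>, which saves \<open>2 * m\<close> in total.\<close>
  have "length (q \<cdot> u \<cdot> p) + length u \<le> length (q \<cdot> u) + length (u \<cdot> p)"
    by (rule length_mult_mult_le) (use pq uv c len cp cq in auto)
  moreover have "length (q \<cdot> u) + m = length u" "length (u \<cdot> p) + m = length u"
    "length (q \<cdot> p) \<le> 2 * m"
    using length_mult[of q u] length_mult[of u p] length_mult[of q p] pq uv(1) cp cq len by auto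
  moreover have "q \<cdot> (u \<cdot> v) \<cdot> q\<^sup>- = q \<cdot> u \<cdot> p" "q \<cdot> v \<cdot> q\<^sup>- = q \<cdot> p"
    using pq uv by (simp_all add: v' F2.m_assoc)
  ultimately show ?thesis using len pq(2) by (intro bexI[of _ q]) auto
qed

text \<open>Descent on the total length. A Nielsen move or a conjugation after half cancellation
  shortens the pair; if neither is available, no product has fewer letters than factors, so every
  letter is itself one of \<open>u\<close>, \<open>v\<close> and their inverses.\<close>

theorem generating_imp_standard_pair: "generating u v \<Longrightarrow> standard_pair u v"
proof (induction "length u + length v" arbitrary: u v rule: less_induct)
  case less
  have uv: "u \<in> carrier F2" "v \<in> carrier F2" "u \<noteq> []" "v \<noteq> []"
    using less.prems generating_not_Nil generating_swap by (auto simp: generating_def)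
  define f where "f = pair_letter u v"
  have f: "f a \<in> carrier F2" "f (inv_letter a) = (f a)\<^sup>-" for a
    using uv by (auto simp: f_def pair_letter_carrier pair_letter_inv)
  \<comment> \<open>Inverting or exchanging the entries preserves generation and total length, and
    standardness transfers back; so any two signed entries from different generators may replace
    \<open>u\<close> and \<open>v\<close>.\<close>
  have gen: "generating (f a) (f b)" "length (f a) + length (f b) = length u + length v"
    "standard_pair (f a) (f b) \<Longrightarrow> standard_pair u v"
    if ne: "fst a \<noteq> fst b" for a b
  proof -
    obtain u' v' where uv': "u' = u \<or> u' = u\<^sup>-" "v' = v \<or> v' = v\<^sup>-"
      and ab: "f a = u' \<and> f b = v' \<or> f a = v' \<and> f b = u'"
    proof (cases "fst a")
      case GX
      then have "fst b = GY" using ne by (cases "fst b") auto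
      with GX that[of "f a" "f b"] show ?thesis by (simp add: f_def pair_letter_def)
    next
      case GY
      then have "fst b = GX" using ne by (cases "fst b") auto
      with GY that[of "f b" "f a"] show ?thesis by (simp add: f_def pair_letter_def)
    qed
    have u': "generating u' v" using less.prems uv'(1) generating_inv_left by metis
    have "generating v' u'" using generating_swap[OF u'] uv'(2) generating_inv_left by metis
    then show "generating (f a) (f b)" using ab generating_swap by metis
    have "length u' = length u" "length v' = length v" using uv uv' by auto
    then show "length (f a) + length (f b) = length u + length v" using ab by auto
    assume "standard_pair (f a) (f b)"
    then have "standard_pair u' v'" using ab standard_pair_swap by metis
    then have "standard_pair u v'" using uv'(1) standard_pair_inv_left uv(1) by (metis F2.inv_inv)
    then show "standard_pair u v" using uv'(2) standard_pair_inv_right uv(2) by (metis F2.inv_inv)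
  qed
  show ?case
  proof (cases "\<exists>a b. fst a \<noteq> fst b \<and> length (f a \<cdot> f b) < length (f b)")
    case True
    then obtain a b where ab: "fst a \<noteq> fst b" "length (f a \<cdot> f b) < length (f b)" by blast
    have "standard_pair (f a) (f a \<cdot> f b)"
      using less.hyps[of "f a" "f a \<cdot> f b"] gen(1,2)[OF ab(1)] ab(2) generating_mult_right by auto
    then have "standard_pair (f a) (f b)" by (rule standard_pair_mult_rightD) (rule f)+
    then show ?thesis by (rule gen(3)[OF ab(1)])
  next
    case False
    then have c1: "2 * cancel (f a) (f b) \<le> length (f a)" if "fst a \<noteq> fst b" for a b
      using that length_mult[OF f(1) f(1), of a b] by (metis add_le_cancel_left add.commute not_less)
    then have c2: "2 * cancel (f a) (f b) \<le> length (f b)" if "fst a \<noteq> fst b" for a b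
    proof -
      have "cancel (f (inv_letter b)) (f (inv_letter a)) = cancel (f a) (f b)"
        "length (f (inv_letter b)) = length (f b)"
        by (simp_all add: f cancel_inv)
      moreover have "fst (inv_letter b) \<noteq> fst (inv_letter a)" using that by (simp add: inv_letter_def)
      ultimately show ?thesis using c1[of "inv_letter b" "inv_letter a"] by simp
    qed
    have c3: "2 * cancel (f a) (f a) < length (f a)" for a
      using cancel_self[OF f(1)[of a]] uv F2.inv_eq_1_iff
      by (auto simp: f_def pair_letter_def Let_def one_F2 split: gen.splits if_splits)
    show ?thesis
    proof (cases "\<exists>a b. fst a \<noteq> fst b \<and> 2 * cancel (f a) (f b) = length (f b) \<and>
        2 * cancel (f b) (f a) = length (f b)")
      case True
      then obtain a b where ab: "fst a \<noteq> fst b" "2 * cancel (f a) (f b) = length (f b)"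
        "2 * cancel (f b) (f a) = length (f b)" by blast
      have "f b \<noteq> []" using gen(1)[of b a] ab(1) generating_not_Nil by auto
      from half_cancellation[OF f(1) f(1) this ab(2,3)] c1[OF ab(1)] ab(2)
      obtain h where h: "h \<in> carrier F2"
        "length (h \<cdot> (f a \<cdot> f b) \<cdot> h\<^sup>-) + length (h \<cdot> f b \<cdot> h\<^sup>-) < length u + length v"
        using gen(2)[OF ab(1)] by auto
      have "generating (f a \<cdot> f b) (f b)"
        by (rule generating_mult_left[OF gen(1)[OF ab(1)]])
      then have "standard_pair (h \<cdot> (f a \<cdot> f b) \<cdot> h\<^sup>-) (h \<cdot> f b \<cdot> h\<^sup>-)"
        using h generating_conj less.hyps by blast
      then have "standard_pair (f a \<cdot> f b) (f b)"
        using standard_pair_conjD[OF _ h(1)] f by blast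
      then have "standard_pair (f a) (f b)"
        using standard_pair_mult_leftD f by blast
      then show ?thesis by (rule gen(3)[OF ab(1)])
    next
      case False
      \<comment> \<open>Otherwise \<open>a\<close> and \<open>c\<close> each cancel exactly half of
        \<open>f b\<close>, so by \<open>c3\<close> neither shares its generator with
        \<open>b\<close>. Then \<open>c = a\<close> is the excluded case, and for
        \<open>c = inv_letter a\<close> the ultrametric inequality makes half of \<open>f b\<close>
        cancel against itself.\<close>
      have C: "cancel (f a) (f b) + cancel (f b) (f c) < length (f b)"
        if "b \<noteq> inv_letter a" "c \<noteq> inv_letter b" for a b c
      proof (rule ccontr)
        assume *: "\<not> ?thesis"
        have le: "2 * cancel (f a) (f b) \<le> length (f b)" "2 * cancel (f b) (f c) \<le> length (f b)"
          using c1[of b c] c2[of a b] c3[of b] letter_eq_or_inv[of a b] letter_eq_or_inv[of b c] that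
          by (metis less_imp_le)+
        then have eq: "2 * cancel (f a) (f b) = length (f b)" "2 * cancel (f b) (f c) = length (f b)"
          using * by linarith+
        then have ne: "fst a \<noteq> fst b" "fst b \<noteq> fst c"
          using c3[of b] letter_eq_or_inv[of a b] letter_eq_or_inv[of b c] that by (metis nat_less_le)+
        then have "fst a = fst c" by (metis (full_types) gen.exhaust)
        then consider "c = a" | "c = inv_letter a" using letter_eq_or_inv by blast
        then show False
        proof cases
          case 1
          with False ne eq show False by blast
        next
          case 2
          then show False
            using common_prefix_ultrametric[of "(f b)\<^sup>-" "(f a)\<^sup>-" "f b"] eq c3[of b]
            by (simp add: f cancel_def)
        qed
      qed
      \<comment> \<open>A letter has length 1, so the word expressing it has at most one
        factor.\<close>
      have letter: "\<exists>a. f a = [x]" for x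
      proof -
        obtain w where w: "w \<in> carrier F2" "word_eval f w = [x]"
          using generating_word[OF less.prems] letter_in_F2 unfolding f_def by blast
        have "length w \<le> length (word_eval f w)"
          by (rule length_word_eval) (use f(1) C w(1) in auto)
        with w have "length w \<le> 1" by simp
        with w obtain a where "w = [a]" by (cases w) auto
        with w f(1)[of a] have "f a = [x]" by simp
        then show ?thesis by blast
      qed
      from letter obtain a b where ab: "f a = [(GX, True)]" "f b = [(GY, True)]" by metis
      have "fst a \<noteq> fst b"
      proof
        assume "fst a = fst b"
        then have "b = a \<or> b = inv_letter a" by (auto simp: inv_letter_def prod_eq_iff)
        then show False using ab f by (auto simp: inv_letter_F2 inv_letter_def)
      qed
      moreover have "standard_pair (f a) (f b)"
        unfolding ab by (simp add: standard_pair_def positive_pair.letters)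
      ultimately show ?thesis using gen(3) by blast
    qed
  qed
qed

subsection \<open>Automorphisms acting trivially on the abelianization\<close>

lemma reduced_positive_word:
  "fst a \<noteq> fst b \<Longrightarrow> set w \<subseteq> {a, b} \<Longrightarrow> reduced_word w"
proof (induction w)
  case (Cons c w)
  have "hd w \<noteq> inv_letter c" if "w \<noteq> []"
  proof -
    have "hd w \<in> {a, b}" "c \<in> {a, b}" using Cons.prems(2) hd_in_set[OF that] by auto
    then show ?thesis using Cons.prems(1) by (auto simp: inv_letter_def prod_eq_iff)
  qed
  with Cons show ?case by (auto simp: reduced_word_Cons)
qed simp

text \<open>All occurrences of one generator carry the same sign, so its exponent sum counts them up
  to that sign.\<close>

lemma length_positive_word:
  assumes "fst a \<noteq> fst b" "set w \<subseteq> {a, b}"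
  shows "int (length w) = \<bar>exponent_sum GX w\<bar> + \<bar>exponent_sum GY w\<bar>"
proof -
  have "exponent_sum (fst a) w = (if snd a then 1 else -1) * int (count_list w a) \<and>
      exponent_sum (fst b) w = (if snd b then 1 else -1) * int (count_list w b) \<and>
      length w = count_list w a + count_list w b"
    using assms(2)
  proof (induction w)
    case (Cons c w)
    then have "c = a \<or> c = b" by auto
    with Cons assms(1) show ?case
      by (cases a; cases b) (auto simp: exponent_sum_def)
  qed (simp add: exponent_sum_def)
  then have "int (length w) = \<bar>exponent_sum (fst a) w\<bar> + \<bar>exponent_sum (fst b) w\<bar>"
    by (auto simp: abs_mult)
  then show ?thesis using assms(1) by (cases "fst a"; cases "fst b") auto
qed

text \<open>Words in \<open>a\<close> and \<open>b\<close> are reduced, so their group product is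
  plain concatenation, and the conjugators collect into the single \<open>h\<close>.\<close>

lemma positive_pair_words:
  "positive_pair u v \<Longrightarrow> \<exists>h\<in>carrier F2. \<exists>a b u' v'. fst a \<noteq> fst b \<and> set u' \<subseteq> {a, b} \<and>
     set v' \<subseteq> {a, b} \<and> u = h \<cdot> u' \<cdot> h\<^sup>- \<and> v = h \<cdot> v' \<cdot> h\<^sup>-"
proof (induction rule: positive_pair.induct)
  case (letters a b)
  have "[]\<^sup>- = []" using F2.inv_one by (simp only: one_F2)
  then have "[c] = [] \<cdot> [c] \<cdot> []\<^sup>-" for c :: letter by (simp add: one_F2)
  with letters show ?case
    by (intro bexI[of _ "[]"] exI[of _ a] exI[of _ b] exI[of _ "[a]"] exI[of _ "[b]"]) (auto simp: one_F2)
next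
  case (right u v)
  then obtain h a b u' v' where *: "h \<in> carrier F2" "fst a \<noteq> fst b" "set u' \<subseteq> {a, b}"
    "set v' \<subseteq> {a, b}" "u = h \<cdot> u' \<cdot> h\<^sup>-" "v = h \<cdot> v' \<cdot> h\<^sup>-" by blast
  have uv: "u' \<in> carrier F2" "v' \<in> carrier F2" "u' \<cdot> v' = u' @ v'"
    using * reduced_positive_word[of a b] by (auto simp: carrier_F2 intro!: mult_eq_append)
  have "u \<cdot> v = h \<cdot> (u' @ v') \<cdot> h\<^sup>-"
    using * uv(1,2) by (simp add: F2.m_assoc F2_cancel flip: uv(3))
  with * show ?case
    by (intro bexI[of _ h] exI[of _ a] exI[of _ b] exI[of _ u'] exI[of _ "u' @ v'"]) auto
next
  case (left u v)
  then obtain h a b u' v' where *: "h \<in> carrier F2" "fst a \<noteq> fst b" "set u' \<subseteq> {a, b}"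
    "set v' \<subseteq> {a, b}" "u = h \<cdot> u' \<cdot> h\<^sup>-" "v = h \<cdot> v' \<cdot> h\<^sup>-" by blast
  have uv: "u' \<in> carrier F2" "v' \<in> carrier F2" "u' \<cdot> v' = u' @ v'"
    using * reduced_positive_word[of a b] by (auto simp: carrier_F2 intro!: mult_eq_append)
  have "u \<cdot> v = h \<cdot> (u' @ v') \<cdot> h\<^sup>-"
    using * uv(1,2) by (simp add: F2.m_assoc F2_cancel flip: uv(3))
  with * show ?case
    by (intro bexI[of _ h] exI[of _ a] exI[of _ b] exI[of _ "u' @ v'"] exI[of _ v']) auto
next
  case (conj u v k)
  then obtain h a b u' v' where *: "h \<in> carrier F2" "fst a \<noteq> fst b" "set u' \<subseteq> {a, b}"
    "set v' \<subseteq> {a, b}" "u = h \<cdot> u' \<cdot> h\<^sup>-" "v = h \<cdot> v' \<cdot> h\<^sup>-" by blast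
  have uv: "u' \<in> carrier F2" "v' \<in> carrier F2"
    using * reduced_positive_word[of a b] by (auto simp: carrier_F2)
  have "k \<cdot> u \<cdot> k\<^sup>- = (k \<cdot> h) \<cdot> u' \<cdot> (k \<cdot> h)\<^sup>-" "k \<cdot> v \<cdot> k\<^sup>- = (k \<cdot> h) \<cdot> v' \<cdot> (k \<cdot> h)\<^sup>-"
    using * uv conj.hyps by (simp_all add: F2.m_assoc F2.inv_mult_group)
  with * conj.hyps show ?case
    by (intro bexI[of _ "k \<cdot> h"] exI[of _ a] exI[of _ b] exI[of _ u'] exI[of _ v']) auto
qed

text \<open>Exponent sums survive conjugation and give the lengths of positive words, so both
  entries are conjugates of single letters. The sign \<open>s\<close> stays open because the second
  entry may have been inverted to make the pair positive.\<close>

lemma positive_pair_conj_letters: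
  assumes "positive_pair u v" "exponent_sum GX u = 1" "exponent_sum GY u = 0"
    and "exponent_sum GX v = 0" "\<bar>exponent_sum GY v\<bar> = 1"
  shows "\<exists>h\<in>carrier F2. \<exists>s. u = h \<cdot> [(GX, True)] \<cdot> h\<^sup>- \<and> v = h \<cdot> [(GY, s)] \<cdot> h\<^sup>-"
proof -
  obtain h a b u' v' where *: "h \<in> carrier F2" "fst a \<noteq> fst b" "set u' \<subseteq> {a, b}"
    "set v' \<subseteq> {a, b}" "u = h \<cdot> u' \<cdot> h\<^sup>-" "v = h \<cdot> v' \<cdot> h\<^sup>-"
    using positive_pair_words[OF assms(1)] by blast
  have e: "exponent_sum GX u' = 1" "exponent_sum GY u' = 0" "exponent_sum GX v' = 0"
    "\<bar>exponent_sum GY v'\<bar> = 1"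
    using assms(2-) * by (simp_all add: exponent_sum_conj)
  then have "length u' = 1" "length v' = 1"
    using length_positive_word[OF *(2,3)] length_positive_word[OF *(2,4)] by auto
  then obtain c c' where c: "u' = [c]" "v' = [c']" by (auto simp: length_Suc_conv)
  obtain g s where gs: "c = (g, s)" by fastforce
  obtain g' s' where gs': "c' = (g', s')" by fastforce
  have "c = (GX, True)" using e gs unfolding c
    by (cases g; cases s) (auto simp: exponent_sum_def)
  moreover have "c' = (GY, s')" using e gs' unfolding c
    by (cases g'; cases s') (auto simp: exponent_sum_def)
  ultimately show ?thesis using * c by blast
qed

text \<open>The images of the generators form a standard pair, so one \<open>h\<close> conjugates
  them back to \<open>x\<close> and to \<open>y\<close> or its inverse; the exponent sum decides the
  sign. Agreement on generators then extends to the group.\<close>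

theorem trivial_on_abelianization_imp_inner:
  assumes "\<phi> \<in> hom F2 F2" "\<phi> ` carrier F2 = carrier F2"
    and ex: "\<And>w g. w \<in> carrier F2 \<Longrightarrow> exponent_sum g (\<phi> w) = exponent_sum g w"
  shows "\<exists>h\<in>carrier F2. \<forall>w\<in>carrier F2. \<phi> w = h \<cdot> w \<cdot> h\<^sup>-"
proof -
  interpret group_hom F2 F2 \<phi>
    by (simp add: assms(1) group_F2 group_hom_axioms.intro group_hom_def)
  define x where "x = [(GX, True)]"
  define y where "y = [(GY, True)]"
  have xy: "x \<in> carrier F2" "y \<in> carrier F2" by (simp_all add: x_def y_def)
  have xyK: "carrier F2 \<subseteq> K" if "subgroup K F2" "x \<in> K" "y \<in> K" for K
  proof
    fix w assume "w \<in> carrier F2"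
    then show "w \<in> K"
    proof (induction w rule: F2_induct)
      case one
      then show ?case using subgroup.one_closed[OF that(1)] by (simp add: one_F2)
    next
      case (mult a w)
      have "[a] = x \<or> [a] = x\<^sup>- \<or> [a] = y \<or> [a] = y\<^sup>-"
        by (cases a; cases "fst a") (auto simp: x_def y_def inv_letter_F2 inv_letter_def)
      then have "[a] \<in> K" using that subgroup.m_inv_closed by metis
      then show ?case using mult that(1) by (simp add: subgroup.m_closed)
    qed
  qed
  have "generating (\<phi> x) (\<phi> y)"
    unfolding generating_def
  proof (intro conjI allI impI)
    fix K assume K: "subgroup K F2" "\<phi> x \<in> K" "\<phi> y \<in> K"
    have "subgroup {w \<in> carrier F2. \<phi> w \<in> K} F2"
      using K xy by (intro F2.subgroupI) (auto simp: subgroup.m_inv_closed subgroup.m_closed)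
    then have "carrier F2 \<subseteq> {w \<in> carrier F2. \<phi> w \<in> K}" using K xy by (intro xyK) auto
    then have "\<phi> ` carrier F2 \<subseteq> K" by blast
    then show "K = carrier F2" using assms(2) subgroup.subset[OF K(1)] by blast
  qed (use xy in auto)
  then have "standard_pair (\<phi> x) (\<phi> y)" by (rule generating_imp_standard_pair)
  then obtain v where v: "positive_pair (\<phi> x) v" "v = \<phi> y \<or> v = (\<phi> y)\<^sup>-"
    unfolding standard_pair_def by blast
  have "\<exists>h\<in>carrier F2. \<exists>s. \<phi> x = h \<cdot> [(GX, True)] \<cdot> h\<^sup>- \<and> v = h \<cdot> [(GY, s)] \<cdot> h\<^sup>-"
  proof (rule positive_pair_conj_letters[OF v(1)])
    have e: "exponent_sum GX x = 1" "exponent_sum GY x = 0" "exponent_sum GX y = 0" "exponent_sum GY y = 1"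
      by (simp_all add: x_def y_def exponent_sum_def)
    show "exponent_sum GX (\<phi> x) = 1" "exponent_sum GY (\<phi> x) = 0"
      using ex[OF xy(1)] e by simp_all
    show "exponent_sum GX v = 0" "\<bar>exponent_sum GY v\<bar> = 1"
      using ex[OF xy(2)] exponent_sum_inv[OF hom_closed[OF xy(2)]] e v(2) by auto
  qed
  then obtain h s where h: "h \<in> carrier F2" "\<phi> x = h \<cdot> x \<cdot> h\<^sup>-" "v = h \<cdot> [(GY, s)] \<cdot> h\<^sup>-"
    unfolding x_def by blast
  have "\<exists>s. \<phi> y = h \<cdot> [(GY, s)] \<cdot> h\<^sup>-"
    using v(2)
  proof
    assume "v = (\<phi> y)\<^sup>-"
    then have "\<phi> y = (h \<cdot> [(GY, s)] \<cdot> h\<^sup>-)\<^sup>-" using h xy by (metis F2.inv_inv hom_closed)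
    also have "\<dots> = h \<cdot> [(GY, \<not> s)] \<cdot> h\<^sup>-"
      using h by (simp add: F2.inv_mult_group F2.m_assoc inv_letter_F2 inv_letter_def)
    finally show ?thesis by blast
  qed (use h in blast)
  then obtain s' where s': "\<phi> y = h \<cdot> [(GY, s')] \<cdot> h\<^sup>-" by blast
  moreover have "exponent_sum GY (\<phi> y) = 1" using ex[OF xy(2)] by (simp add: y_def exponent_sum_def)
  ultimately have "s'"
    using h(1) by (cases s') (simp_all add: exponent_sum_conj, simp add: exponent_sum_def)
  then have y: "\<phi> y = h \<cdot> y \<cdot> h\<^sup>-" using s' by (simp add: y_def)
  have "subgroup {w \<in> carrier F2. \<phi> w = h \<cdot> w \<cdot> h\<^sup>-} F2" (is "subgroup ?K F2")
  proof (rule F2.subgroupI)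
    show "?K \<noteq> {}" using xy h by blast
  qed (use h in \<open>auto simp: F2.m_assoc F2.inv_mult_group F2_cancel\<close>)
  then have "carrier F2 \<subseteq> ?K" by (rule xyK) (use xy h y in auto)
  then show ?thesis using h(1) by blast
qed

subsection \<open>Covering spaces of topological spaces\<close>

text \<open>Over an evenly covered set, two lifts in the same sheet agree and two lifts in different
  sheets differ, so agreement is locally constant. The setting is general topological spaces because
  \<open>torus\<close> carries only a topology.\<close>

lemma covering_space_lift_eq:
  fixes p :: "'a::topological_space \<Rightarrow> 'b::topological_space"
    and g1 g2 :: "'c::topological_space \<Rightarrow> 'a"
  assumes cov: "covering_space C p S" and T: "connected T"
    and g1: "continuous_on T g1" "g1 ` T \<subseteq> C" and g2: "continuous_on T g2" "g2 ` T \<subseteq> C"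
    and eq: "\<And>x. x \<in> T \<Longrightarrow> p (g1 x) = p (g2 x)"
    and a: "a \<in> T" "g1 a = g2 a" and x: "x \<in> T"
  shows "g1 x = g2 x"
proof -
  have "(\<lambda>x. g1 x = g2 x) constant_on T"
  proof (rule locally_constant_imp_constant[OF T])
    fix y assume y: "y \<in> T"
    have "p (g1 y) \<in> S" using cov g1 y covering_space_imp_surjective by blast
    then obtain B \<V> where B: "p (g1 y) \<in> B" "\<Union>\<V> = C \<inter> p -` B" "pairwise disjnt \<V>"
      "\<forall>V\<in>\<V>. openin (top_of_set C) V" "\<forall>V\<in>\<V>. \<exists>q. homeomorphism V B p q"
      using cov unfolding covering_space_def by metis
    have "g1 y \<in> \<Union>\<V>" "g2 y \<in> \<Union>\<V>" using B(1,2) g1 g2 eq y by auto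
    then obtain V1 V2 where V: "V1 \<in> \<V>" "g1 y \<in> V1" "V2 \<in> \<V>" "g2 y \<in> V2" by blast
    define W where "W = (T \<inter> g1 -` V1) \<inter> (T \<inter> g2 -` V2)"
    have "openin (top_of_set T) W"
      unfolding W_def using g1 g2 B V
      by (intro openin_Int continuous_openin_preimage[of _ _ C]) (auto simp: Pi_iff)
    moreover have "y \<in> W" using V y by (simp add: W_def)
    moreover have "(g1 z = g2 z) = (g1 y = g2 y)" if "z \<in> W" for z
    proof (cases "V1 = V2")
      case True
      obtain q where "homeomorphism V1 B p q" using B V by blast
      then have "inj_on p V1" by (metis homeomorphism_apply1 inj_onI)
      then have "g1 w = g2 w" if "w \<in> W" for w
        using that True eq[of w] unfolding W_def inj_on_def by auto
      with that \<open>y \<in> W\<close> show ?thesis by simp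
    next
      case False
      then have "V1 \<inter> V2 = {}" using B(3) V by (auto simp: pairwise_def disjnt_def)
      then show ?thesis using that \<open>y \<in> W\<close> by (auto simp: W_def)
    qed
    ultimately show "\<exists>W. openin (top_of_set T) W \<and> y \<in> W \<and> (\<forall>z\<in>W. (g1 z = g2 z) = (g1 y = g2 y))"
      by blast
  qed
  then show ?thesis using a x unfolding constant_on_def by metis
qed

lemma covering_space_openin_image:
  fixes p :: "'a::topological_space \<Rightarrow> 'b::topological_space"
  assumes cov: "covering_space C p S" and W: "openin (top_of_set C) W"
  shows "openin (top_of_set S) (p ` W)"
proof (subst openin_subopen, intro ballI)
  fix e assume "e \<in> p ` W"
  then obtain x where x: "x \<in> W" "e = p x" by blast
  then have "x \<in> C" using W openin_imp_subset by blast
  obtain N B q where N: "x \<in> N" "openin (top_of_set C) N" "p x \<in> B"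
      "openin (top_of_set S) B" "homeomorphism N B p q"
    using covering_space_local_homeomorphism[OF cov \<open>x \<in> C\<close>] by metis
  have "openin (top_of_set N) (W \<inter> N)"
    using W N(2) by (meson Int_lower2 openin_Int openin_imp_subset openin_subset_trans)
  then have "openin (top_of_set B) (p ` (W \<inter> N))"
    by (rule homeomorphism_imp_open_map[OF N(5)])
  then have "openin (top_of_set S) (p ` (W \<inter> N))" using N(4) openin_trans by blast
  then show "\<exists>T. openin (top_of_set S) T \<and> e \<in> T \<and> T \<subseteq> p ` W" using x N(1) by blast
qed

text \<open>A covering map is open and surjective, hence a quotient map.\<close>

lemma covering_space_continuous_on_descend:
  fixes p :: "'a::topological_space \<Rightarrow> 'b::topological_space"
  assumes cov: "covering_space C p S" and f: "continuous_on C (f \<circ> p)"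
  shows "continuous_on S f"
  unfolding continuous_openin_preimage_eq
proof (intro allI impI)
  fix B :: "'c set" assume "open B"
  then have "openin (top_of_set C) (C \<inter> (f \<circ> p) -` B)"
    using f continuous_openin_preimage_gen by blast
  then have "openin (top_of_set S) (p ` (C \<inter> (f \<circ> p) -` B))"
    by (rule covering_space_openin_image[OF cov])
  moreover have "p ` (C \<inter> (f \<circ> p) -` B) = S \<inter> f -` B"
    using covering_space_imp_surjective[OF cov] by auto
  ultimately show "openin (top_of_set S) (S \<inter> f -` B)" by simp
qed

text \<open>Each sheet of \<open>p\<close> over \<open>e\<close> restricts the neighbourhood of
  \<open>e\<close> on which \<open>u\<close> is evenly covered. With finite fibres only finitely
  many such conditions have to be intersected.\<close>

lemma covering_space_compose_finite:
  fixes u :: "'a::topological_space \<Rightarrow> 'b::topological_space" and p :: "'b \<Rightarrow> 'c::topological_space"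
  assumes u: "covering_space C u X" and p: "covering_space X p S"
    and fin: "\<And>e. e \<in> S \<Longrightarrow> finite {x \<in> X. p x = e}"
  shows "covering_space C (p \<circ> u) S"
proof
  have u': "u ` C = X" and p': "p ` X = S" using u p covering_space_imp_surjective by blast+
  then show "(p \<circ> u) ` C = S" by (metis image_comp)
  show cont: "continuous_on C (p \<circ> u)"
    using u u' p by (intro continuous_on_compose) (auto dest: covering_space_imp_continuous)
  fix e assume e: "e \<in> S"
  then obtain B \<V> where B: "e \<in> B" "openin (top_of_set S) B" "\<Union>\<V> = X \<inter> p -` B" "pairwise disjnt \<V>"
    "\<forall>V\<in>\<V>. openin (top_of_set X) V" "\<forall>V\<in>\<V>. \<exists>q. homeomorphism V B p q"
    using p unfolding covering_space_def by metis
  have inj: "inj_on p V" if "V \<in> \<V>" for V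
  proof -
    from bspec[OF B(6) that] obtain q where "homeomorphism V B p q" ..
    then show ?thesis by (metis homeomorphism_apply1 inj_onI)
  qed
  have img: "p ` V = B" if "V \<in> \<V>" for V
    using B(6) that homeomorphism_image1 by blast
  \<comment> \<open>The point over \<open>e\<close> in the sheet \<open>V\<close>. This choice
    embeds the set of sheets into the fibre, so there are finitely many sheets.\<close>
  define c where "c V = (SOME x. x \<in> V \<and> p x = e)" for V
  have c: "c V \<in> V \<and> p (c V) = e" if "V \<in> \<V>" for V
    unfolding c_def by (rule someI_ex) (use img[OF that] B(1) in blast)
  have cX: "c V \<in> X" if "V \<in> \<V>" for V using c[OF that] B(3) that by blast
  have "inj_on c \<V>"
    using c B(4) by (intro inj_onI) (metis disjnt_iff pairwiseD)
  moreover have "finite (c ` \<V>)"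
    by (rule finite_subset[OF _ fin[OF e]]) (use c cX in auto)
  ultimately have finV: "finite \<V>" by (rule inj_on_finite[OF _ order_refl])
  have "\<forall>V\<in>\<V>. \<exists>N \<W>. c V \<in> N \<and> openin (top_of_set X) N \<and> \<Union>\<W> = C \<inter> u -` N \<and> pairwise disjnt \<W> \<and>
     (\<forall>W\<in>\<W>. openin (top_of_set C) W) \<and> (\<forall>W\<in>\<W>. \<exists>q. homeomorphism W N u q)"
    using u cX unfolding covering_space_def by metis
  then obtain N \<W> where N: "\<And>V. V \<in> \<V> \<Longrightarrow> c V \<in> N V \<and> openin (top_of_set X) (N V) \<and>
     \<Union>(\<W> V) = C \<inter> u -` N V \<and> pairwise disjnt (\<W> V) \<and>
     (\<forall>W\<in>\<W> V. openin (top_of_set C) W) \<and> (\<forall>W\<in>\<W> V. \<exists>q. homeomorphism W (N V) u q)"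
    by metis
  \<comment> \<open>Over \<open>B'\<close> each sheet \<open>V\<close> stays inside the set
    \<open>N V\<close>, which is evenly covered by \<open>u\<close>.\<close>
  define B' where "B' = B \<inter> (\<Inter>V\<in>\<V>. p ` (V \<inter> N V))"
  have B'o: "openin (top_of_set S) B'"
  proof (cases "\<V> = {}")
    case True
    then show ?thesis using B by (simp add: B'_def)
  next
    case False
    then show ?thesis unfolding B'_def using B N finV
      by (intro openin_Int openin_INT2 covering_space_openin_image[OF p]) auto
  qed
  have eB': "e \<in> B'" using c N B by (force simp: B'_def)
  \<comment> \<open>A sheet of the composite is a sheet \<open>W\<close> of \<open>u\<close> cut
    down to the part lying over a sheet \<open>V\<close> of \<open>p\<close>.\<close>
  define \<U> where "\<U> = {W \<inter> u -` (V \<inter> p -` B') | V W. V \<in> \<V> \<and> W \<in> \<W> V}"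
  have VB': "V \<inter> p -` B' \<subseteq> N V" if "V \<in> \<V>" for V
  proof
    fix x assume x: "x \<in> V \<inter> p -` B'"
    then have "p x \<in> p ` (V \<inter> N V)" using that by (auto simp: B'_def)
    then obtain x' where "x' \<in> V \<inter> N V" "p x' = p x" by (metis imageE)
    then show "x \<in> N V" using inj[OF that] x by (auto simp: inj_on_def)
  qed
  have "\<Union>\<U> = C \<inter> (p \<circ> u) -` B'"
  proof
    show "\<Union>\<U> \<subseteq> C \<inter> (p \<circ> u) -` B'"
      using N unfolding \<U>_def by (auto dest: openin_imp_subset)
    show "C \<inter> (p \<circ> u) -` B' \<subseteq> \<Union>\<U>"
    proof
      fix z assume z: "z \<in> C \<inter> (p \<circ> u) -` B'"
      then have "u z \<in> X \<inter> p -` B" using u' by (auto simp: B'_def)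
      then obtain V where V: "V \<in> \<V>" "u z \<in> V" using B(3) by blast
      then have "z \<in> C \<inter> u -` N V" using VB'[OF V(1)] z by auto
      then obtain W where "W \<in> \<W> V" "z \<in> W" using N[OF V(1)] by blast
      then show "z \<in> \<Union>\<U>" using V z unfolding \<U>_def by auto
    qed
  qed
  moreover have "\<forall>U\<in>\<U>. openin (top_of_set C) U"
  proof
    fix U assume "U \<in> \<U>"
    then obtain V W where VW: "V \<in> \<V>" "W \<in> \<W> V" "U = W \<inter> u -` (V \<inter> p -` B')" unfolding \<U>_def by blast
    have W: "openin (top_of_set C) W" using N VW by blast
    have "openin (top_of_set C) (C \<inter> u -` V)"
      using u u' B(5) VW by (intro continuous_openin_preimage[of _ _ X]) (auto dest: covering_space_imp_continuous)
    moreover have "openin (top_of_set C) (C \<inter> (p \<circ> u) -` B')"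
      using cont B'o u' p' by (intro continuous_openin_preimage[of _ _ S]) auto
    ultimately have "openin (top_of_set C) (W \<inter> (C \<inter> u -` V) \<inter> (C \<inter> (p \<circ> u) -` B'))"
      using W by blast
    moreover have "W \<inter> (C \<inter> u -` V) \<inter> (C \<inter> (p \<circ> u) -` B') = U"
      using openin_imp_subset[OF W] VW by auto
    ultimately show "openin (top_of_set C) U" by simp
  qed
  moreover have "pairwise disjnt \<U>"
  proof (rule pairwiseI)
    fix U U' assume "U \<in> \<U>" "U' \<in> \<U>" and ne: "U \<noteq> U'"
    then obtain V W V' W' where *: "V \<in> \<V>" "W \<in> \<W> V" "U = W \<inter> u -` (V \<inter> p -` B')"
      "V' \<in> \<V>" "W' \<in> \<W> V'" "U' = W' \<inter> u -` (V' \<inter> p -` B')" unfolding \<U>_def by blast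
    show "disjnt U U'"
    proof (cases "V = V'")
      case True
      then have "W \<noteq> W'" using ne * by auto
      then have "disjnt W W'" using N[OF *(1)] * True by (auto simp: pairwise_def)
      then show ?thesis using * by (auto simp: disjnt_def)
    next
      case False
      then have "disjnt V V'" using B(4) * by (auto simp: pairwise_def)
      then show ?thesis using * by (auto simp: disjnt_def)
    qed
  qed
  moreover have "\<forall>U\<in>\<U>. \<exists>q. homeomorphism U B' (p \<circ> u) q"
  proof
    fix U assume "U \<in> \<U>"
    then obtain V W where VW: "V \<in> \<V>" "W \<in> \<W> V" "U = W \<inter> u -` (V \<inter> p -` B')" unfolding \<U>_def by blast
    obtain q where q: "homeomorphism W (N V) u q" using N VW by blast
    obtain r where r: "homeomorphism V B p r" using B VW by blast
    have "u ` U = V \<inter> p -` B'"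
    proof
      show "V \<inter> p -` B' \<subseteq> u ` U"
      proof
        fix x assume x: "x \<in> V \<inter> p -` B'"
        then have "x \<in> u ` W" using VB'[OF VW(1)] homeomorphism_image1[OF q] by auto
        then show "x \<in> u ` U" using x VW(3) by auto
      qed
    qed (auto simp: VW(3))
    then have 1: "homeomorphism U (V \<inter> p -` B') u q"
      using q VW(3) VB'[OF VW(1)] by (intro homeomorphism_of_subsets[OF q]) auto
    have "p ` (V \<inter> p -` B') = B'"
      using img[OF VW(1)] by (auto simp: B'_def)
    then have 2: "homeomorphism (V \<inter> p -` B') B' p r"
      by (intro homeomorphism_of_subsets[OF r]) (auto simp: B'_def)
    show "\<exists>q. homeomorphism U B' (p \<circ> u) q"
      using homeomorphism_compose[OF 1 2] by blast
  qed
  ultimately show "\<exists>T. e \<in> T \<and> openin (top_of_set S) T \<and> (\<exists>v. \<Union>v = C \<inter> (p \<circ> u) -` T \<and>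
      (\<forall>u\<in>v. openin (top_of_set C) u) \<and> pairwise disjnt v \<and> (\<forall>ua\<in>v. \<exists>q. homeomorphism ua T (p \<circ> u) q))"
    using eB' B'o by blast
qed

subsection \<open>Lifting maps to the once-punctured torus\<close>

text \<open>Realizes the torus as a product of two unit circles inside a normed space. The chosen
  representative does not affect the value, by periodicity.\<close>

definition torus_embedding :: "torus \<Rightarrow> complex \<times> complex" where
  "torus_embedding e = (cis (2 * pi * Re (rep_torus e)), cis (2 * pi * Im (rep_torus e)))"

lemma to_torus_rep_torus: "to_torus (rep_torus e) = e"
  by (rule Quotient_abs_rep[OF Quotient_torus])

lemma cis_2pi_eq_iff: "cis (2 * pi * x) = cis (2 * pi * y) \<longleftrightarrow> x - y \<in> \<int>"
proof -
  have "cis (2 * pi * x) = cis (2 * pi * y) \<longleftrightarrow> cis (2 * pi * (x - y)) = 1"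
    by (simp add: right_diff_distrib flip: cis_divide)
  also have "\<dots> \<longleftrightarrow> x - y \<in> \<int>"
  proof
    assume "cis (2 * pi * (x - y)) = 1"
    then have "exp (\<i> * complex_of_real (2 * pi * (x - y))) = 1" by (simp only: cis_conv_exp)
    then obtain n :: int where "2 * pi * (x - y) = of_int (2 * n) * pi" unfolding exp_eq_1 by auto
    then have "x - y = of_int n" by simp
    then show "x - y \<in> \<int>" by simp
  qed (rule cis_multiple_2pi)
  finally show ?thesis .
qed

lemma torus_embedding_to_torus:
  "torus_embedding (to_torus z) = (cis (2 * pi * Re z), cis (2 * pi * Im z))"
proof -
  have "to_torus (rep_torus (to_torus z)) = to_torus z" by (rule to_torus_rep_torus)
  then show ?thesis
    by (simp add: torus_embedding_def cis_2pi_eq_iff to_torus_eq_iff Z2_lattice_def)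
qed

lemma inj_torus_embedding: "inj torus_embedding"
proof (rule injI)
  fix e e' assume eq: "torus_embedding e = torus_embedding e'"
  obtain z w where "e = to_torus z" "e' = to_torus w" using to_torus_surj by metis
  then show "e = e'"
    using eq by (simp add: torus_embedding_to_torus cis_2pi_eq_iff to_torus_eq_iff Z2_lattice_def)
qed

lemma continuous_on_torus_iff: "continuous_on UNIV f \<longleftrightarrow> continuous_on UNIV (f \<circ> to_torus)"
  by (simp add: continuous_on_open_vimage[OF open_UNIV] open_torus_iff vimage_comp o_def)

text \<open>The torus is the image of the closed unit square, hence compact, and a continuous
  injection of a compact space into a Hausdorff space is a homeomorphism onto its image.\<close>

lemma torus_embedding_homeomorphism:
  "\<exists>k. homeomorphism E_star (torus_embedding ` E_star) torus_embedding k"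
proof -
  have "torus_embedding \<circ> to_torus = (\<lambda>z. (cis (2 * pi * Re z), cis (2 * pi * Im z)))"
    by (auto simp: torus_embedding_to_torus)
  moreover have "continuous_on UNIV (\<lambda>z. (cis (2 * pi * Re z), cis (2 * pi * Im z)))"
    unfolding cis_conv_exp by (intro continuous_intros)
  ultimately have cont: "continuous_on UNIV torus_embedding"
    by (simp add: continuous_on_torus_iff)
  have "to_torus ` cbox 0 (Complex 1 1) = UNIV"
  proof (rule UNIV_eq_I[symmetric])
    fix e
    obtain z where z: "e = to_torus z" using to_torus_surj by blast
    have "e = to_torus (Complex (frac (Re z)) (frac (Im z)))"
      by (simp add: z to_torus_eq_iff Z2_lattice_def frac_def)
    moreover have "Complex (frac (Re z)) (frac (Im z)) \<in> cbox 0 (Complex 1 1)"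
      by (simp add: in_cbox_complex_iff frac_ge_0 less_imp_le[OF frac_lt_1])
    ultimately show "e \<in> to_torus ` cbox 0 (Complex 1 1)" by blast
  qed
  then have "compact (UNIV :: torus set)"
    using compact_continuous_image[OF continuous_on_subset[OF continuous_to_torus subset_UNIV] compact_cbox]
    by metis
  then obtain k where "homeomorphism UNIV (range torus_embedding) torus_embedding k"
    using homeomorphism_compact[OF _ cont refl inj_torus_embedding] by blast
  then show ?thesis using homeomorphism_of_subsets by blast
qed

text \<open>The embedding moves the base into a normed space. There the lifting theorem applies,
  since convex sets are simply connected and locally path connected.\<close>

lemma covering_E_star_lift:
  fixes q :: "'a::real_normed_vector \<Rightarrow> torus" and f :: "'b::real_normed_vector \<Rightarrow> torus"
  assumes q: "covering_space C q E_star" and U: "convex U"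
    and f: "continuous_on U f" "f ` U \<subseteq> E_star"
    and base: "z \<in> U" "a \<in> C" "q a = f z"
  obtains g where "continuous_on U g" "g ` U \<subseteq> C" "g z = a" "\<And>y. y \<in> U \<Longrightarrow> q (g y) = f y"
proof -
  obtain k where k: "homeomorphism E_star (torus_embedding ` E_star) torus_embedding k"
    using torus_embedding_homeomorphism by blast
  have "finite {x \<in> E_star. torus_embedding x = e}" for e
    by (rule finite_subset[OF _ finite_vimageI[OF finite.intros(2)[OF finite.emptyI] inj_torus_embedding, of e]])
      auto
  then have cov: "covering_space C (torus_embedding \<circ> q) (torus_embedding ` E_star)"
    using covering_space_compose_finite[OF q homeomorphism_imp_covering_space[OF k]] by blast
  have "continuous_on U (torus_embedding \<circ> f)"
    using f k by (intro continuous_on_compose) (auto simp: homeomorphism_def elim: continuous_on_subset)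
  moreover have "torus_embedding \<circ> f \<in> U \<rightarrow> torus_embedding ` E_star"
    using f by auto
  moreover have "(torus_embedding \<circ> f) z = (torus_embedding \<circ> q) a" using base by simp
  ultimately obtain g where g: "continuous_on U g" "g \<in> U \<rightarrow> C" "g z = a"
    "\<And>y. y \<in> U \<Longrightarrow> (torus_embedding \<circ> q) (g y) = (torus_embedding \<circ> f) y"
    using covering_space_lift_strong[OF cov base(2,1) convex_imp_simply_connected[OF U]
        convex_imp_locally_path_connected[OF U]] by metis
  show thesis
    by (rule that[OF g(1)]) (use g inj_torus_embedding in \<open>auto dest: injD\<close>)
qed

text \<open>On the contractible set \<open>U\<close> both circle coordinates have continuous
  logarithms. These are purely imaginary because the coordinates have modulus 1; their imaginary
  parts over \<open>2 * pi\<close> are the coordinates of the lift.\<close>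

lemma torus_map_lift:
  fixes f :: "'a::real_normed_vector \<Rightarrow> torus"
  assumes U: "convex U" and f: "continuous_on U f" "f ` U \<subseteq> E_star"
  obtains g where "continuous_on U g" "\<And>z. z \<in> U \<Longrightarrow> to_torus (g z) = f z"
proof -
  obtain k where k: "homeomorphism E_star (torus_embedding ` E_star) torus_embedding k"
    using torus_embedding_homeomorphism by blast
  have "continuous_on U (torus_embedding \<circ> f)"
    using f k by (intro continuous_on_compose) (auto simp: homeomorphism_def elim: continuous_on_subset)
  then have c: "continuous_on U (\<lambda>z. fst (torus_embedding (f z)))"
      "continuous_on U (\<lambda>z. snd (torus_embedding (f z)))"
    by (auto simp: o_def intro: continuous_on_fst continuous_on_snd)
  have ne: "norm (fst (torus_embedding e)) = 1" "norm (snd (torus_embedding e)) = 1" for e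
    by (simp_all add: torus_embedding_def)
  then have ne': "fst (torus_embedding e) \<noteq> 0" "snd (torus_embedding e) \<noteq> 0" for e
    by (metis norm_zero zero_neq_one)+
  obtain a where a: "continuous_on U a" "\<And>z. z \<in> U \<Longrightarrow> fst (torus_embedding (f z)) = exp (a z)"
    using continuous_logarithm_on_contractible[OF c(1) convex_imp_contractible[OF U]] ne' by metis
  obtain b where b: "continuous_on U b" "\<And>z. z \<in> U \<Longrightarrow> snd (torus_embedding (f z)) = exp (b z)"
    using continuous_logarithm_on_contractible[OF c(2) convex_imp_contractible[OF U]] ne' by metis
  have ab: "exp (a z) = cis (Im (a z))" "exp (b z) = cis (Im (b z))" if "z \<in> U" for z
  proof -
    have "norm (exp (a z)) = 1" "norm (exp (b z)) = 1"
      using ne[of "f z"] a(2)[OF that] b(2)[OF that] by simp_all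
    then have "Re (a z) = 0" "Re (b z) = 0" by simp_all
    then show "exp (a z) = cis (Im (a z))" "exp (b z) = cis (Im (b z))"
      by (simp_all add: exp_eq_polar)
  qed
  define g where "g z = Complex (Im (a z) / (2 * pi)) (Im (b z) / (2 * pi))" for z
  have "continuous_on U g"
    unfolding g_def using a b by (intro continuous_intros) auto
  moreover have "to_torus (g z) = f z" if "z \<in> U" for z
  proof -
    have "torus_embedding (to_torus (g z)) = torus_embedding (f z)"
      using a(2)[OF that] b(2)[OF that] ab[OF that]
      by (simp add: torus_embedding_to_torus g_def prod_eq_iff)
    then show ?thesis using inj_torus_embedding by (simp add: inj_eq)
  qed
  ultimately show thesis by (rule that)
qed

text \<open>The difference is continuous with values in the lattice, whose distinct points are at
  distance at least 1.\<close>

lemma to_torus_eq_on_connected: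
  fixes f g :: "'a::topological_space \<Rightarrow> complex"
  assumes "connected S" "continuous_on S f" "continuous_on S g"
    and eq: "\<And>x. x \<in> S \<Longrightarrow> to_torus (f x) = to_torus (g x)"
  shows "\<exists>l\<in>Z2_lattice. \<forall>x\<in>S. f x = g x + l"
proof (cases "S = {}")
  case False
  have d: "f x - g x \<in> Z2_lattice" if "x \<in> S" for x
    using eq[OF that] by (simp add: to_torus_eq_iff)
  have "(\<lambda>x. f x - g x) constant_on S"
  proof (rule continuous_discrete_range_constant[OF assms(1)])
    show "continuous_on S (\<lambda>x. f x - g x)" using assms by (intro continuous_intros)
    fix x assume x: "x \<in> S"
    have "1 \<le> norm ((f y - g y) - (f x - g x))" if "y \<in> S" "f y - g y \<noteq> f x - g x" for y
    proof (rule ccontr)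
      assume "\<not> ?thesis"
      moreover have "(f y - g y) - (f x - g x) \<in> Z2_lattice"
        using d[OF x] d[OF that(1)] by (simp add: Z2_lattice_def)
      ultimately have "(f y - g y) - (f x - g x) = 0" by (intro Z2_lattice_small) auto
      with that(2) show False by simp
    qed
    then show "\<exists>e>0. \<forall>y. y \<in> S \<and> f y - g y \<noteq> f x - g x \<longrightarrow> e \<le> norm ((f y - g y) - (f x - g x))"
      by (intro exI[of _ 1]) auto
  qed
  then obtain l where l: "\<And>x. x \<in> S \<Longrightarrow> f x - g x = l" unfolding constant_on_def by blast
  with False d have "l \<in> Z2_lattice" by blast
  then show ?thesis using l by (metis add.commute diff_add_cancel)
next
  case True
  then show ?thesis using Z2_lattice_0 by blast
qed

subsection \<open>Matrices acting on the plane\<close>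

definition mat_act :: "real^2^2 \<Rightarrow> complex \<Rightarrow> complex" where
  "mat_act A z = Complex (A$1$1 * Re z + A$1$2 * Im z) (A$2$1 * Re z + A$2$2 * Im z)"

text \<open>The adjugate: an inverse up to the factor \<open>det A\<close>, with integral entries
  whenever \<open>A\<close> has them.\<close>

definition mat_adj :: "real^2^2 \<Rightarrow> real^2^2" where
  "mat_adj A = vector [vector [A$2$2, - A$1$2], vector [- A$2$1, A$1$1]]"

lemma real2_of_complex_nth [simp]:
  "real2_of_complex z $ 1 = Re z" "real2_of_complex z $ 2 = Im z"
  by (simp_all add: real2_of_complex_def)

lemma real2_of_complex_eq_iff: "real2_of_complex z = v \<longleftrightarrow> Re z = v $ 1 \<and> Im z = v $ 2"
  by (simp add: vec_eq_iff forall_2)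

lemma real2_of_complex_mat_act: "real2_of_complex (mat_act A z) = A *v real2_of_complex z"
  by (simp add: vec_eq_iff forall_2 matrix_vector_mult_def sum_2 mat_act_def)

lemma affine_eq_iff:
  "real2_of_complex z' = A *v real2_of_complex z + b \<longleftrightarrow> z' = mat_act A z + Complex (b $ 1) (b $ 2)"
  by (auto simp: real2_of_complex_eq_iff complex_eq_iff simp flip: real2_of_complex_mat_act)

lemma mat_act_0 [simp]: "mat_act A 0 = 0"
  by (simp add: mat_act_def complex_eq_iff)

lemma mat_act_add: "mat_act A (z + w) = mat_act A z + mat_act A w"
  by (simp add: mat_act_def complex_eq_iff algebra_simps)

lemma continuous_on_mat_act [continuous_intros]:
  "continuous_on S f \<Longrightarrow> continuous_on S (\<lambda>x. mat_act A (f x))"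
  unfolding mat_act_def by (intro continuous_intros)

lemma mat_adj_nth [simp]:
  "mat_adj A $ 1 $ 1 = A$2$2" "mat_adj A $ 1 $ 2 = - A$1$2"
  "mat_adj A $ 2 $ 1 = - A$2$1" "mat_adj A $ 2 $ 2 = A$1$1"
  by (simp_all add: mat_adj_def)

lemma mat_act_mat_adj: "mat_act (mat_adj A) (mat_act A z) = of_real (det A) * z"
  "mat_act A (mat_act (mat_adj A) z) = of_real (det A) * z"
  by (simp_all add: mat_act_def complex_eq_iff det_2 algebra_simps)

lemma mat_adj_SL2Z: "A \<in> SL2Z \<Longrightarrow> mat_adj A \<in> SL2Z"
  by (auto simp: SL2Z_def det_2 forall_2 mult.commute)

lemma SL2Z_cancel:
  assumes "A \<in> SL2Z"
  shows "mat_act (mat_adj A) (mat_act A z) = z" "mat_act A (mat_act (mat_adj A) z) = z"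
  using assms by (simp_all add: mat_act_mat_adj SL2Z_def)

lemma mat_act_lattice: "A \<in> SL2Z \<Longrightarrow> z \<in> Z2_lattice \<Longrightarrow> mat_act A z \<in> Z2_lattice"
  by (auto simp: SL2Z_def Z2_lattice_def mat_act_def intro!: Ints_add Ints_mult)

lemma mat_act_lattice_iff: "A \<in> SL2Z \<Longrightarrow> mat_act A z \<in> Z2_lattice \<longleftrightarrow> z \<in> Z2_lattice"
  using mat_act_lattice mat_act_lattice[OF mat_adj_SL2Z, of A "mat_act A z"] SL2Z_cancel(1) by metis

lemma mat_act_eq_imp_eq:
  assumes "open S" "S \<noteq> {}" "\<And>z. z \<in> S \<Longrightarrow> mat_act A z + b = mat_act B z + c"
  shows "A = B"
proof -
  obtain z where z: "z \<in> S" using assms(2) by blast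
  then obtain r where r: "r > 0" "ball z r \<subseteq> S" using assms(1) open_contains_ball by blast
  have "mat_act A w = mat_act B w" if "norm w < r" for w
  proof -
    have "z + w \<in> S" using r that by (auto simp: subset_iff dist_norm)
    from assms(3)[OF this] assms(3)[OF z] show ?thesis
      by (simp add: mat_act_add) (metis add.assoc add.commute add_left_cancel)
  qed
  from this[of "of_real (r/2)"] this[of "Complex 0 (r/2)"] r(1)
  show ?thesis by (simp add: mat_act_def vec_eq_iff forall_2 cmod_def)
qed

text \<open>The image of 0 shows that \<open>b\<close> is a lattice vector, so \<open>A\<close>
  itself maps the lattice onto the lattice. Integrality of \<open>A\<close> and of its inverse
  leaves only determinant 1 once it is positive.\<close>

lemma lattice_preserving_imp_SL2Z:
  assumes "det A > 0" "(\<lambda>z. mat_act A z + b) ` Z2_lattice = Z2_lattice"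
  shows "A \<in> SL2Z"
proof -
  have b: "b \<in> Z2_lattice"
    using assms(2) Z2_lattice_0 by (metis add_0 imageI mat_act_0)
  have A: "mat_act A z \<in> Z2_lattice" if "z \<in> Z2_lattice" for z
  proof -
    have "mat_act A z + b \<in> Z2_lattice" using assms(2) that by blast
    from Z2_lattice_add[OF this Z2_lattice_minus[OF b]] show ?thesis by simp
  qed
  have surj: "\<exists>w\<in>Z2_lattice. mat_act A w = z" if "z \<in> Z2_lattice" for z
  proof -
    have "z + b \<in> Z2_lattice" using that b by (rule Z2_lattice_add)
    then show ?thesis using assms(2) by (metis (no_types, lifting) add_right_cancel imageE)
  qed
  have int: "A $ i $ j \<in> \<int>" for i j
    using A[of 1] A[of \<i>] by (cases i rule: exhaust_2[THEN disjE]; cases j rule: exhaust_2[THEN disjE])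
      (auto simp: Z2_lattice_def mat_act_def)
  obtain v w where vw: "v \<in> Z2_lattice" "mat_act A v = 1" "w \<in> Z2_lattice" "mat_act A w = \<i>"
    using surj[of 1] surj[of \<i>] by (auto simp: Z2_lattice_def)
  \<comment> \<open>Multiplicativity of the determinant; \<open>v\<close> and \<open>w\<close> are
    the columns of an integral inverse of \<open>A\<close>.\<close>
  have "det A * (Re v * Im w - Im v * Re w) =
      Re (mat_act A v) * Im (mat_act A w) - Im (mat_act A v) * Re (mat_act A w)"
    by (simp add: mat_act_def det_2 algebra_simps)
  then have "det A * (Re v * Im w - Im v * Re w) = 1" using vw by simp
  moreover have "det A \<in> \<int>" unfolding det_2 by (intro Ints_diff Ints_mult int)
  moreover have "Re v * Im w - Im v * Re w \<in> \<int>"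
    using vw unfolding Z2_lattice_def by (intro Ints_diff Ints_mult) auto
  ultimately obtain m n :: int where mn: "det A = of_int m" "of_int m * of_int n = (1::real)"
    by (metis Ints_cases)
  then have "m * n = 1" by (metis of_int_eq_1_iff of_int_mult)
  moreover have "m > 0" using mn(1) assms(1) by simp
  ultimately have "m = 1" by (simp add: pos_zmult_eq_1_iff)
  then show ?thesis using int mn(1) by (simp add: SL2Z_def)
qed

subsection \<open>The developing map\<close>

abbreviation \<H> where "\<H> \<equiv> upper_half_plane"

lemma UHP: "convex \<H>" "connected \<H>" "open \<H>" "\<i> \<in> \<H>"
proof -
  show c: "convex \<H>" unfolding upper_half_plane_def by (rule convex_halfspace_Im_gt)
  show "connected \<H>" by (rule convex_connected[OF c])
  show "open \<H>" unfolding upper_half_plane_def by (rule open_halfspace_Im_gt)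
qed (simp add: upper_half_plane_def)

lemma self_homeos_iff:
  "f \<in> self_homeos Y \<longleftrightarrow> f \<in> extensional Y \<and> (\<exists>g. homeomorphism Y Y f g)"
proof
  assume "f \<in> extensional Y \<and> (\<exists>g. homeomorphism Y Y f g)"
  then obtain g where f: "f \<in> extensional Y" "homeomorphism Y Y f g" by blast
  then have "bij_betw f Y Y"
    by (auto simp: bij_betw_def homeomorphism_def intro: inj_on_inverseI[of _ g])
  moreover have "homeomorphism Y Y f (inv_into Y f)"
    using f(2) calculation
    by (intro homeomorphism_cong[OF f(2)])
      (auto simp: homeomorphism_def bij_betw_def intro!: inv_into_f_eq)
  ultimately show "f \<in> self_homeos Y" using f(1) by (simp add: self_homeos_def Bij_def)
qed (auto simp: self_homeos_def Bij_def)

lemma mem_deck_group: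
  "g \<in> carrier (deck_group C q) \<longleftrightarrow>
     g \<in> extensional C \<and> (\<exists>k. homeomorphism C C g k) \<and> (\<forall>z\<in>C. q (g z) = q z)"
  by (auto simp: deck_group_def self_homeos_iff)

lemma deck_group_mult:
  "g \<in> carrier (deck_group C q) \<Longrightarrow> h \<in> carrier (deck_group C q) \<Longrightarrow>
     g \<otimes>\<^bsub>deck_group C q\<^esub> h = compose C g h"
  by (auto simp: deck_group_def BijGroup_def self_homeos_def)

lemma deck_group_image: "g \<in> carrier (deck_group C q) \<Longrightarrow> z \<in> C \<Longrightarrow> g z \<in> C"
  by (auto simp: mem_deck_group homeomorphism_def)

lemma countable_Z2_lattice: "countable Z2_lattice"
proof -
  have "Z2_lattice = (\<lambda>(m, n). Complex (of_int m) (of_int n)) ` (UNIV :: (int \<times> int) set)"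
    by (auto simp: Z2_lattice_def image_iff complex_eq_iff elim!: Ints_cases)
  then show ?thesis by (metis countable_image countableI_type)
qed

locale developed_cover =
  fixes P :: "complex \<Rightarrow> torus" and D :: "complex \<Rightarrow> complex"
  assumes cov: "covering_space \<H> P E_star"
    and cont_D: "continuous_on \<H> D"
    and to_torus_D: "\<And>z. z \<in> \<H> \<Longrightarrow> to_torus (D z) = P z"
begin

lemma P_E_star: "z \<in> \<H> \<Longrightarrow> P z \<in> E_star"
  using covering_space_imp_surjective[OF cov] by blast

lemma cont_P: "continuous_on \<H> P"
  by (rule covering_space_imp_continuous[OF cov])

lemma D_not_lattice: "z \<in> \<H> \<Longrightarrow> D z \<notin> Z2_lattice"
  using P_E_star[of z] to_torus_D[of z] to_torus_eq_iff[of "D z" 0] by (auto simp: E_star_def)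

text \<open>The complement of a countable set in the plane is path connected. A path there projects
  to \<open>E_star\<close> and lifts to the half plane; developing the lift returns the path, since
  both start at \<open>D \<i>\<close>.\<close>

lemma D_image: "D ` \<H> = - Z2_lattice"
proof
  show "D ` \<H> \<subseteq> - Z2_lattice" using D_not_lattice by blast
  show "- Z2_lattice \<subseteq> D ` \<H>"
  proof
    fix w assume w: "w \<in> - Z2_lattice"
    have "path_connected (- Z2_lattice)"
      by (rule path_connected_complement_countable) (simp_all add: countable_Z2_lattice)
    then obtain \<gamma> where \<gamma>: "path \<gamma>" "path_image \<gamma> \<subseteq> - Z2_lattice" "pathstart \<gamma> = D \<i>" "pathfinish \<gamma> = w"
      using w D_not_lattice[OF UHP(4)] unfolding path_connected_def by blast
    have c: "continuous_on {0..1} \<gamma>" using \<gamma>(1) by (simp add: path_def)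
    obtain g where g: "continuous_on {0..1} g" "g ` {0..1} \<subseteq> \<H>" "g 0 = \<i>"
      "\<And>t. t \<in> {0..1::real} \<Longrightarrow> P (g t) = (to_torus \<circ> \<gamma>) t"
    proof (rule covering_E_star_lift[OF cov, of "{0..1::real}" "to_torus \<circ> \<gamma>" 0 \<i>])
      show "continuous_on {0..1} (to_torus \<circ> \<gamma>)"
        by (intro continuous_on_compose c continuous_on_subset[OF continuous_to_torus]) simp
      show "(to_torus \<circ> \<gamma>) ` {0..1} \<subseteq> E_star"
      proof safe
        fix t :: real assume "t \<in> {0..1}"
        then have "\<gamma> t - 0 \<notin> Z2_lattice" using \<gamma>(2) by (simp add: path_image_def image_subset_iff)
        then show "(to_torus \<circ> \<gamma>) t \<in> E_star" unfolding to_torus_eq_iff[symmetric] by (simp add: E_star_def)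
      qed
      show "P \<i> = (to_torus \<circ> \<gamma>) 0"
        using \<gamma>(3) to_torus_D[OF UHP(4)] by (simp add: pathstart_def)
    qed (use UHP in auto)
    have "\<exists>l\<in>Z2_lattice. \<forall>t\<in>{0..1::real}. (D \<circ> g) t = \<gamma> t + l"
    proof (rule to_torus_eq_on_connected)
      show "continuous_on {0..1} (D \<circ> g)"
        by (intro continuous_on_compose g(1) continuous_on_subset[OF cont_D g(2)])
      show "to_torus ((D \<circ> g) t) = to_torus (\<gamma> t)" if "t \<in> {0..1}" for t
        using g(4)[OF that] to_torus_D[of "g t"] g(2) that by (simp add: image_subset_iff)
    qed (use c in auto)
    then obtain l where l: "\<And>t. t \<in> {0..1::real} \<Longrightarrow> D (g t) = \<gamma> t + l" by auto
    have "l = 0" using l[of 0] g(3) \<gamma>(3) by (simp add: pathstart_def)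
    then have "w = D (g 1)" using l[of 1] \<gamma>(4) by (simp add: pathfinish_def)
    then show "w \<in> D ` \<H>" using g(2) by force
  qed
qed

text \<open>On a small ball \<open>s \<circ> P\<close> and \<open>D\<close> are both lifts of
  \<open>P\<close> to the plane.\<close>

lemma chart_developing:
  assumes V: "(V, s) \<in> E_star_atlas" and z: "z \<in> \<H>" "P z \<in> V"
  shows "\<exists>N c. open N \<and> z \<in> N \<and> N \<subseteq> \<H> \<and> P ` N \<subseteq> V \<and> (\<forall>n\<in>N. s (P n) = D n + c)"
proof -
  have V': "open V" "continuous_on V s" "\<And>e. e \<in> V \<Longrightarrow> to_torus (s e) = e"
    using V by (auto simp: E_star_atlas_iff)
  have "open (\<H> \<inter> P -` V)"
    using continuous_open_preimage[OF cont_P UHP(3) V'(1)] .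
  then obtain r where r: "r > 0" "ball z r \<subseteq> \<H> \<inter> P -` V"
    using z open_contains_ball by (metis IntI vimageI)
  have "\<exists>l\<in>Z2_lattice. \<forall>n\<in>ball z r. (s \<circ> P) n = D n + l"
  proof (rule to_torus_eq_on_connected)
    show "continuous_on (ball z r) (s \<circ> P)"
      using r by (intro continuous_on_compose continuous_on_subset[OF cont_P] continuous_on_subset[OF V'(2)]) auto
    show "continuous_on (ball z r) D" using r by (intro continuous_on_subset[OF cont_D]) auto
    show "to_torus ((s \<circ> P) n) = to_torus (D n)" if "n \<in> ball z r" for n
    proof -
      have "n \<in> \<H>" "P n \<in> V" using r(2) that by auto
      then show ?thesis by (simp add: V'(3) to_torus_D)
    qed
  qed simp
  then obtain l where "\<forall>n\<in>ball z r. s (P n) = D n + l" by auto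
  with r show ?thesis by (intro exI[of _ "ball z r"] exI[of _ l]) auto
qed

text \<open>Locally \<open>D\<close> is a translate of a chart of \<open>E_star\<close> composed
  with \<open>P\<close>, and both of these are open maps.\<close>

lemma open_D_image:
  assumes "open N" "N \<subseteq> \<H>"
  shows "open (D ` N)"
  unfolding open_subopen[of "D ` N"]
proof
  fix w assume "w \<in> D ` N"
  then obtain z where z: "z \<in> N" "w = D z" by blast
  then have zH: "z \<in> \<H>" using assms by blast
  obtain V s where V: "(V, s) \<in> E_star_atlas" "P z \<in> V"
    using E_star_atlas_cover[OF P_E_star[OF zH]] by auto
  obtain M c where M: "open M" "z \<in> M" "M \<subseteq> \<H>" "P ` M \<subseteq> V" "\<forall>n\<in>M. s (P n) = D n + c"
    using chart_developing[OF V(1) zH V(2)] by blast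
  have "openin (top_of_set \<H>) (N \<inter> M)"
    using assms M UHP(3) by (simp add: openin_open_eq open_Int le_infI1)
  then have "open (P ` (N \<inter> M))"
    by (rule covering_E_star_open_map[OF cov])
  then have "open (s ` P ` (N \<inter> M))"
    using M(4) by (intro E_star_section_open[OF V(1)]) auto
  moreover have "D ` (N \<inter> M) = (\<lambda>v. - c + v) ` s ` P ` (N \<inter> M)"
    using M(5) by (force simp: image_iff)
  ultimately have "open (D ` (N \<inter> M))" by (metis open_translation)
  then show "\<exists>T. open T \<and> w \<in> T \<and> T \<subseteq> D ` N" using z M(2) by blast
qed

end

section \<open>Deck transformations and their periods\<close>

context developed_cover
begin

abbreviation Deck where "Deck \<equiv> deck_group \<H> P"

text \<open>The period of a deck transformation. The base point \<i> is arbitrary, since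
  \<open>D (g z) - D z\<close> is constant on the half plane.\<close>

definition hol :: "(complex \<Rightarrow> complex) \<Rightarrow> complex" where
  "hol g = D (g \<i>) - D \<i>"

lemma continuous_on_D_comp: "continuous_on S g \<Longrightarrow> g ` S \<subseteq> \<H> \<Longrightarrow> continuous_on S (D \<circ> g)"
  by (intro continuous_on_compose continuous_on_subset[OF cont_D])

lemma P_lift_eq:
  assumes "continuous_on \<H> g" "g ` \<H> \<subseteq> \<H>" "continuous_on \<H> h" "h ` \<H> \<subseteq> \<H>"
    and "\<And>z. z \<in> \<H> \<Longrightarrow> P (g z) = P (h z)" "a \<in> \<H>" "g a = h a" "z \<in> \<H>"
  shows "g z = h z"
  by (rule covering_space_lift_eq[OF cov UHP(2)]) (use assms in auto)

lemma deck_homeo: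
  assumes "g \<in> carrier Deck"
  shows "continuous_on \<H> g" "g ` \<H> \<subseteq> \<H>" "\<And>z. z \<in> \<H> \<Longrightarrow> P (g z) = P z" "g \<in> extensional \<H>"
  using assms by (auto simp: mem_deck_group homeomorphism_def)

text \<open>Both composites are lifts of \<open>P\<close> along \<open>P\<close>. The first fixes
  \<open>a\<close> and the second fixes \<open>f a\<close>, so uniqueness of lifts makes them the
  identity.\<close>

lemma homeomorphism_lift:
  assumes "continuous_on \<H> f" "f ` \<H> \<subseteq> \<H>" "continuous_on \<H> g" "g ` \<H> \<subseteq> \<H>"
    and "\<And>z. z \<in> \<H> \<Longrightarrow> P (g (f z)) = P z" "\<And>z. z \<in> \<H> \<Longrightarrow> P (f (g z)) = P z"
    and "a \<in> \<H>" "g (f a) = a"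
  shows "homeomorphism \<H> \<H> f g"
proof -
  have c: "continuous_on \<H> (g \<circ> f)" "continuous_on \<H> (f \<circ> g)"
    by (rule continuous_on_compose[OF assms(1) continuous_on_subset[OF assms(3,2)]],
        rule continuous_on_compose[OF assms(3) continuous_on_subset[OF assms(1,4)]])
  have "(g \<circ> f) z = id z" if "z \<in> \<H>" for z
    by (rule P_lift_eq[where g = "g \<circ> f" and h = id and a = a]) (use c assms that in auto)
  moreover have "(f \<circ> g) z = id z" if "z \<in> \<H>" for z
    by (rule P_lift_eq[where g = "f \<circ> g" and h = id and a = "f a"]) (use c assms that in auto)
  ultimately show ?thesis using assms(1-4) by (intro homeomorphismI) auto
qed

lemma P_lift:
  assumes "continuous_on \<H> f" "f ` \<H> \<subseteq> E_star" "z \<in> \<H>" "a \<in> \<H>" "P a = f z"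
  obtains g where "continuous_on \<H> g" "g ` \<H> \<subseteq> \<H>" "g z = a" "\<And>y. y \<in> \<H> \<Longrightarrow> P (g y) = f y"
  using covering_E_star_lift[OF cov UHP(1) assms] by metis

text \<open>The half plane is simply connected, so \<open>P\<close> lifts along itself from
  \<open>z\<close> to \<open>z'\<close> and back; the two lifts are mutually inverse.\<close>

lemma deck_transitive:
  assumes "z \<in> \<H>" "z' \<in> \<H>" "P z = P z'"
  shows "\<exists>g\<in>carrier Deck. g z = z'"
proof -
  have P: "P ` \<H> \<subseteq> E_star" using P_E_star by blast
  obtain f where f: "continuous_on \<H> f" "f ` \<H> \<subseteq> \<H>" "f z = z'" "\<And>y. y \<in> \<H> \<Longrightarrow> P (f y) = P y"
    using P_lift[OF cont_P P assms(1,2)] assms(3) by metis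
  obtain g where g: "continuous_on \<H> g" "g ` \<H> \<subseteq> \<H>" "g z' = z" "\<And>y. y \<in> \<H> \<Longrightarrow> P (g y) = P y"
    using P_lift[OF cont_P P assms(2,1)] assms(3) by metis
  have "homeomorphism \<H> \<H> f g"
    by (rule homeomorphism_lift[OF f(1,2) g(1,2) _ _ assms(1)]) (use f g in auto)
  then have "homeomorphism \<H> \<H> (restrict f \<H>) g"
    by (rule homeomorphism_cong) auto
  then have "restrict f \<H> \<in> carrier Deck" using f(4) by (auto simp: mem_deck_group)
  then show ?thesis using f(3) assms(1) by (intro bexI[of _ "restrict f \<H>"]) auto
qed

lemma D_deck:
  assumes g: "g \<in> carrier Deck"
  shows "hol g \<in> Z2_lattice" "z \<in> \<H> \<Longrightarrow> D (g z) = D z + hol g"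
proof -
  note g' = deck_homeo[OF g]
  have "\<exists>l\<in>Z2_lattice. \<forall>z\<in>\<H>. (D \<circ> g) z = D z + l"
  proof (rule to_torus_eq_on_connected[OF UHP(2) continuous_on_D_comp[OF g'(1,2)] cont_D])
    fix z assume z: "z \<in> \<H>"
    then have "g z \<in> \<H>" using g'(2) by blast
    then show "to_torus ((D \<circ> g) z) = to_torus (D z)" using z g'(3) by (simp add: to_torus_D)
  qed
  then obtain l where l: "l \<in> Z2_lattice" "\<And>z. z \<in> \<H> \<Longrightarrow> D (g z) = D z + l" by auto
  then have "hol g = l" using UHP(4) by (simp add: hol_def)
  with l show "hol g \<in> Z2_lattice" "z \<in> \<H> \<Longrightarrow> D (g z) = D z + hol g" by auto
qed

lemma hol_eqI: "g \<in> carrier Deck \<Longrightarrow> z \<in> \<H> \<Longrightarrow> D (g z) = D z + c \<Longrightarrow> hol g = c"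
  by (simp add: D_deck(2))

lemma hol_compose:
  assumes "g \<in> carrier Deck" "h \<in> carrier Deck"
  shows "hol (compose \<H> g h) = hol g + hol h"
proof -
  have "h \<i> \<in> \<H>" using deck_homeo(2)[OF assms(2)] UHP(4) by blast
  then have "D (g (h \<i>)) = D \<i> + hol h + hol g" using D_deck(2) assms UHP(4) by simp
  then show ?thesis by (simp add: hol_def compose_def UHP(4))
qed

text \<open>Developing the lifted path yields a translate of the segment from \<open>Q\<close> to
  \<open>Q'\<close>, so its end points differ by \<open>Q' - Q\<close>.\<close>

lemma hol_lift:
  assumes "is_lift_from_to P (to_torus \<circ> linepath Q Q') z (g z)" "g \<in> carrier Deck" "z \<in> \<H>"
  shows "hol g = Q' - Q"
proof -
  obtain \<gamma> where \<gamma>: "path \<gamma>" "path_image \<gamma> \<subseteq> \<H>" "pathstart \<gamma> = z" "pathfinish \<gamma> = g z"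
    "\<And>t. t \<in> {0..1} \<Longrightarrow> P (\<gamma> t) = to_torus (linepath Q Q' t)"
    using assms(1) unfolding is_lift_from_to_def by auto
  have im: "\<gamma> t \<in> \<H>" if "t \<in> {0..1}" for t using \<gamma>(2) that by (auto simp: path_image_def)
  have "\<exists>l\<in>Z2_lattice. \<forall>t\<in>{0..1::real}. (D \<circ> \<gamma>) t = linepath Q Q' t + l"
  proof (rule to_torus_eq_on_connected)
    show "continuous_on {0..1} (D \<circ> \<gamma>)"
      using \<gamma>(1,2) by (intro continuous_on_D_comp) (auto simp: path_def path_image_def)
    show "to_torus ((D \<circ> \<gamma>) t) = to_torus (linepath Q Q' t)" if "t \<in> {0..1}" for t
      using \<gamma>(5)[OF that] im[OF that] by (simp add: to_torus_D)
  qed (auto intro: continuous_on_linepath)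
  then obtain l where l: "\<And>t. t \<in> {0..1::real} \<Longrightarrow> D (\<gamma> t) = linepath Q Q' t + l" by auto
  have "D z = Q + l" "D (g z) = Q' + l"
    using l[of 0] l[of 1] \<gamma>(3,4) by (simp_all add: pathstart_def pathfinish_def linepath_def)
  then show ?thesis using hol_eqI[OF assms(2,3), of "Q' - Q"] by simp
qed

subsection \<open>Affine homeomorphisms of the universal covering\<close>

definition dev_affine :: "real^2^2 \<Rightarrow> (complex \<Rightarrow> complex) \<Rightarrow> bool" where
  "dev_affine A f \<longleftrightarrow> (\<exists>b. \<forall>z\<in>\<H>. D (f z) = mat_act A (D z) + b)"

text \<open>The affine map of the plane is bijective and preserves the image of \<open>D\<close>,
  hence also its complement, the lattice.\<close>

lemma dev_affine_SL2Z:
  assumes "dev_affine A f" "f ` \<H> = \<H>" "det A > 0"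
  shows "A \<in> SL2Z"
proof -
  obtain b where b: "\<And>z. z \<in> \<H> \<Longrightarrow> D (f z) = mat_act A (D z) + b"
    using assms(1) unfolding dev_affine_def by blast
  let ?F = "\<lambda>z. mat_act A z + b"
  have inj: "inj ?F"
  proof (rule injI)
    fix z w assume "?F z = ?F w"
    then have "mat_act (mat_adj A) (mat_act A z) = mat_act (mat_adj A) (mat_act A w)" by simp
    then show "z = w" using assms(3) by (simp add: mat_act_mat_adj)
  qed
  have surj: "surj ?F"
  proof (rule surjI)
    show "?F (mat_act (mat_adj A) (of_real (1 / det A) * (z - b))) = z" for z
      using assms(3) by (simp add: mat_act_mat_adj)
  qed
  have "D ` \<H> = D ` (f ` \<H>)" using assms(2) by simp
  also have "\<dots> = ?F ` D ` \<H>" using b by (force simp: image_image)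
  finally have "- Z2_lattice = ?F ` (- Z2_lattice)" by (simp add: D_image)
  also have "\<dots> = - ?F ` Z2_lattice" using bij_image_Compl_eq inj surj by (metis bijI)
  finally have "?F ` Z2_lattice = Z2_lattice" by simp
  then show ?thesis by (rule lattice_preserving_imp_SL2Z[OF assms(3)])
qed

lemma dev_affine_inverse:
  assumes "dev_affine A f" "homeomorphism \<H> \<H> f g" "A \<in> SL2Z"
  shows "dev_affine (mat_adj A) g"
proof -
  obtain b where b: "\<And>z. z \<in> \<H> \<Longrightarrow> D (f z) = mat_act A (D z) + b"
    using assms(1) unfolding dev_affine_def by blast
  have "D (g z) = mat_act (mat_adj A) (D z) + - mat_act (mat_adj A) b" if z: "z \<in> \<H>" for z
  proof -
    have "g z \<in> \<H>" "f (g z) = z" using assms(2) z by (auto simp: homeomorphism_def)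
    then have "D z = mat_act A (D (g z)) + b" using b[of "g z"] by simp
    then show ?thesis by (simp add: mat_act_add SL2Z_cancel[OF assms(3)])
  qed
  then show ?thesis unfolding dev_affine_def by blast
qed

text \<open>An affine map with linear part \<open>A\<close> conjugates the translation by
  \<open>hol k\<close> into that by \<open>A\<close> applied to \<open>hol k\<close>. This is again
  a lattice vector, so the conjugate still preserves \<open>P\<close>.\<close>

lemma dev_affine_conj:
  assumes "dev_affine A f" "homeomorphism \<H> \<H> f g" "A \<in> SL2Z" "k \<in> carrier Deck"
  shows "(\<lambda>z\<in>\<H>. f (k (g z))) \<in> carrier Deck" "hol (\<lambda>z\<in>\<H>. f (k (g z))) = mat_act A (hol k)"
proof -
  obtain b where b: "\<And>z. z \<in> \<H> \<Longrightarrow> D (f z) = mat_act A (D z) + b"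
    using assms(1) unfolding dev_affine_def by blast
  have D: "D (f (k (g z))) = D z + mat_act A (hol k)" if z: "z \<in> \<H>" for z
  proof -
    have gz: "g z \<in> \<H>" "f (g z) = z" using assms(2) z by (auto simp: homeomorphism_def)
    then have "k (g z) \<in> \<H>" using deck_group_image[OF assms(4)] by blast
    then have "D (f (k (g z))) = mat_act A (D (g z)) + b + mat_act A (hol k)"
      using b D_deck(2)[OF assms(4) gz(1)] by (simp add: mat_act_add)
    also have "mat_act A (D (g z)) + b = D z" using b[OF gz(1)] gz(2) by simp
    finally show ?thesis .
  qed
  obtain k' where k': "homeomorphism \<H> \<H> k k'" using assms(4) by (auto simp: mem_deck_group)
  have "homeomorphism \<H> \<H> (f \<circ> (k \<circ> g)) (f \<circ> k' \<circ> g)"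
    using homeomorphism_compose[OF homeomorphism_compose[OF homeomorphism_symD[OF assms(2)] k'] assms(2)] by simp
  then have "homeomorphism \<H> \<H> (\<lambda>z\<in>\<H>. f (k (g z))) (f \<circ> k' \<circ> g)"
    by (rule homeomorphism_cong) auto
  moreover have "P (f (k (g z))) = P z" if z: "z \<in> \<H>" for z
  proof -
    have "f w \<in> \<H>" "g w \<in> \<H>" if "w \<in> \<H>" for w
      using assms(2) that by (auto simp: homeomorphism_def)
    then have "f (k (g z)) \<in> \<H>" using deck_group_image[OF assms(4)] z by blast
    then have "P (f (k (g z))) = to_torus (D (f (k (g z))))" by (simp add: to_torus_D)
    also have "\<dots> = to_torus (D z)"
      using mat_act_lattice[OF assms(3) D_deck(1)[OF assms(4)]] by (simp add: D[OF z] to_torus_eq_iff)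
    finally show ?thesis by (simp add: to_torus_D z)
  qed
  ultimately show *: "(\<lambda>z\<in>\<H>. f (k (g z))) \<in> carrier Deck" by (auto simp: mem_deck_group)
  show "hol (\<lambda>z\<in>\<H>. f (k (g z))) = mat_act A (hol k)"
    by (rule hol_eqI[OF * UHP(4)]) (simp add: UHP(4) D)
qed

lemma dev_affine_conj_iso:
  assumes f: "dev_affine A f" "homeomorphism \<H> \<H> f g" "A \<in> SL2Z"
  shows "(\<lambda>k. \<lambda>z\<in>\<H>. f (k (g z))) \<in> iso Deck Deck"
proof -
  let ?c = "\<lambda>k. \<lambda>z\<in>\<H>. f (k (g z))" and ?c' = "\<lambda>k. \<lambda>z\<in>\<H>. g (k (f z))"
  note c = dev_affine_conj(1)[OF f]
  have f': "dev_affine (mat_adj A) g" "homeomorphism \<H> \<H> g f" "mat_adj A \<in> SL2Z"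
    using dev_affine_inverse[OF f] f(2,3) homeomorphism_symD mat_adj_SL2Z by blast+
  note c' = dev_affine_conj(1)[OF f']
  have fg: "f z \<in> \<H>" "g z \<in> \<H>" "f (g z) = z" "g (f z) = z" if "z \<in> \<H>" for z
    using f(2) that by (auto simp: homeomorphism_def)
  have inv: "?c' (?c k) = k" "?c (?c' k) = k" if "k \<in> carrier Deck" for k
    by (rule extensionalityI[OF _ deck_homeo(4)[OF that]];
        simp add: fg deck_group_image[OF that])+
  have "bij_betw ?c (carrier Deck) (carrier Deck)"
    by (rule bij_betw_byWitness[of _ ?c']) (use inv c c' in auto)
  moreover have "?c \<in> hom Deck Deck"
  proof (rule homI)
    fix k l assume kl: "k \<in> carrier Deck" "l \<in> carrier Deck"
    have "?c (compose \<H> k l) = compose \<H> (?c k) (?c l)"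
      by (rule extensionalityI[of _ \<H>])
        (simp_all add: compose_eq fg deck_group_image[OF kl(1)] deck_group_image[OF kl(2)])
    then show "?c (k \<otimes>\<^bsub>Deck\<^esub> l) = ?c k \<otimes>\<^bsub>Deck\<^esub> ?c l"
      using kl c by (simp add: deck_group_mult)
  qed (rule c)
  ultimately show ?thesis by (simp add: iso_def)
qed

text \<open>An integral matrix of determinant 1 induces a map of the punctured torus. The matrix and
  its adjugate are lifted with matching base points; their composites cover the identity because the
  translation parts are lattice vectors.\<close>

lemma dev_affine_exists:
  assumes "A \<in> SL2Z"
  obtains f g where "homeomorphism \<H> \<H> f g" "dev_affine A f"
proof -
  have lift: "\<exists>f. continuous_on \<H> f \<and> f ` \<H> \<subseteq> \<H> \<and> f z = a \<and> (\<forall>y\<in>\<H>. P (f y) = to_torus (mat_act B (D y)))"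
    if B: "B \<in> SL2Z" and z: "z \<in> \<H>" and a: "a \<in> \<H>" "P a = to_torus (mat_act B (D z))" for B z a
  proof -
    have "continuous_on \<H> (to_torus \<circ> (\<lambda>y. mat_act B (D y)))"
      by (intro continuous_on_compose continuous_on_mat_act cont_D continuous_on_subset[OF continuous_to_torus]) simp
    then have 1: "continuous_on \<H> (\<lambda>y. to_torus (mat_act B (D y)))" by (simp add: o_def)
    have "to_torus (mat_act B (D y)) \<in> E_star" if "y \<in> \<H>" for y
      using D_not_lattice[OF that] mat_act_lattice_iff[OF B] to_torus_eq_iff[of _ 0]
      by (auto simp: E_star_def)
    then have 2: "(\<lambda>y. to_torus (mat_act B (D y))) ` \<H> \<subseteq> E_star" by blast
    show ?thesis using P_lift[OF 1 2 z a] by metis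
  qed
  have affine: "\<exists>b\<in>Z2_lattice. \<forall>y\<in>\<H>. D (f y) = mat_act B (D y) + b"
    if f: "continuous_on \<H> f" "f ` \<H> \<subseteq> \<H>" "\<And>y. y \<in> \<H> \<Longrightarrow> P (f y) = to_torus (mat_act B (D y))" for f B
  proof -
    have "\<exists>b\<in>Z2_lattice. \<forall>y\<in>\<H>. (D \<circ> f) y = mat_act B (D y) + b"
    proof (rule to_torus_eq_on_connected[OF UHP(2) continuous_on_D_comp[OF f(1,2)] continuous_on_mat_act[OF cont_D]])
      fix y assume y: "y \<in> \<H>"
      then have "f y \<in> \<H>" using f(2) by blast
      then show "to_torus ((D \<circ> f) y) = to_torus (mat_act B (D y))" using f(3)[OF y] by (simp add: to_torus_D)
    qed
    then show ?thesis by simp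
  qed
  note A' = mat_adj_SL2Z[OF assms]
  \<comment> \<open>The image of \<open>D\<close> is the complement of the lattice, which
    \<open>A\<close> preserves; this supplies the base point \<open>a\<close> for the lift.\<close>
  have "mat_act A (D \<i>) \<in> D ` \<H>"
    using D_not_lattice[OF UHP(4)] mat_act_lattice_iff[OF assms] by (simp add: D_image)
  then obtain a where a: "a \<in> \<H>" "D a = mat_act A (D \<i>)" by (metis imageE)
  have Pa: "P a = to_torus (mat_act A (D \<i>))" "P \<i> = to_torus (mat_act (mat_adj A) (D a))"
    using a UHP(4) by (simp_all add: SL2Z_cancel[OF assms] flip: to_torus_D)
  obtain f where f: "continuous_on \<H> f" "f ` \<H> \<subseteq> \<H>" "f \<i> = a"
    "\<And>y. y \<in> \<H> \<Longrightarrow> P (f y) = to_torus (mat_act A (D y))"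
    using lift[OF assms UHP(4) a(1) Pa(1)] by blast
  obtain g where g: "continuous_on \<H> g" "g ` \<H> \<subseteq> \<H>" "g a = \<i>"
    "\<And>y. y \<in> \<H> \<Longrightarrow> P (g y) = to_torus (mat_act (mat_adj A) (D y))"
    using lift[OF A' a(1) UHP(4) Pa(2)] by blast
  obtain b where b: "b \<in> Z2_lattice" "\<And>y. y \<in> \<H> \<Longrightarrow> D (f y) = mat_act A (D y) + b"
    using affine[OF f(1,2,4)] by blast
  obtain c where c: "c \<in> Z2_lattice" "\<And>y. y \<in> \<H> \<Longrightarrow> D (g y) = mat_act (mat_adj A) (D y) + c"
    using affine[OF g(1,2,4)] by blast
  have "homeomorphism \<H> \<H> f g"
  proof (rule homeomorphism_lift[OF f(1,2) g(1,2) _ _ UHP(4)])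
    fix z assume z: "z \<in> \<H>"
    then have fg: "f z \<in> \<H>" "g z \<in> \<H>" using f(2) g(2) by auto
    have "P (g (f z)) = to_torus (D z + mat_act (mat_adj A) b)"
      using g(4)[OF fg(1)] b(2)[OF z] by (simp add: mat_act_add SL2Z_cancel[OF assms])
    also have "\<dots> = to_torus (D z)" using mat_act_lattice[OF A' b(1)] by (simp add: to_torus_eq_iff)
    finally show "P (g (f z)) = P z" by (simp add: to_torus_D z)
    have "P (f (g z)) = to_torus (D z + mat_act A c)"
      using f(4)[OF fg(2)] c(2)[OF z] by (simp add: mat_act_add SL2Z_cancel[OF assms])
    also have "\<dots> = to_torus (D z)" using mat_act_lattice[OF assms c(1)] by (simp add: to_torus_eq_iff)
    finally show "P (f (g z)) = P z" by (simp add: to_torus_D z)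
  qed (simp add: f(3) g(3))
  moreover have "dev_affine A f" using b(2) unfolding dev_affine_def by blast
  ultimately show thesis by (rule that)
qed

end

subsection \<open>Exponent sums and markings\<close>

definition exponent_vector :: "letter list \<Rightarrow> complex" where
  "exponent_vector w = Complex (of_int (exponent_sum GX w)) (of_int (exponent_sum GY w))"

lemma exponent_vector_mult: "exponent_vector (v \<cdot> w) = exponent_vector v + exponent_vector w"
  by (simp add: exponent_vector_def exponent_sum_mult complex_eq_iff)

lemma exponent_vector_letter:
  "exponent_vector [] = 0" "exponent_vector [(GX, True)] = 1" "exponent_vector [(GY, True)] = \<i>"
  "exponent_vector [(g, False)] = - exponent_vector [(g, True)]"
  by (cases g; simp add: exponent_vector_def exponent_sum_def complex_eq_iff)+

text \<open>An additive function factors through the abelianization, in which the exponent sums are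
  the coordinates.\<close>

lemma additive_eq_exponent_vector:
  fixes h :: "letter list \<Rightarrow> complex"
  assumes add: "\<And>v w. v \<in> carrier F2 \<Longrightarrow> w \<in> carrier F2 \<Longrightarrow> h (v \<cdot> w) = h v + h w"
    and w: "w \<in> carrier F2"
  shows "h w = Re (exponent_vector w) *\<^sub>R h [(GX, True)] + Im (exponent_vector w) *\<^sub>R h [(GY, True)]"
  using w
proof (induction w rule: F2_induct)
  have h0: "h [] = 0" using add[of "[]" "[]"] by simp
  case one
  show ?case by (simp add: h0 exponent_vector_letter)
next
  have h0: "h [] = 0" using add[of "[]" "[]"] by simp
  case (mult a w)
  obtain g s where a: "a = (g, s)" by fastforce
  have "[(g, True)] \<cdot> [(g, False)] = []" by (simp add: mult_F2 red_cons_def inv_letter_def)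
  then have "h [(g, True)] + h [(g, False)] = 0" using add[of "[(g, True)]" "[(g, False)]"] h0 by simp
  then have "h [(g, False)] = - h [(g, True)]" by (simp add: add_eq_0_iff)
  then have "h [a] = Re (exponent_vector [a]) *\<^sub>R h [(GX, True)] + Im (exponent_vector [a]) *\<^sub>R h [(GY, True)]"
    by (cases g; cases s) (simp_all add: a exponent_vector_letter)
  then show ?case
    using mult add[of "[a]" w] by (simp add: exponent_vector_mult algebra_simps)
qed

lemma hat_beta_nth:
  "hat_beta \<phi> $ 1 $ 1 = exponent_sum GX (\<phi> [(GX, True)])"
  "hat_beta \<phi> $ 1 $ 2 = exponent_sum GX (\<phi> [(GY, True)])"
  "hat_beta \<phi> $ 2 $ 1 = exponent_sum GY (\<phi> [(GX, True)])"
  "hat_beta \<phi> $ 2 $ 2 = exponent_sum GY (\<phi> [(GY, True)])"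
  by (simp_all add: hat_beta_def Let_def)

lemma hat_beta_eqI:
  assumes "exponent_vector (\<phi> [(GX, True)]) = mat_act A 1" "exponent_vector (\<phi> [(GY, True)]) = mat_act A \<i>"
  shows "hat_beta \<phi> = A"
  using assms by (simp add: vec_eq_iff forall_2 hat_beta_nth exponent_vector_def mat_act_def)

text \<open>\<open>hat_beta \<phi>\<close> is the matrix of the map that \<phi> induces on the
  abelianization.\<close>

lemma exponent_vector_hom:
  assumes "\<phi> \<in> hom F2 F2" "w \<in> carrier F2"
  shows "exponent_vector (\<phi> w) = mat_act (hat_beta \<phi>) (exponent_vector w)"
proof -
  have "exponent_vector (\<phi> w) = Re (exponent_vector w) *\<^sub>R exponent_vector (\<phi> [(GX, True)]) +
      Im (exponent_vector w) *\<^sub>R exponent_vector (\<phi> [(GY, True)])"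
    by (rule additive_eq_exponent_vector[OF _ assms(2)])
      (simp add: hom_mult[OF assms(1)] exponent_vector_mult)
  then show ?thesis
    by (simp add: complex_eq_iff mat_act_def hat_beta_nth exponent_vector_def mult.commute)
qed

lemma hat_beta_SL2Z: "\<phi> \<in> Aut_plus_F2 \<Longrightarrow> hat_beta \<phi> \<in> SL2Z"
  by (simp add: Aut_plus_F2_def SL2Z_def forall_2 hat_beta_nth)

lemma restrict_iso:
  assumes "group G" "h \<in> iso G K"
  shows "restrict h (carrier G) \<in> iso G K"
proof -
  have "bij_betw (restrict h (carrier G)) (carrier G) (carrier K)"
    using assms(2) bij_betw_cong[of "carrier G" "restrict h (carrier G)" h] by (simp add: iso_def)
  moreover have "restrict h (carrier G) \<in> hom G K"
    using assms by (auto simp: iso_def hom_def group.is_monoid monoid.m_closed)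
  ultimately show ?thesis by (simp add: iso_def)
qed

text \<open>The marking enters through its periods 1 and \<i> on the generators, which determine
  \<open>hol\<close> on the whole deck group.\<close>

locale marked_cover = developed_cover +
  fixes \<Phi> :: "letter list \<Rightarrow> complex \<Rightarrow> complex"
  assumes \<Phi>: "\<Phi> \<in> iso F2 Deck"
    and hol_x: "hol (\<Phi> [(GX, True)]) = 1"
    and hol_y: "hol (\<Phi> [(GY, True)]) = \<i>"
begin

lemma \<Phi>_deck: "w \<in> carrier F2 \<Longrightarrow> \<Phi> w \<in> carrier Deck"
  using \<Phi> by (auto simp: iso_iff)

lemma \<Phi>_surj: "g \<in> carrier Deck \<Longrightarrow> \<exists>w\<in>carrier F2. \<Phi> w = g"
  using \<Phi> by (metis iso_iff imageE)

lemma \<Phi>_image: "w \<in> carrier F2 \<Longrightarrow> z \<in> \<H> \<Longrightarrow> \<Phi> w z \<in> \<H>"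
  using \<Phi>_deck deck_group_image by blast

lemma \<Phi>_compose:
  "v \<in> carrier F2 \<Longrightarrow> w \<in> carrier F2 \<Longrightarrow> \<Phi> (v \<cdot> w) = compose \<H> (\<Phi> v) (\<Phi> w)"
  using hom_mult[of \<Phi> F2 Deck v w] \<Phi> by (simp add: iso_iff deck_group_mult \<Phi>_deck)

lemma \<Phi>_mult:
  "v \<in> carrier F2 \<Longrightarrow> w \<in> carrier F2 \<Longrightarrow> z \<in> \<H> \<Longrightarrow> \<Phi> (v \<cdot> w) z = \<Phi> v (\<Phi> w z)"
  by (simp add: \<Phi>_compose compose_eq)

lemma hol_\<Phi>:
  assumes "w \<in> carrier F2"
  shows "hol (\<Phi> w) = exponent_vector w"
proof -
  have "hol (\<Phi> w) = Re (exponent_vector w) *\<^sub>R hol (\<Phi> [(GX, True)]) +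
      Im (exponent_vector w) *\<^sub>R hol (\<Phi> [(GY, True)])"
    by (rule additive_eq_exponent_vector[OF _ assms]) (simp add: \<Phi>_compose hol_compose \<Phi>_deck)
  then show ?thesis by (simp add: hol_x hol_y complex_eq_iff)
qed

text \<open>The automorphism that \<open>f\<close> induces on the free group, with \<open>g\<close>
  in the role of the inverse of \<open>f\<close>. The restriction to the carrier makes it
  extensional, as \<open>auto\<close> demands.\<close>

definition conj_aut :: "(complex \<Rightarrow> complex) \<Rightarrow> (complex \<Rightarrow> complex) \<Rightarrow> letter list \<Rightarrow> letter list" where
  "conj_aut f g = (\<lambda>w\<in>carrier F2. inv_into (carrier F2) \<Phi> (\<lambda>z\<in>\<H>. f (\<Phi> w (g z))))"

context
  fixes A f g
  assumes A: "dev_affine A f" "homeomorphism \<H> \<H> f g" "A \<in> SL2Z"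
begin

lemma conj_aut_iso: "conj_aut f g \<in> iso F2 F2"
proof -
  have "inv_into (carrier F2) \<Phi> \<circ> ((\<lambda>k. \<lambda>z\<in>\<H>. f (k (g z))) \<circ> \<Phi>) \<in> iso F2 F2"
    by (intro iso_set_trans[of _ _ Deck] \<Phi> dev_affine_conj_iso[OF A] F2.iso_set_sym[OF \<Phi>])
  then have "restrict (inv_into (carrier F2) \<Phi> \<circ> ((\<lambda>k. \<lambda>z\<in>\<H>. f (k (g z))) \<circ> \<Phi>)) (carrier F2) \<in> iso F2 F2"
    by (rule restrict_iso[OF group_F2])
  then show ?thesis by (simp add: conj_aut_def comp_def)
qed

lemma conj_aut_carrier: "w \<in> carrier F2 \<Longrightarrow> conj_aut f g w \<in> carrier F2"
  using conj_aut_iso by (auto simp: iso_iff)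

lemma \<Phi>_conj_aut: "w \<in> carrier F2 \<Longrightarrow> \<Phi> (conj_aut f g w) = (\<lambda>z\<in>\<H>. f (\<Phi> w (g z)))"
  using dev_affine_conj(1)[OF A \<Phi>_deck[of w]] \<Phi> by (simp add: conj_aut_def f_inv_into_f iso_iff)

lemma conj_aut_auto: "conj_aut f g \<in> auto F2"
  using conj_aut_iso by (auto simp: auto_def Bij_def iso_def conj_aut_def)

lemma exponent_vector_conj_aut:
  assumes "w \<in> carrier F2"
  shows "exponent_vector (conj_aut f g w) = mat_act A (exponent_vector w)"
proof -
  have "exponent_vector (conj_aut f g w) = hol (\<Phi> (conj_aut f g w))"
    by (simp add: hol_\<Phi> conj_aut_carrier assms)
  also have "\<dots> = mat_act A (exponent_vector w)"
    using dev_affine_conj(2)[OF A \<Phi>_deck[OF assms]] by (simp add: \<Phi>_conj_aut assms hol_\<Phi>)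
  finally show ?thesis .
qed

lemma hat_beta_conj_aut: "hat_beta (conj_aut f g) = A"
  by (rule hat_beta_eqI) (simp_all add: exponent_vector_conj_aut exponent_vector_letter)

end

text \<open>
  By Nielsen's theorem the affine lift of the linear map \<open>hat_beta \<gamma>\<close> induces \<open>\<gamma>\<close> up to an inner
  automorphism, which is corrected by a deck transformation.
\<close>

lemma automorphism_realization:
  assumes "\<gamma> \<in> Aut_plus_F2"
  obtains f g where "homeomorphism \<H> \<H> f g" "dev_affine (hat_beta \<gamma>) f"
    "\<And>w z. w \<in> carrier F2 \<Longrightarrow> z \<in> \<H> \<Longrightarrow> f (\<Phi> w z) = \<Phi> (\<gamma> w) (f z)"
proof -
  define A where "A = hat_beta \<gamma>"
  have A: "A \<in> SL2Z" unfolding A_def by (rule hat_beta_SL2Z[OF assms])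
  have \<gamma>: "\<gamma> \<in> hom F2 F2" "\<gamma> ` carrier F2 = carrier F2"
    using assms by (auto simp: Aut_plus_F2_def auto_def Bij_def bij_betw_def)
  obtain f0 g0 where fg: "homeomorphism \<H> \<H> f0 g0" "dev_affine A f0"
    using dev_affine_exists[OF A] by blast
  have gf: "dev_affine (mat_adj A) g0" "homeomorphism \<H> \<H> g0 f0" "mat_adj A \<in> SL2Z"
    using dev_affine_inverse[OF fg(2,1) A] fg(1) homeomorphism_symD mat_adj_SL2Z[OF A] by blast+
  have in\<H>: "f0 z \<in> \<H>" "g0 z \<in> \<H>" "f0 (g0 z) = z" "g0 (f0 z) = z" if "z \<in> \<H>" for z
    using fg(1) that by (auto simp: homeomorphism_def)
  \<comment> \<open>\<gamma> followed by the inverse of the automorphism induced by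
    \<open>f0\<close>; the two matrices cancel, so exponent sums are fixed.\<close>
  define \<phi> where "\<phi> = conj_aut g0 f0 \<circ> \<gamma>"
  have c: "conj_aut g0 f0 \<in> hom F2 F2" "conj_aut g0 f0 ` carrier F2 = carrier F2"
    using conj_aut_iso[OF gf] by (auto simp: iso_iff)
  have "\<phi> \<in> hom F2 F2" unfolding \<phi>_def by (rule hom_compose[OF \<gamma>(1) c(1)])
  moreover have "\<phi> ` carrier F2 = carrier F2"
    unfolding \<phi>_def using \<gamma>(2) c(2) by (metis image_comp)
  moreover have "exponent_sum a (\<phi> w) = exponent_sum a w" if w: "w \<in> carrier F2" for a w
  proof -
    have "exponent_vector (\<phi> w) = mat_act (mat_adj A) (mat_act A (exponent_vector w))"
      using exponent_vector_conj_aut[OF gf, of "\<gamma> w"] exponent_vector_hom[OF \<gamma>(1) w] \<gamma>(2) w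
      by (auto simp: \<phi>_def A_def)
    then have "exponent_vector (\<phi> w) = exponent_vector w" by (simp add: SL2Z_cancel[OF A])
    then show ?thesis by (cases a) (simp_all add: exponent_vector_def)
  qed
  ultimately have "\<exists>h\<in>carrier F2. \<forall>w\<in>carrier F2. \<phi> w = h \<cdot> w \<cdot> h\<^sup>-"
    by (rule trivial_on_abelianization_imp_inner)
  then obtain h where h: "h \<in> carrier F2" "\<And>w. w \<in> carrier F2 \<Longrightarrow> \<phi> w = h \<cdot> w \<cdot> h\<^sup>-" by blast
  obtain h' where h': "homeomorphism \<H> \<H> (\<Phi> h) h'"
    using \<Phi>_deck[OF h(1)] by (auto simp: mem_deck_group)
  \<comment> \<open>Undoing \<open>f0\<close> takes \<open>\<gamma> w\<close> to
    \<open>h \<cdot> w \<cdot> h\<^sup>-\<close>; precomposing with \<open>\<Phi> h\<close> absorbs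
    this inner automorphism.\<close>
  define f where "f = f0 \<circ> \<Phi> h"
  have "homeomorphism \<H> \<H> f (h' \<circ> g0)"
    unfolding f_def by (rule homeomorphism_compose[OF h' fg(1)])
  moreover have "dev_affine A f"
  proof -
    obtain b where b: "\<And>z. z \<in> \<H> \<Longrightarrow> D (f0 z) = mat_act A (D z) + b"
      using fg(2) unfolding dev_affine_def by blast
    have "D (f z) = mat_act A (D z) + (mat_act A (hol (\<Phi> h)) + b)" if "z \<in> \<H>" for z
      using that h(1) b[of "\<Phi> h z"] D_deck(2)[OF \<Phi>_deck[OF h(1)] that]
      by (simp add: f_def \<Phi>_image mat_act_add)
    then show ?thesis unfolding dev_affine_def by blast
  qed
  moreover have "f (\<Phi> w z) = \<Phi> (\<gamma> w) (f z)" if w: "w \<in> carrier F2" and z: "z \<in> \<H>" for w z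
  proof -
    have \<gamma>w: "\<gamma> w \<in> carrier F2" using \<gamma>(2) w by blast
    have hz: "\<Phi> h z \<in> \<H>" using h(1) z by (rule \<Phi>_image)
    have "g0 (\<Phi> (\<gamma> w) (f z)) = \<Phi> (\<phi> w) (\<Phi> h z)"
      using \<Phi>_conj_aut[OF gf \<gamma>w] by (simp add: \<phi>_def f_def hz)
    also have "\<dots> = \<Phi> (h \<cdot> w \<cdot> h\<^sup>- \<cdot> h) z" using h w z by (simp add: \<Phi>_mult)
    also have "h \<cdot> w \<cdot> h\<^sup>- \<cdot> h = h \<cdot> w" using h(1) w by (simp add: F2.m_assoc)
    finally have "f0 (g0 (\<Phi> (\<gamma> w) (f z))) = f0 (\<Phi> h (\<Phi> w z))"
      using h(1) w z by (simp add: \<Phi>_mult)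
    moreover have "\<Phi> (\<gamma> w) (f z) \<in> \<H>"
      using \<gamma>w hz in\<H>(1) by (simp add: f_def \<Phi>_image)
    ultimately show ?thesis by (simp add: in\<H>(3) f_def)
  qed
  ultimately show thesis using that unfolding A_def by blast
qed

end

subsection \<open>Affine homeomorphisms of an origami\<close>

locale origami_cover = marked_cover "p \<circ> u" D \<Phi>
  for p :: "'a::topological_space \<Rightarrow> torus" and u D \<Phi> +
  fixes X :: "'a set"
  assumes cov_p: "covering_space X p E_star"
    and cov_u: "covering_space \<H> u X"
begin

abbreviation Atlas where "Atlas \<equiv> origami_atlas X p"

lemma cont_u: "continuous_on \<H> u"
  by (rule covering_space_imp_continuous[OF cov_u])

lemma u_image: "u ` \<H> = X"
  by (rule covering_space_imp_surjective[OF cov_u])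

lemma u_in: "z \<in> \<H> \<Longrightarrow> u z \<in> X"
  using u_image by blast

lemma cont_p: "continuous_on X p"
  by (rule covering_space_imp_continuous[OF cov_p])

lemma ex_chart: "x \<in> X \<Longrightarrow> \<exists>c\<in>Atlas. x \<in> fst c"
proof -
  assume "x \<in> X"
  then have "x \<in> (\<Union>(U, \<phi>)\<in>Atlas. U)"
    using translation_atlas_origami[OF cov_p] unfolding translation_atlas_def by simp
  then show ?thesis by force
qed

lemma chart_subset: "c \<in> Atlas \<Longrightarrow> fst c \<subseteq> X"
  unfolding lift_atlas_def using openin_imp_subset by fastforce

lemma openin_UHP: "open N \<Longrightarrow> N \<subseteq> \<H> \<Longrightarrow> openin (top_of_set \<H>) N"
  by (rule open_subset)

lemma open_preimage: "continuous_on \<H> g \<Longrightarrow> open N \<Longrightarrow> open (\<H> \<inter> g -` N)"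
  by (rule continuous_open_preimage[OF _ UHP(3)])

lemma open_u_preimage: "openin (top_of_set X) W \<Longrightarrow> open (\<H> \<inter> u -` W)"
  using continuous_openin_preimage[OF cont_u, of X W] u_in openin_open_eq[OF UHP(3)] by (metis Pi_I)

text \<open>Seen from the half plane, every chart of the origami is locally the developing map up to
  a translation.\<close>

lemma chart_lift:
  assumes c: "c \<in> Atlas" and z: "z \<in> \<H>" "u z \<in> fst c"
  shows "\<exists>N b. open N \<and> z \<in> N \<and> N \<subseteq> \<H> \<and> u ` N \<subseteq> fst c \<and> (\<forall>n\<in>N. snd c (u n) = D n + b)"
proof -
  obtain U V s where V: "c = (U, s \<circ> p)" "(V, s) \<in> E_star_atlas" "openin (top_of_set X) U" "p ` U \<subseteq> V"
    using c unfolding lift_atlas_def by blast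
  have "(p \<circ> u) z \<in> V" using V z by auto
  from chart_developing[OF V(2) z(1) this]
  obtain N b where N: "open N" "z \<in> N" "N \<subseteq> \<H>" "\<forall>n\<in>N. s ((p \<circ> u) n) = D n + b" by blast
  show ?thesis
    using N z V(1) open_u_preimage[OF V(3)]
    by (intro exI[of _ "N \<inter> (\<H> \<inter> u -` U)"] exI[of _ b]) auto
qed

definition locally_affine :: "(complex \<Rightarrow> complex) \<Rightarrow> complex \<Rightarrow> real^2^2 \<Rightarrow> bool" where
  "locally_affine f z A \<longleftrightarrow>
     (\<exists>N b. open N \<and> z \<in> N \<and> N \<subseteq> \<H> \<and> (\<forall>n\<in>N. D (f n) = mat_act A (D n) + b))"

text \<open>As \<open>D\<close> is open, the two affine maps of the plane agree on a nonempty open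
  set.\<close>

lemma locally_affine_unique:
  assumes "locally_affine f z A" "locally_affine f z B"
  shows "A = B"
proof -
  obtain N b M c where NM: "open N" "z \<in> N" "N \<subseteq> \<H>" "\<forall>n\<in>N. D (f n) = mat_act A (D n) + b"
    "open M" "z \<in> M" "\<forall>n\<in>M. D (f n) = mat_act B (D n) + c"
    using assms unfolding locally_affine_def by blast
  show ?thesis
  proof (rule mat_act_eq_imp_eq[of "D ` (N \<inter> M)" A b B c])
    show "open (D ` (N \<inter> M))" using NM by (intro open_D_image) auto
    show "mat_act A v + b = mat_act B v + c" if v: "v \<in> D ` (N \<inter> M)" for v
    proof -
      obtain n where "n \<in> N" "n \<in> M" "v = D n" using v by blast
      then show ?thesis using NM(4,7) by metis
    qed
  qed (use NM in auto)
qed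

context
  fixes f f'
  assumes f': "continuous_on \<H> f'" "f' ` \<H> \<subseteq> \<H>" "\<And>z. z \<in> \<H> \<Longrightarrow> u (f' z) = f (u z)"
begin

text \<open>Passing from the charts at source and target to \<open>D\<close> changes only the
  translation part.\<close>

lemma affine_near_imp_locally_affine:
  assumes c: "c \<in> Atlas" "c' \<in> Atlas" and z: "z \<in> \<H>" "u z \<in> fst c" "f (u z) \<in> fst c'"
    and A: "affine_near X c c' f (u z) A"
  shows "locally_affine f' z A"
proof -
  have f'z: "f' z \<in> \<H>" "u (f' z) \<in> fst c'" using f' z by auto
  obtain N1 b1 where N1: "open N1" "z \<in> N1" "N1 \<subseteq> \<H>" "\<forall>n\<in>N1. snd c (u n) = D n + b1"
    using chart_lift[OF c(1) z(1,2)] by blast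
  obtain N2 b2 where N2: "open N2" "f' z \<in> N2" "N2 \<subseteq> \<H>" "\<forall>n\<in>N2. snd c' (u n) = D n + b2"
    using chart_lift[OF c(2) f'z] by blast
  obtain b W where W: "openin (top_of_set X) W" "u z \<in> W"
    "\<forall>y\<in>W. real2_of_complex (snd c' (f y)) = A *v real2_of_complex (snd c y) + b"
    using A unfolding affine_near_def by blast
  define b' where "b' = Complex (b $ 1) (b $ 2)"
  have W': "snd c' (f y) = mat_act A (snd c y) + b'" if "y \<in> W" for y
    using W(3) that by (simp add: affine_eq_iff b'_def)
  let ?N = "N1 \<inter> (\<H> \<inter> f' -` N2) \<inter> (\<H> \<inter> u -` W)"
  have "open ?N" using N1(1) N2(1) W(1) f'(1) by (intro open_Int open_preimage open_u_preimage)
  moreover have "D (f' n) = mat_act A (D n) + (mat_act A b1 + b' - b2)" if n: "n \<in> ?N" for n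
  proof -
    have "D (f' n) + b2 = snd c' (u (f' n))" using N2(4) n by simp
    also have "\<dots> = mat_act A (D n + b1) + b'" using W'[of "u n"] f'(3)[of n] N1(4) n by simp
    finally show ?thesis by (simp add: mat_act_add algebra_simps eq_diff_eq)
  qed
  ultimately show ?thesis
    unfolding locally_affine_def using N1 N2 W(2) z(1)
    by (intro exI[of _ ?N] exI[of _ "mat_act A b1 + b' - b2"]) auto
qed

text \<open>The converse passage from \<open>D\<close> to charts; the neighbourhood on the origami
  is an image under the open map \<open>u\<close>.\<close>

lemma dev_affine_imp_affine_near:
  assumes c: "c \<in> Atlas" "c' \<in> Atlas" and z: "z \<in> \<H>" "u z \<in> fst c" "f (u z) \<in> fst c'"
    and A: "dev_affine A f'"
  shows "affine_near X c c' f (u z) A"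
proof -
  have f'z: "f' z \<in> \<H>" "u (f' z) \<in> fst c'" using f' z by auto
  obtain N1 b1 where N1: "open N1" "z \<in> N1" "N1 \<subseteq> \<H>" "u ` N1 \<subseteq> fst c" "\<forall>n\<in>N1. snd c (u n) = D n + b1"
    using chart_lift[OF c(1) z(1,2)] by blast
  obtain N2 b2 where N2: "open N2" "f' z \<in> N2" "N2 \<subseteq> \<H>" "u ` N2 \<subseteq> fst c'" "\<forall>n\<in>N2. snd c' (u n) = D n + b2"
    using chart_lift[OF c(2) f'z] by blast
  obtain b where b: "\<And>z. z \<in> \<H> \<Longrightarrow> D (f' z) = mat_act A (D z) + b"
    using A unfolding dev_affine_def by blast
  let ?N = "N1 \<inter> (\<H> \<inter> f' -` N2)"
  have "open ?N" using N1(1) N2(1) f'(1) by (intro open_Int open_preimage)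
  then have "openin (top_of_set \<H>) ?N" by (rule openin_UHP) blast
  then have "openin (top_of_set X) (u ` ?N)" by (rule covering_space_openin_image[OF cov_u])
  moreover have "real2_of_complex (snd c' (f y)) = A *v real2_of_complex (snd c y) +
      real2_of_complex (b + b2 - mat_act A b1)" if "y \<in> u ` ?N" for y
  proof -
    obtain n where n: "n \<in> N1" "n \<in> \<H>" "f' n \<in> N2" "y = u n" using \<open>y \<in> u ` ?N\<close> by blast
    have "f (u n) = u (f' n)" using f'(3)[OF n(2)] by simp
    then have "snd c' (f y) = D (f' n) + b2" using N2(5) n by simp
    also have "\<dots> = mat_act A (snd c y) + (b + b2 - mat_act A b1)"
      using b[OF n(2)] N1(5) n by (simp add: mat_act_add)
    finally show ?thesis by (simp add: affine_eq_iff complex_eq_iff)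
  qed
  moreover have "f y \<in> fst c'" if "y \<in> u ` ?N" for y
    using that N2(4) f'(3) by force
  ultimately show ?thesis
    unfolding affine_near_def using N1 N2 z
    by (intro exI[of _ "real2_of_complex (b + b2 - mat_act A b1)"] exI[of _ "u ` ?N"]) auto
qed

text \<open>A single pair of charts, around \<open>u \<i>\<close> and its image, already determines
  the linear part.\<close>

lemma der_eq:
  assumes A: "dev_affine A f'"
  shows "der X Atlas f = A"
  unfolding der_def
proof (rule the_equality)
  show "\<forall>c\<in>Atlas. \<forall>c'\<in>Atlas. \<forall>y\<in>fst c. f y \<in> fst c' \<longrightarrow> affine_near X c c' f y A"
  proof (intro ballI impI)
    fix c c' y assume *: "c \<in> Atlas" "c' \<in> Atlas" "y \<in> fst c" "f y \<in> fst c'"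
    then have "y \<in> u ` \<H>" using chart_subset u_image by blast
    then obtain z where "z \<in> \<H>" "y = u z" by blast
    then show "affine_near X c c' f y A" using dev_affine_imp_affine_near * A by blast
  qed
  fix B assume B: "\<forall>c\<in>Atlas. \<forall>c'\<in>Atlas. \<forall>y\<in>fst c. f y \<in> fst c' \<longrightarrow> affine_near X c c' f y B"
  have "f' \<i> \<in> \<H>" using f'(2) UHP(4) by blast
  then have "f (u \<i>) \<in> X" using f'(3)[OF UHP(4)] u_in by metis
  then obtain c c' where "c \<in> Atlas" "u \<i> \<in> fst c" "c' \<in> Atlas" "f (u \<i>) \<in> fst c'"
    using ex_chart u_in[OF UHP(4)] by meson
  then have "locally_affine f' \<i> B" using affine_near_imp_locally_affine B UHP(4) by blast
  moreover have "locally_affine f' \<i> A"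
    using A UHP unfolding locally_affine_def dev_affine_def by blast
  ultimately show "B = A" by (rule locally_affine_unique)
qed

text \<open>First the linear part and then the translation part is locally constant, and the half
  plane is connected.\<close>

lemma locally_affine_imp_dev_affine:
  assumes "\<And>z. z \<in> \<H> \<Longrightarrow> \<exists>A. det A > 0 \<and> locally_affine f' z A"
  shows "\<exists>A. det A > 0 \<and> dev_affine A f'"
proof -
  obtain L where L: "\<And>z. z \<in> \<H> \<Longrightarrow> det (L z) > 0 \<and> locally_affine f' z (L z)"
    using assms by metis
  have "L constant_on \<H>"
  proof (rule locally_constant_imp_constant[OF UHP(2)])
    fix z assume z: "z \<in> \<H>"
    then obtain N b where N: "open N" "z \<in> N" "N \<subseteq> \<H>" "\<forall>n\<in>N. D (f' n) = mat_act (L z) (D n) + b"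
      using L unfolding locally_affine_def by blast
    have "L x = L z" if "x \<in> N" for x
    proof (rule locally_affine_unique)
      show "locally_affine f' x (L x)" using L N(3) that by blast
      show "locally_affine f' x (L z)" unfolding locally_affine_def using N that by blast
    qed
    then show "\<exists>T. openin (top_of_set \<H>) T \<and> z \<in> T \<and> (\<forall>x\<in>T. L x = L z)"
      using N openin_UHP[OF N(1,3)] by blast
  qed
  then obtain A where A: "\<And>z. z \<in> \<H> \<Longrightarrow> L z = A" unfolding constant_on_def by blast
  have "(\<lambda>z. D (f' z) - mat_act A (D z)) constant_on \<H>"
  proof (rule locally_constant_imp_constant[OF UHP(2)])
    fix z assume z: "z \<in> \<H>"
    then obtain N b where N: "open N" "z \<in> N" "N \<subseteq> \<H>" "\<forall>n\<in>N. D (f' n) = mat_act A (D n) + b"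
      using L A unfolding locally_affine_def by metis
    then have "\<forall>x\<in>N. D (f' x) - mat_act A (D x) = D (f' z) - mat_act A (D z)" by simp
    then show "\<exists>T. openin (top_of_set \<H>) T \<and> z \<in> T \<and>
        (\<forall>x\<in>T. D (f' x) - mat_act A (D x) = D (f' z) - mat_act A (D z))"
      using N openin_UHP[OF N(1,3)] by blast
  qed
  then obtain b where "\<And>z. z \<in> \<H> \<Longrightarrow> D (f' z) - mat_act A (D z) = b" unfolding constant_on_def by blast
  then have "dev_affine A f'" unfolding dev_affine_def by (metis add.commute diff_add_cancel)
  moreover have "det A > 0" using L[OF UHP(4)] A[OF UHP(4)] by simp
  ultimately show ?thesis by blast
qed

end

section \<open>Lifting maps to the half plane and descending to the origami\<close>

lemma u_lift_eq:
  assumes "continuous_on \<H> g" "g ` \<H> \<subseteq> X" "continuous_on \<H> h" "h ` \<H> \<subseteq> X"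
    and "\<And>z. z \<in> \<H> \<Longrightarrow> p (g z) = p (h z)" "a \<in> \<H>" "g a = h a" "z \<in> \<H>"
  shows "g z = h z"
  by (rule covering_space_lift_eq[OF cov_p UHP(2), of g h a]) (use assms in auto)

text \<open>The map \<open>p \<circ> f \<circ> u\<close> is lifted through
  \<open>p \<circ> u\<close>. Uniqueness of lifts along \<open>p\<close> then shows that the lift
  covers \<open>f\<close>, and not merely \<open>p \<circ> f\<close>.\<close>

lemma map_lift:
  assumes f: "continuous_on X f" "f ` X \<subseteq> X" and z: "z \<in> \<H>" "a \<in> \<H>" "u a = f (u z)"
  shows "\<exists>f'. continuous_on \<H> f' \<and> f' ` \<H> \<subseteq> \<H> \<and> f' z = a \<and> (\<forall>y\<in>\<H>. u (f' y) = f (u y))"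
proof -
  have fu: "continuous_on \<H> (f \<circ> u)" "(f \<circ> u) ` \<H> \<subseteq> X"
  proof -
    show "continuous_on \<H> (f \<circ> u)" using f(1) by (intro continuous_on_compose cont_u) (simp add: u_image)
    show "(f \<circ> u) ` \<H> \<subseteq> X" using f(2) u_image by (metis image_comp)
  qed
  then have "continuous_on \<H> (p \<circ> (f \<circ> u))"
    by (rule continuous_on_compose[OF _ continuous_on_subset[OF cont_p]])
  moreover have "(p \<circ> (f \<circ> u)) ` \<H> \<subseteq> E_star"
    using fu(2) covering_space_imp_surjective[OF cov_p] by auto
  moreover have "(p \<circ> u) a = (p \<circ> (f \<circ> u)) z" using z by simp
  ultimately obtain f' where f': "continuous_on \<H> f'" "f' ` \<H> \<subseteq> \<H>" "f' z = a"
      "\<And>y. y \<in> \<H> \<Longrightarrow> (p \<circ> u) (f' y) = (p \<circ> (f \<circ> u)) y"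
    using P_lift[OF _ _ z(1,2)] by metis
  have "(u \<circ> f') y = (f \<circ> u) y" if y: "y \<in> \<H>" for y
  proof (rule u_lift_eq[OF _ _ fu _ z(1) _ y])
    show "continuous_on \<H> (u \<circ> f')" using f' by (intro continuous_on_compose continuous_on_subset[OF cont_u])
    show "(u \<circ> f') ` \<H> \<subseteq> X" using f'(2) u_in by auto
  qed (use f' z in auto)
  then show ?thesis using f' by auto
qed

lemma homeomorphism_X_lift:
  assumes "homeomorphism X X f k"
  shows "\<exists>f' k'. homeomorphism \<H> \<H> f' k' \<and> (\<forall>z\<in>\<H>. u (f' z) = f (u z)) \<and> (\<forall>z\<in>\<H>. u (k' z) = k (u z))"
proof -
  have f: "continuous_on X f" "f ` X \<subseteq> X" "continuous_on X k" "k ` X \<subseteq> X"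
    "\<And>x. x \<in> X \<Longrightarrow> k (f x) = x" "\<And>x. x \<in> X \<Longrightarrow> f (k x) = x"
    using assms by (auto simp: homeomorphism_def)
  have "f (u \<i>) \<in> u ` \<H>" using f(2) u_in[OF UHP(4)] u_image by blast
  then obtain a where a: "a \<in> \<H>" "u a = f (u \<i>)" by (metis imageE)
  obtain f' where f': "continuous_on \<H> f'" "f' ` \<H> \<subseteq> \<H>" "f' \<i> = a" "\<And>y. y \<in> \<H> \<Longrightarrow> u (f' y) = f (u y)"
    using map_lift[OF f(1,2) UHP(4) a] by blast
  have "u \<i> = k (u a)" using a(2) f(5) u_in[OF UHP(4)] by simp
  then obtain k' where k': "continuous_on \<H> k'" "k' ` \<H> \<subseteq> \<H>" "k' a = \<i>" "\<And>y. y \<in> \<H> \<Longrightarrow> u (k' y) = k (u y)"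
    using map_lift[OF f(3,4) a(1) UHP(4)] by blast
  have "homeomorphism \<H> \<H> f' k'"
  proof (rule homeomorphism_lift[OF f'(1,2) k'(1,2) _ _ UHP(4)])
    fix z assume z: "z \<in> \<H>"
    then have "f' z \<in> \<H>" "k' z \<in> \<H>" using f'(2) k'(2) by auto
    then show "(p \<circ> u) (k' (f' z)) = (p \<circ> u) z" "(p \<circ> u) (f' (k' z)) = (p \<circ> u) z"
      using z u_in[OF z] by (simp_all add: f'(4) k'(4) f(5,6))
  qed (simp add: f'(3) k'(3))
  then show ?thesis using f'(4) k'(4) by blast
qed

text \<open>Values are read off at chosen preimages; the result is continuous because
  \<open>u\<close> is a quotient map.\<close>

lemma map_descend:
  assumes f': "continuous_on \<H> f'" "f' ` \<H> \<subseteq> \<H>"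
    and u: "\<And>z z'. z \<in> \<H> \<Longrightarrow> z' \<in> \<H> \<Longrightarrow> u z = u z' \<Longrightarrow> u (f' z) = u (f' z')"
  shows "\<exists>f\<in>extensional X. continuous_on X f \<and> f ` X \<subseteq> X \<and> (\<forall>z\<in>\<H>. f (u z) = u (f' z))"
proof -
  define f where "f = (\<lambda>x\<in>X. u (f' (inv_into \<H> u x)))"
  have f: "f (u z) = u (f' z)" if "z \<in> \<H>" for z
    using u[of "inv_into \<H> u (u z)" z] that
    by (simp add: f_def u_in inv_into_into f_inv_into_f)
  have "continuous_on \<H> (u \<circ> f')"
    using f' by (intro continuous_on_compose continuous_on_subset[OF cont_u])
  then have "continuous_on \<H> (f \<circ> u)"
    by (rule continuous_on_eq) (simp add: f)
  then have "continuous_on X f" by (rule covering_space_continuous_on_descend[OF cov_u])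
  moreover have "f ` X \<subseteq> X" using f f'(2) u_in by (auto simp flip: u_image)
  ultimately show ?thesis using f by (intro bexI[of _ f]) (auto simp: f_def)
qed

abbreviation H_X where "H_X \<equiv> origami_subgroup u \<Phi>"

lemma mem_H: "w \<in> H_X \<longleftrightarrow> w \<in> carrier F2 \<and> (\<forall>z\<in>\<H>. u (\<Phi> w z) = u z)"
  unfolding origami_subgroup_def using \<Phi>_deck[of w] by (auto simp: mem_deck_group)

text \<open>A deck transformation of \<open>p \<circ> u\<close> moves \<open>z\<close> to
  \<open>z'\<close>. It preserves \<open>u\<close> everywhere, because \<open>u\<close> and its
  composite with this transformation are lifts along \<open>p\<close> that agree at
  \<open>z\<close>.\<close>

lemma fibre_H:
  assumes "z \<in> \<H>" "z' \<in> \<H>" "u z = u z'"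
  shows "\<exists>w\<in>H_X. z' = \<Phi> w z"
proof -
  have "(p \<circ> u) z = (p \<circ> u) z'" using assms by simp
  then obtain w where w: "w \<in> carrier F2" "\<Phi> w z = z'"
    using deck_transitive[OF assms(1,2)] \<Phi>_surj by metis
  note g = deck_homeo[OF \<Phi>_deck[OF w(1)]]
  have "(u \<circ> \<Phi> w) y = u y" if "y \<in> \<H>" for y
  proof (rule u_lift_eq[OF _ _ cont_u _ _ assms(1) _ that])
    show "continuous_on \<H> (u \<circ> \<Phi> w)" using g by (intro continuous_on_compose continuous_on_subset[OF cont_u])
  qed (use g assms w u_in in auto)
  then show ?thesis using w by (auto simp: mem_H)
qed

section \<open>The two inclusions between the Veech group and the image of the stabilizer\<close>

lemma veech_subset: "veech_group X Atlas \<subseteq> hat_beta ` Aff_plus_subgroup H_X"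
proof
  fix A assume "A \<in> veech_group X Atlas"
  then obtain f where f: "f \<in> Aff_plus X Atlas" "A = der X Atlas f" unfolding veech_group_def by blast
  obtain k where k: "homeomorphism X X f k" using f(1) by (auto simp: Aff_plus_def self_homeos_iff)
  obtain f' k' where f': "homeomorphism \<H> \<H> f' k'" "\<And>z. z \<in> \<H> \<Longrightarrow> u (f' z) = f (u z)"
      "\<And>z. z \<in> \<H> \<Longrightarrow> u (k' z) = k (u z)"
    using homeomorphism_X_lift[OF k] by blast
  have f'': "continuous_on \<H> f'" "f' ` \<H> \<subseteq> \<H>" using f'(1) by (auto simp: homeomorphism_def)
  have fX: "f x \<in> X" "k (f x) = x" if "x \<in> X" for x using k that by (auto simp: homeomorphism_def)
  have kX: "f (k x) = x" if "x \<in> X" for x using k that by (auto simp: homeomorphism_def)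
  have f'_in: "f' z \<in> \<H>" "k' z \<in> \<H>" "k' (f' z) = z" if "z \<in> \<H>" for z
    using f'(1) that by (auto simp: homeomorphism_def)
  have "\<exists>B. det B > 0 \<and> locally_affine f' z B" if z: "z \<in> \<H>" for z
  proof -
    obtain c c' where c: "c \<in> Atlas" "u z \<in> fst c" "c' \<in> Atlas" "f (u z) \<in> fst c'"
      using ex_chart u_in[OF z] fX(1) by meson
    then obtain B where "det B > 0" "affine_near X c c' f (u z) B"
      using f(1) unfolding Aff_plus_def by blast
    then show ?thesis
      using affine_near_imp_locally_affine[OF f'' f'(2) c(1,3) z c(2,4)] by blast
  qed
  then obtain B where B: "det B > 0" "dev_affine B f'"
    using locally_affine_imp_dev_affine[OF f'' f'(2)] by blast
  have AB: "A = B" using der_eq[OF f'' f'(2) B(2)] f(2) by simp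
  have "B \<in> SL2Z" using dev_affine_SL2Z[OF B(2) _ B(1)] f'(1) by (auto simp: homeomorphism_def)
  note B' = B(2) f'(1) this
  define \<gamma> where "\<gamma> = conj_aut f' k'"
  have \<gamma>: "\<Phi> (\<gamma> w) z = f' (\<Phi> w (k' z))" if "w \<in> carrier F2" "z \<in> \<H>" for w z
    using \<Phi>_conj_aut[OF B' that(1)] that(2) by (simp add: \<gamma>_def)
  \<comment> \<open>Elements of \<open>H_X\<close> are those whose deck transformation covers the
    identity of the origami, and conjugation by \<open>f'\<close> covers conjugation by
    \<open>f\<close>.\<close>
  have iff: "\<gamma> w \<in> H_X \<longleftrightarrow> w \<in> H_X" if w: "w \<in> carrier F2" for w
  proof
    assume "w \<in> H_X"
    have "u (\<Phi> (\<gamma> w) z) = u z" if z: "z \<in> \<H>" for z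
    proof -
      have "u (\<Phi> (\<gamma> w) z) = f (u (\<Phi> w (k' z)))" using w z f'_in by (simp add: \<gamma> f'(2) \<Phi>_image)
      also have "\<dots> = u z" using \<open>w \<in> H_X\<close> z f'_in(2) by (simp add: mem_H f'(3) kX u_in)
      finally show ?thesis .
    qed
    then show "\<gamma> w \<in> H_X" using conj_aut_carrier[OF B' w] by (simp add: mem_H \<gamma>_def)
  next
    assume "\<gamma> w \<in> H_X"
    have "u (\<Phi> w z) = u z" if z: "z \<in> \<H>" for z
    proof -
      have "f (u (\<Phi> w z)) = u (\<Phi> (\<gamma> w) (f' z))" using w z f'_in by (simp add: \<gamma> f'(2) \<Phi>_image)
      also have "\<dots> = f (u z)" using \<open>\<gamma> w \<in> H_X\<close> z f'_in(1) by (simp add: mem_H f'(2))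
      finally show ?thesis using fX(2) u_in \<Phi>_image[OF w z] z by metis
    qed
    then show "w \<in> H_X" using w by (simp add: mem_H)
  qed
  have auto: "\<gamma> \<in> auto F2" unfolding \<gamma>_def by (rule conj_aut_auto[OF B'])
  have surj: "\<gamma> ` carrier F2 = carrier F2" using auto by (auto simp: auto_def Bij_def bij_betw_def)
  have "\<gamma> ` H_X = H_X"
  proof (intro equalityI subsetI)
    fix v assume v: "v \<in> H_X"
    then have "v \<in> \<gamma> ` carrier F2" using surj by (simp add: mem_H)
    then show "v \<in> \<gamma> ` H_X" using v iff by auto
  next
    fix v assume "v \<in> \<gamma> ` H_X"
    then obtain w where "w \<in> H_X" "v = \<gamma> w" by blast
    then show "v \<in> H_X" using iff[of w] mem_H[of w] by blast
  qed
  moreover have "hat_beta \<gamma> = A" unfolding \<gamma>_def AB by (rule hat_beta_conj_aut[OF B'])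
  moreover have "det A = 1" using B'(3) AB by (simp add: SL2Z_def)
  ultimately have "\<gamma> \<in> Aff_plus_subgroup H_X" "A = hat_beta \<gamma>"
    using auto by (auto simp: Aff_plus_subgroup_def Aut_plus_F2_def)
  then show "A \<in> hat_beta ` Aff_plus_subgroup H_X" by blast
qed

lemma veech_supset: "hat_beta ` Aff_plus_subgroup H_X \<subseteq> veech_group X Atlas"
proof
  fix A assume "A \<in> hat_beta ` Aff_plus_subgroup H_X"
  then obtain \<gamma> where \<gamma>: "\<gamma> \<in> Aut_plus_F2" "\<gamma> ` H_X = H_X" "A = hat_beta \<gamma>"
    by (auto simp: Aff_plus_subgroup_def)
  obtain f' k' where f': "homeomorphism \<H> \<H> f' k'" "dev_affine A f'"
    "\<And>w z. w \<in> carrier F2 \<Longrightarrow> z \<in> \<H> \<Longrightarrow> f' (\<Phi> w z) = \<Phi> (\<gamma> w) (f' z)"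
    using automorphism_realization[OF \<gamma>(1)] \<gamma>(3) by metis
  have cont: "continuous_on \<H> f'" "f' ` \<H> \<subseteq> \<H>" "continuous_on \<H> k'" "k' ` \<H> \<subseteq> \<H>"
    using f'(1) by (auto simp: homeomorphism_def)
  have f'_in: "f' z \<in> \<H>" "k' z \<in> \<H>" "k' (f' z) = z" "f' (k' z) = z" if "z \<in> \<H>" for z
    using f'(1) that by (auto simp: homeomorphism_def)
  \<comment> \<open>Equivariance and \<gamma> mapping \<open>H_X\<close> into itself let
    \<open>f'\<close> descend.\<close>
  have "u (f' z) = u (f' z')" if z: "z \<in> \<H>" "z' \<in> \<H>" "u z = u z'" for z z'
  proof -
    obtain w where w: "w \<in> H_X" "z' = \<Phi> w z" using fibre_H[OF z] by blast
    then have "\<gamma> w \<in> H_X" "f' z' = \<Phi> (\<gamma> w) (f' z)" using \<gamma>(2) f'(3)[OF _ z(1), of w] mem_H by blast+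
    then show ?thesis using f'_in(1)[OF z(1)] by (simp add: mem_H)
  qed
  then obtain f where f: "f \<in> extensional X" "continuous_on X f" "f ` X \<subseteq> X" "\<And>z. z \<in> \<H> \<Longrightarrow> f (u z) = u (f' z)"
    using map_descend[OF cont(1,2)] by blast
  \<comment> \<open>For the inverse, surjectivity of \<gamma> on \<open>H_X\<close> is used.\<close>
  have "u (k' z) = u (k' z')" if z: "z \<in> \<H>" "z' \<in> \<H>" "u z = u z'" for z z'
  proof -
    obtain w where w: "w \<in> H_X" "z' = \<Phi> w z" using fibre_H[OF z] by blast
    then obtain v where v: "v \<in> H_X" "w = \<gamma> v" using \<gamma>(2) by blast
    then have "f' (\<Phi> v (k' z)) = z'"
      using f'(3)[of v "k' z"] f'_in(2,4)[OF z(1)] w(2) by (simp add: mem_H)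
    then have "k' z' = \<Phi> v (k' z)"
      using f'_in(3)[of "\<Phi> v (k' z)"] \<Phi>_image f'_in(2)[OF z(1)] v(1) by (auto simp: mem_H)
    then show ?thesis using v(1) f'_in(2)[OF z(1)] by (simp add: mem_H)
  qed
  then obtain k where k: "continuous_on X k" "k ` X \<subseteq> X" "\<And>z. z \<in> \<H> \<Longrightarrow> k (u z) = u (k' z)"
    using map_descend[OF cont(3,4)] by blast
  have "homeomorphism X X f k"
  proof (rule homeomorphismI[OF f(2) k(1) f(3) k(2)])
    fix x assume "x \<in> X"
    then have "x \<in> u ` \<H>" by (simp add: u_image)
    then obtain z where z: "z \<in> \<H>" "x = u z" by blast
    then show "k (f x) = x" "f (k x) = x" by (simp_all add: f(4) k(3) f'_in)
  qed
  then have "f \<in> self_homeos X" using f(1) by (auto simp: self_homeos_iff)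
  moreover have "\<exists>B. det B > 0 \<and> affine_near X c c' f y B"
    if c: "c \<in> Atlas" "c' \<in> Atlas" "y \<in> fst c" "f y \<in> fst c'" for c c' y
  proof -
    have "y \<in> u ` \<H>" using c chart_subset u_image by blast
    then obtain z where z: "z \<in> \<H>" "y = u z" by blast
    have "affine_near X c c' f (u z) A"
      by (rule dev_affine_imp_affine_near[OF cont(1,2) _ c(1,2) z(1) _ _ f'(2)]) (use f(4) c z in auto)
    moreover have "det A > 0" using \<gamma>(1,3) by (simp add: Aut_plus_F2_def)
    ultimately show ?thesis using z by blast
  qed
  ultimately have "f \<in> Aff_plus X Atlas" by (auto simp: Aff_plus_def)
  moreover have "der X Atlas f = A"
    by (rule der_eq[OF cont(1,2) _ f'(2)]) (simp add: f(4))
  ultimately show "A \<in> veech_group X Atlas" unfolding veech_group_def by blast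
qed

end

theorem proposition1:
  fixes X :: "'a::topological_space set"
    and p :: "'a \<Rightarrow> torus"
    and u :: "complex \<Rightarrow> 'a"
    and \<Phi> :: "letter list \<Rightarrow> complex \<Rightarrow> complex"
    and H :: "letter list set"
    and d :: nat
  assumes "origami d X p"
    and "covering_space upper_half_plane u X"
    and "canonical_marking (p \<circ> u) \<Phi>"
    and "H = origami_subgroup u \<Phi>"
  shows "veech_group X (origami_atlas X p) = hat_beta ` Aff_plus_subgroup H \<and>
         hat_beta ` Aff_plus_subgroup H \<subseteq> SL2Z"
proof -
  \<comment> \<open>Fibres are finite since their \<open>card\<close> is \<open>d > 0\<close>, while
    infinite sets have \<open>card\<close> 0.\<close>
  have cov_p: "covering_space X p E_star" and fin: "\<And>e. e \<in> E_star \<Longrightarrow> finite {x \<in> X. p x = e}"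
    using assms(1) unfolding origami_def by (auto intro: card_ge_0_finite)
  have cov: "covering_space \<H> (p \<circ> u) E_star"
    by (rule covering_space_compose_finite[OF assms(2) cov_p fin])
  obtain D where D: "continuous_on \<H> D" "\<And>z. z \<in> \<H> \<Longrightarrow> to_torus (D z) = (p \<circ> u) z"
    using torus_map_lift[OF UHP(1) covering_space_imp_continuous[OF cov]]
      covering_space_imp_surjective[OF cov] by (metis order_refl)
  interpret developed_cover "p \<circ> u" D
    by unfold_locales (use cov D in auto)
  obtain Q z where \<Phi>: "\<Phi> \<in> iso F2 Deck" and z: "z \<in> \<H>"
      "is_lift_from_to (p \<circ> u) (to_torus \<circ> linepath Q (Q + 1)) z (\<Phi> [(GX, True)] z)"
      "is_lift_from_to (p \<circ> u) (to_torus \<circ> linepath Q (Q + \<i>)) z (\<Phi> [(GY, True)] z)"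
    using assms(3) unfolding canonical_marking_def by blast
  have deck: "\<Phi> [a] \<in> carrier Deck" for a using \<Phi> letter_in_F2 by (auto simp: iso_iff)
  interpret origami_cover p u D \<Phi> X
    by unfold_locales
      (use \<Phi> cov_p assms(2) hol_lift[OF z(2) deck z(1)] hol_lift[OF z(3) deck z(1)] in auto)
  have "hat_beta ` Aff_plus_subgroup H \<subseteq> SL2Z"
    using hat_beta_SL2Z by (auto simp: Aff_plus_subgroup_def)
  then show ?thesis using veech_subset veech_supset assms(4) by blast
qed

end
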